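(* Let $n\ge 3$ and let $(M^n,\mathcal E,\langle\ ,\ \rangle,D,\varphi)$ be a GCF-manifold, let $g=\varphi^*\langle\ ,\ \rangle$ be the induced metric (a Riemannian metric on the set $\mathcal R_{M^n}$ of regular points of $\varphi$), and let $A=\sum A_{ij}\,du^i\otimes du^j$ be the Schouten tensor of $g$ on $\mathcal R_{M^n}$. Let $\mathcal R^*_{M^n}\subset\mathcal R_{M^n}$ be the set of regular points at which $A$ is non-degenerate. Then $$\check g:=\sum_{i,j,a,b}A_{ia}A_{jb}\,g^{ab}\,du^i\otimes du^j$$ is a conformally flat Riemannian metric on $\mathcal R^*_{M^n}$, where $(u^1,\dots,u^n)$ is a local coordinate system and $(g^{ab})$ is the inverse matrix of $(g_{ij})$. Moreover, the Schouten tensor of $\check g$ coincides with $A$ on $\mathcal R^*_{M^n}$.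
   Context: All manifolds, bundles and maps are $C^\infty$. A coherent tangent bundle over an $n$-manifold $M^n$ is a tuple $(M^n,\mathcal E,\langle\ ,\ \rangle,D,\varphi)$, where $\mathcal E$ is a rank $n$ real vector bundle over $M^n$ with a positive definite fibre metric $\langle\ ,\ \rangle$ and a metric connection $D$, and $\varphi:TM^n\to\mathcal E$ is a bundle homomorphism (over the identity) such that $D_X\varphi(Y)-D_Y\varphi(X)-\varphi([X,Y])=0$ for all vector fields $X,Y$ on $M^n$. A point $p$ is regular if $\varphi_p:T_pM^n\to\mathcal E_p$ is injective, and singular otherwise; $\mathcal R_{M^n}$ is the set of regular points. On $\mathcal R_{M^n}$, $g:=\varphi^*\langle\ ,\ \rangle$ is a Riemannian metric. A Riemannian metric $g$ is conformally flat if every point has a neighborhood $U$ and $\sigma\in C^\infty(U)$ such that $e^{2\sigma}g$ has vanishing sectional curvature. For $n\ge 3$, a coherent tangent bundle is a generalized conformally flat manifold (GCF-manifold) if $\mathcal R_{M^n}$ is dense in $M^n$ and $g$ is conformally flat on $\mathcal R_{M^n}$. The Schouten tensor of a Riemannian metric $g$ in dimension $n\ge3$ is $A=\frac{1}{n-2}\left(\mathrm{Ric}_g-\frac{S_g}{2(n-1)}g\right)$, where $\mathrm{Ric}_g$ is the Ricci tensor (normalized so that the unit $n$-sphere has $\mathrm{Ric}_g=(n-1)g$) and $S_g$ is the scalar curvature. *)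

theory Defs
  imports "HOL-Analysis.Analysis"
begin

section \<open>Smooth maps between normed spaces\<close>

fun Ck_on :: "nat \<Rightarrow> 'a::real_normed_vector set \<Rightarrow> ('a \<Rightarrow> 'b::real_normed_vector) \<Rightarrow> bool" where
  "Ck_on 0 S f \<longleftrightarrow> continuous_on S f"
| "Ck_on (Suc k) S f \<longleftrightarrow>
     (\<forall>x\<in>S. f differentiable (at x)) \<and> (\<forall>v. Ck_on k S (\<lambda>x. frechet_derivative f (at x) v))"

text \<open>Used for open \<open>S\<close> only. The values of \<open>f\<close> outside \<open>S\<close> are then irrelevant.\<close>

definition smooth_on :: "'a::real_normed_vector set \<Rightarrow> ('a \<Rightarrow> 'b::real_normed_vector) \<Rightarrow> bool" where
  "smooth_on S f \<longleftrightarrow> (\<forall>k. Ck_on k S f)"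

section \<open>Smooth manifolds\<close>

text \<open>
  The manifold is the whole type \<open>'m\<close>, a Hausdorff second countable space, together with a
  maximal smooth atlas modelled on \<open>real ^ 'n\<close>. A chart is a pair of a domain and a coordinate
  map; the values of the coordinate map outside the domain carry no information.
\<close>

type_synonym ('m, 'n) chart = "'m set \<times> ('m \<Rightarrow> real ^ 'n)"

definition cdom :: "('m, 'n) chart \<Rightarrow> 'm set" where
  "cdom c = fst c"

definition coord :: "('m, 'n) chart \<Rightarrow> 'm \<Rightarrow> real ^ 'n" where
  "coord c = snd c"

definition param :: "('m, 'n) chart \<Rightarrow> real ^ 'n \<Rightarrow> 'm" where
  "param c = inv_into (cdom c) (coord c)"

definition is_chart :: "('m::topological_space, 'n::finite) chart \<Rightarrow> bool" where
  "is_chart c \<longleftrightarrow> open (cdom c) \<and> open (coord c ` cdom c) \<and>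
     homeomorphism (cdom c) (coord c ` cdom c) (coord c) (param c)"

definition compatible :: "('m, 'n::finite) chart \<Rightarrow> ('m, 'n) chart \<Rightarrow> bool" where
  "compatible c c' \<longleftrightarrow>
     smooth_on (coord c ` (cdom c \<inter> cdom c')) (\<lambda>y. coord c' (param c y)) \<and>
     smooth_on (coord c' ` (cdom c \<inter> cdom c')) (\<lambda>y. coord c (param c' y))"

definition smooth_structure ::
    "('m::{t2_space, second_countable_topology}, 'n::finite) chart set \<Rightarrow> bool" where
  "smooth_structure \<A> \<longleftrightarrow>
     (\<Union>c\<in>\<A>. cdom c) = UNIV \<and>
     (\<forall>c\<in>\<A>. is_chart c) \<and>
     (\<forall>c\<in>\<A>. \<forall>c'\<in>\<A>. compatible c c') \<and>
     (\<forall>c. is_chart c \<longrightarrow> (\<forall>c'\<in>\<A>. compatible c c') \<longrightarrow> c \<in> \<A>)"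

definition charts_at :: "('m, 'n) chart set \<Rightarrow> 'm \<Rightarrow> ('m, 'n) chart set" where
  "charts_at \<A> p = {c \<in> \<A>. p \<in> cdom c}"

definition smooth_map_on ::
    "('m, 'n::finite) chart set \<Rightarrow> 'm set \<Rightarrow> ('m \<Rightarrow> 'b::real_normed_vector) \<Rightarrow> bool" where
  "smooth_map_on \<A> W f \<longleftrightarrow> (\<forall>c\<in>\<A>. smooth_on (coord c ` (cdom c \<inter> W)) (\<lambda>y. f (param c y)))"

text \<open>
  The common value of \<open>F c\<close> over all charts \<open>c\<close> about \<open>p\<close>: a quantity given by an expression in
  local coordinates that does not depend on the coordinates.
\<close>

definition chart_invariant ::
    "('m, 'n) chart set \<Rightarrow> 'm \<Rightarrow> (('m, 'n) chart \<Rightarrow> real) \<Rightarrow> real" where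
  "chart_invariant \<A> p F = (THE r. \<forall>c\<in>charts_at \<A> p. F c = r)"

section \<open>Tangent vectors and vector fields\<close>

text \<open>
  A tangent vector at \<open>p\<close> is the family of its component vectors in all charts about \<open>p\<close>,
  transforming by the Jacobian matrices of the coordinate changes. Components in charts that do
  not contain \<open>p\<close> are set to zero, so that equal tangent vectors are equal functions.
\<close>

type_synonym ('m, 'n) tvec = "('m, 'n) chart \<Rightarrow> real ^ 'n"

definition transition_deriv ::
    "('m, 'n::finite) chart \<Rightarrow> ('m, 'n) chart \<Rightarrow> 'm \<Rightarrow> real ^ 'n \<Rightarrow> real ^ 'n" where
  "transition_deriv c c' p = frechet_derivative (\<lambda>y. coord c' (param c y)) (at (coord c p))"

definition tangent_space :: "('m, 'n::finite) chart set \<Rightarrow> 'm \<Rightarrow> ('m, 'n) tvec set" where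
  "tangent_space \<A> p =
     {X. (\<forall>c\<in>charts_at \<A> p. \<forall>c'\<in>charts_at \<A> p. X c' = transition_deriv c c' p (X c)) \<and>
         (\<forall>c. c \<notin> charts_at \<A> p \<longrightarrow> X c = 0)}"

definition tadd :: "('m, 'n::finite) tvec \<Rightarrow> ('m, 'n) tvec \<Rightarrow> ('m, 'n) tvec" where
  "tadd X Y = (\<lambda>c. X c + Y c)"

definition tscale :: "real \<Rightarrow> ('m, 'n::finite) tvec \<Rightarrow> ('m, 'n) tvec" where
  "tscale r X = (\<lambda>c. r *\<^sub>R X c)"

text \<open>The coordinate vector $\partial/\partial u^i$ of the chart \<open>c\<close> at \<open>p\<close>.\<close>

definition coord_vec ::
    "('m, 'n::finite) chart set \<Rightarrow> ('m, 'n) chart \<Rightarrow> 'm \<Rightarrow> 'n \<Rightarrow> ('m, 'n) tvec" where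
  "coord_vec \<A> c p i =
     (\<lambda>c'. if c' \<in> charts_at \<A> p then transition_deriv c c' p (axis i 1) else 0)"

definition vector_fields :: "('m, 'n::finite) chart set \<Rightarrow> ('m \<Rightarrow> ('m, 'n) tvec) set" where
  "vector_fields \<A> =
     {X. (\<forall>p. X p \<in> tangent_space \<A> p) \<and>
         (\<forall>c\<in>\<A>. smooth_on (coord c ` cdom c) (\<lambda>y. X (param c y) c))}"

definition dir_deriv ::
    "('m, 'n::finite) chart set \<Rightarrow> 'm \<Rightarrow> ('m, 'n) tvec \<Rightarrow> ('m \<Rightarrow> real) \<Rightarrow> real" where
  "dir_deriv \<A> p X f =
     chart_invariant \<A> p
       (\<lambda>c. frechet_derivative (\<lambda>y. f (param c y)) (at (coord c p)) (X c))"

definition lie_bracket ::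
    "('m, 'n::finite) chart set \<Rightarrow> ('m \<Rightarrow> ('m, 'n) tvec) \<Rightarrow> ('m \<Rightarrow> ('m, 'n) tvec)
       \<Rightarrow> 'm \<Rightarrow> ('m, 'n) tvec" where
  "lie_bracket \<A> X Y p =
     (\<lambda>c. if c \<in> charts_at \<A> p
          then frechet_derivative (\<lambda>y. Y (param c y) c) (at (coord c p)) (X p c)
             - frechet_derivative (\<lambda>y. X (param c y) c) (at (coord c p)) (Y p c)
          else 0)"

section \<open>Vector bundles\<close>

text \<open>
  The fibres of a vector bundle are linear subspaces \<open>E p\<close> of one real vector space \<open>'e\<close>, not
  assumed disjoint; the total space is \<open>SIGMA p:UNIV. E p\<close>. This loses no generality, as any
  family of vector spaces embeds in its direct sum. The smooth structure is given by a set of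
  local trivialisations \<open>(V, \<tau>)\<close>, where \<open>\<tau> p\<close> is a linear isomorphism from \<open>E p\<close> onto \<open>real ^ 'k\<close>
  for every \<open>p \<in> V\<close>.
\<close>

type_synonym ('m, 'e, 'k) trivialisation = "'m set \<times> ('m \<Rightarrow> 'e \<Rightarrow> real ^ 'k)"

definition vector_bundle ::
    "('m::topological_space, 'n::finite) chart set \<Rightarrow> ('m \<Rightarrow> 'e::real_vector set)
       \<Rightarrow> ('m, 'e, 'k::finite) trivialisation set \<Rightarrow> bool" where
  "vector_bundle \<A> E \<T> \<longleftrightarrow>
     (\<forall>p. subspace (E p)) \<and>
     (\<Union>(V, \<tau>)\<in>\<T>. V) = UNIV \<and>
     (\<forall>(V, \<tau>)\<in>\<T>. open V \<and>
        (\<forall>p\<in>V. bij_betw (\<tau> p) (E p) UNIV \<and>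
           (\<forall>a\<in>E p. \<forall>b\<in>E p. \<tau> p (a + b) = \<tau> p a + \<tau> p b) \<and>
           (\<forall>a\<in>E p. \<forall>r. \<tau> p (r *\<^sub>R a) = r *\<^sub>R \<tau> p a))) \<and>
     (\<forall>(V, \<tau>)\<in>\<T>. \<forall>(V', \<tau>')\<in>\<T>. \<forall>v.
        smooth_map_on \<A> (V \<inter> V') (\<lambda>p. \<tau>' p (inv_into (E p) (\<tau> p) v)))"

definition smooth_sections ::
    "('m, 'n::finite) chart set \<Rightarrow> ('m \<Rightarrow> 'e set)
       \<Rightarrow> ('m, 'e, 'k::finite) trivialisation set \<Rightarrow> ('m \<Rightarrow> 'e) set" where
  "smooth_sections \<A> E \<T> =
     {s. (\<forall>p. s p \<in> E p) \<and> (\<forall>(V, \<tau>)\<in>\<T>. smooth_map_on \<A> V (\<lambda>p. \<tau> p (s p)))}"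

definition fibre_metric ::
    "('m, 'n::finite) chart set \<Rightarrow> ('m \<Rightarrow> 'e::real_vector set)
       \<Rightarrow> ('m, 'e, 'k::finite) trivialisation set \<Rightarrow> ('m \<Rightarrow> 'e \<Rightarrow> 'e \<Rightarrow> real) \<Rightarrow> bool" where
  "fibre_metric \<A> E \<T> ip \<longleftrightarrow>
     (\<forall>p. \<forall>a\<in>E p. \<forall>b\<in>E p. \<forall>d\<in>E p. \<forall>r.
        ip p a b = ip p b a \<and>
        ip p (a + b) d = ip p a d + ip p b d \<and>
        ip p (r *\<^sub>R a) d = r * ip p a d) \<and>
     (\<forall>p. \<forall>a\<in>E p. a \<noteq> 0 \<longrightarrow> ip p a a > 0) \<and>
     (\<forall>(V, \<tau>)\<in>\<T>. \<forall>v w.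
        smooth_map_on \<A> V
          (\<lambda>p. ip p (inv_into (E p) (\<tau> p) v) (inv_into (E p) (\<tau> p) w)))"

text \<open>
  A connection acts on global vector fields and global sections; its values on other arguments
  are irrelevant. Linearity over \<open>real\<close> in the section is the Leibniz rule for constant \<open>f\<close>.
\<close>

definition connection ::
    "('m, 'n::finite) chart set \<Rightarrow> ('m \<Rightarrow> 'e::real_vector set)
       \<Rightarrow> ('m, 'e, 'k::finite) trivialisation set
       \<Rightarrow> (('m \<Rightarrow> ('m, 'n) tvec) \<Rightarrow> ('m \<Rightarrow> 'e) \<Rightarrow> 'm \<Rightarrow> 'e) \<Rightarrow> bool" where
  "connection \<A> E \<T> D \<longleftrightarrow>
     (\<forall>X\<in>vector_fields \<A>. \<forall>s\<in>smooth_sections \<A> E \<T>. D X s \<in> smooth_sections \<A> E \<T>) \<and>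
     (\<forall>X\<in>vector_fields \<A>. \<forall>Y\<in>vector_fields \<A>. \<forall>s\<in>smooth_sections \<A> E \<T>. \<forall>p.
        D (\<lambda>q. tadd (X q) (Y q)) s p = D X s p + D Y s p) \<and>
     (\<forall>X\<in>vector_fields \<A>. \<forall>s\<in>smooth_sections \<A> E \<T>. \<forall>t\<in>smooth_sections \<A> E \<T>. \<forall>p.
        D X (\<lambda>q. s q + t q) p = D X s p + D X t p) \<and>
     (\<forall>X\<in>vector_fields \<A>. \<forall>s\<in>smooth_sections \<A> E \<T>. \<forall>f. smooth_map_on \<A> UNIV f \<longrightarrow>
        (\<forall>p. D (\<lambda>q. tscale (f q) (X q)) s p = f p *\<^sub>R D X s p \<and>
             D X (\<lambda>q. f q *\<^sub>R s q) p = dir_deriv \<A> p (X p) f *\<^sub>R s p + f p *\<^sub>R D X s p))"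

definition metric_connection ::
    "('m, 'n::finite) chart set \<Rightarrow> ('m \<Rightarrow> 'e::real_vector set)
       \<Rightarrow> ('m, 'e, 'k::finite) trivialisation set \<Rightarrow> ('m \<Rightarrow> 'e \<Rightarrow> 'e \<Rightarrow> real)
       \<Rightarrow> (('m \<Rightarrow> ('m, 'n) tvec) \<Rightarrow> ('m \<Rightarrow> 'e) \<Rightarrow> 'm \<Rightarrow> 'e) \<Rightarrow> bool" where
  "metric_connection \<A> E \<T> ip D \<longleftrightarrow> connection \<A> E \<T> D \<and>
     (\<forall>X\<in>vector_fields \<A>. \<forall>s\<in>smooth_sections \<A> E \<T>. \<forall>t\<in>smooth_sections \<A> E \<T>. \<forall>p.
        dir_deriv \<A> p (X p) (\<lambda>q. ip q (s q) (t q)) = ip p (D X s p) (t p) + ip p (s p) (D X t p))"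

definition tangent_bundle_hom ::
    "('m, 'n::finite) chart set \<Rightarrow> ('m \<Rightarrow> 'e::real_vector set)
       \<Rightarrow> ('m, 'e, 'k::finite) trivialisation set \<Rightarrow> ('m \<Rightarrow> ('m, 'n) tvec \<Rightarrow> 'e) \<Rightarrow> bool" where
  "tangent_bundle_hom \<A> E \<T> \<phi> \<longleftrightarrow>
     (\<forall>p. \<forall>X\<in>tangent_space \<A> p. \<forall>Y\<in>tangent_space \<A> p. \<forall>r.
        \<phi> p X \<in> E p \<and>
        \<phi> p (tadd X Y) = \<phi> p X + \<phi> p Y \<and>
        \<phi> p (tscale r X) = r *\<^sub>R \<phi> p X) \<and>
     (\<forall>c\<in>\<A>. \<forall>(V, \<tau>)\<in>\<T>. \<forall>i.
        smooth_map_on \<A> (cdom c \<inter> V) (\<lambda>p. \<tau> p (\<phi> p (coord_vec \<A> c p i))))"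

section \<open>Coherent tangent bundles\<close>

definition coherent_tangent_bundle ::
    "('m::{t2_space, second_countable_topology}, 'n::finite) chart set
       \<Rightarrow> ('m \<Rightarrow> 'e::real_vector set) \<Rightarrow> ('m, 'e, 'n) trivialisation set
       \<Rightarrow> ('m \<Rightarrow> 'e \<Rightarrow> 'e \<Rightarrow> real)
       \<Rightarrow> (('m \<Rightarrow> ('m, 'n) tvec) \<Rightarrow> ('m \<Rightarrow> 'e) \<Rightarrow> 'm \<Rightarrow> 'e)
       \<Rightarrow> ('m \<Rightarrow> ('m, 'n) tvec \<Rightarrow> 'e) \<Rightarrow> bool" where
  "coherent_tangent_bundle \<A> E \<T> ip D \<phi> \<longleftrightarrow>
     smooth_structure \<A> \<and>
     vector_bundle \<A> E \<T> \<and>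
     fibre_metric \<A> E \<T> ip \<and>
     metric_connection \<A> E \<T> ip D \<and>
     tangent_bundle_hom \<A> E \<T> \<phi> \<and>
     (\<forall>X\<in>vector_fields \<A>. \<forall>Y\<in>vector_fields \<A>. \<forall>p.
        D X (\<lambda>q. \<phi> q (Y q)) p - D Y (\<lambda>q. \<phi> q (X q)) p - \<phi> p (lie_bracket \<A> X Y p) = 0)"

definition regular_points ::
    "('m, 'n::finite) chart set \<Rightarrow> ('m \<Rightarrow> ('m, 'n) tvec \<Rightarrow> 'e) \<Rightarrow> 'm set" where
  "regular_points \<A> \<phi> = {p. inj_on (\<phi> p) (tangent_space \<A> p)}"

type_synonym ('m, 'n) tensor2 = "'m \<Rightarrow> ('m, 'n) tvec \<Rightarrow> ('m, 'n) tvec \<Rightarrow> real"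

definition induced_metric ::
    "('m \<Rightarrow> 'e \<Rightarrow> 'e \<Rightarrow> real) \<Rightarrow> ('m \<Rightarrow> ('m, 'n) tvec \<Rightarrow> 'e) \<Rightarrow> ('m, 'n) tensor2" where
  "induced_metric ip \<phi> = (\<lambda>p X Y. ip p (\<phi> p X) (\<phi> p Y))"

section \<open>Riemannian metrics and their curvature\<close>

text \<open>The component matrix at \<open>p\<close>, in the chart \<open>c\<close>, of a covariant 2-tensor.\<close>

definition comps ::
    "('m, 'n::finite) chart set \<Rightarrow> ('m, 'n) tensor2 \<Rightarrow> ('m, 'n) chart \<Rightarrow> 'm \<Rightarrow> real ^ 'n ^ 'n" where
  "comps \<A> h c p = (\<chi> i j. h p (coord_vec \<A> c p i) (coord_vec \<A> c p j))"

definition riemannian_metric_on ::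
    "('m::topological_space, 'n::finite) chart set \<Rightarrow> 'm set \<Rightarrow> ('m, 'n) tensor2 \<Rightarrow> bool" where
  "riemannian_metric_on \<A> W h \<longleftrightarrow>
     open W \<and>
     (\<forall>p\<in>W. \<forall>X\<in>tangent_space \<A> p. \<forall>Y\<in>tangent_space \<A> p. \<forall>Z\<in>tangent_space \<A> p. \<forall>r.
        h p X Y = h p Y X \<and>
        h p (tadd X Y) Z = h p X Z + h p Y Z \<and>
        h p (tscale r X) Z = r * h p X Z) \<and>
     (\<forall>p\<in>W. \<forall>X\<in>tangent_space \<A> p. X \<noteq> (\<lambda>c. 0) \<longrightarrow> h p X X > 0) \<and>
     (\<forall>c\<in>\<A>. smooth_map_on \<A> (cdom c \<inter> W) (comps \<A> h c))"

definition partial :: "'n::finite \<Rightarrow> (real ^ 'n \<Rightarrow> real) \<Rightarrow> real ^ 'n \<Rightarrow> real" where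
  "partial i F y = frechet_derivative F (at y) (axis i 1)"

text \<open>
  For a metric with component matrix \<open>G\<close> on an open set of \<open>real ^ 'n\<close>: the Christoffel symbols
  \<open>christoffel G k i j\<close>, with upper index \<open>k\<close>, and the components \<open>riemann_comp G l i j k\<close> of the
  curvature tensor, defined by
  $R(\partial_i, \partial_j)\partial_k = \sum_l R^l{}_{ijk}\,\partial_l$ with
  $R(X,Y) = [\nabla_X,\nabla_Y] - \nabla_{[X,Y]}$.
\<close>

definition christoffel ::
    "(real ^ 'n \<Rightarrow> real ^ 'n ^ 'n) \<Rightarrow> 'n::finite \<Rightarrow> 'n \<Rightarrow> 'n \<Rightarrow> real ^ 'n \<Rightarrow> real" where
  "christoffel G k i j y =
     (1 / 2) * (\<Sum>l\<in>UNIV. matrix_inv (G y) $ k $ l *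
       (partial i (\<lambda>z. G z $ j $ l) y + partial j (\<lambda>z. G z $ i $ l) y
          - partial l (\<lambda>z. G z $ i $ j) y))"

definition riemann_comp ::
    "(real ^ 'n \<Rightarrow> real ^ 'n ^ 'n) \<Rightarrow> 'n::finite \<Rightarrow> 'n \<Rightarrow> 'n \<Rightarrow> 'n \<Rightarrow> real ^ 'n \<Rightarrow> real" where
  "riemann_comp G l i j k y =
     partial i (christoffel G l j k) y - partial j (christoffel G l i k) y
     + (\<Sum>m\<in>UNIV. christoffel G l i m y * christoffel G m j k y
                 - christoffel G l j m y * christoffel G m i k y)"

definition curvature ::
    "('m, 'n::finite) chart set \<Rightarrow> ('m, 'n) tensor2
       \<Rightarrow> 'm \<Rightarrow> ('m, 'n) tvec \<Rightarrow> ('m, 'n) tvec \<Rightarrow> ('m, 'n) tvec \<Rightarrow> ('m, 'n) tvec" where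
  "curvature \<A> h p X Y Z =
     (\<lambda>c. if c \<in> charts_at \<A> p
          then \<chi> l. \<Sum>i\<in>UNIV. \<Sum>j\<in>UNIV. \<Sum>k\<in>UNIV.
                 riemann_comp (\<lambda>y. comps \<A> h c (param c y)) l i j k (coord c p)
                   * X c $ i * Y c $ j * Z c $ k
          else 0)"

definition sectional_curvature ::
    "('m, 'n::finite) chart set \<Rightarrow> ('m, 'n) tensor2
       \<Rightarrow> 'm \<Rightarrow> ('m, 'n) tvec \<Rightarrow> ('m, 'n) tvec \<Rightarrow> real" where
  "sectional_curvature \<A> h p X Y =
     h p (curvature \<A> h p X Y Y) X / (h p X X * h p Y Y - (h p X Y)\<^sup>2)"

definition vanishing_sectional_curvature_on ::
    "('m, 'n::finite) chart set \<Rightarrow> 'm set \<Rightarrow> ('m, 'n) tensor2 \<Rightarrow> bool" where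
  "vanishing_sectional_curvature_on \<A> U h \<longleftrightarrow>
     (\<forall>p\<in>U. \<forall>X\<in>tangent_space \<A> p. \<forall>Y\<in>tangent_space \<A> p.
        (\<forall>a b. tadd (tscale a X) (tscale b Y) = (\<lambda>c. 0) \<longrightarrow> a = 0 \<and> b = 0) \<longrightarrow>
        sectional_curvature \<A> h p X Y = 0)"

definition conformally_flat_on ::
    "('m::topological_space, 'n::finite) chart set \<Rightarrow> 'm set \<Rightarrow> ('m, 'n) tensor2 \<Rightarrow> bool" where
  "conformally_flat_on \<A> W h \<longleftrightarrow>
     (\<forall>p\<in>W. \<exists>U \<sigma>. open U \<and> p \<in> U \<and> U \<subseteq> W \<and> smooth_map_on \<A> U \<sigma> \<and>
        vanishing_sectional_curvature_on \<A> U (\<lambda>q X Y. exp (2 * \<sigma> q) * h q X Y))"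

definition gcf_manifold ::
    "('m::{t2_space, second_countable_topology}, 'n::finite) chart set
       \<Rightarrow> ('m \<Rightarrow> 'e::real_vector set) \<Rightarrow> ('m, 'e, 'n) trivialisation set
       \<Rightarrow> ('m \<Rightarrow> 'e \<Rightarrow> 'e \<Rightarrow> real)
       \<Rightarrow> (('m \<Rightarrow> ('m, 'n) tvec) \<Rightarrow> ('m \<Rightarrow> 'e) \<Rightarrow> 'm \<Rightarrow> 'e)
       \<Rightarrow> ('m \<Rightarrow> ('m, 'n) tvec \<Rightarrow> 'e) \<Rightarrow> bool" where
  "gcf_manifold \<A> E \<T> ip D \<phi> \<longleftrightarrow>
     coherent_tangent_bundle \<A> E \<T> ip D \<phi> \<and>
     closure (regular_points \<A> \<phi>) = UNIV \<and>
     conformally_flat_on \<A> (regular_points \<A> \<phi>) (induced_metric ip \<phi>)"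

text \<open>\<open>ricci \<A> h p Y Z\<close> is the trace of the endomorphism \<open>X \<mapsto> R(X, Y)Z\<close> of the tangent space.\<close>

definition ricci :: "('m, 'n::finite) chart set \<Rightarrow> ('m, 'n) tensor2 \<Rightarrow> ('m, 'n) tensor2" where
  "ricci \<A> h p Y Z =
     chart_invariant \<A> p (\<lambda>c. \<Sum>i\<in>UNIV. curvature \<A> h p (coord_vec \<A> c p i) Y Z c $ i)"

definition scalar_curvature ::
    "('m, 'n::finite) chart set \<Rightarrow> ('m, 'n) tensor2 \<Rightarrow> 'm \<Rightarrow> real" where
  "scalar_curvature \<A> h p =
     chart_invariant \<A> p (\<lambda>c. \<Sum>i\<in>UNIV. \<Sum>j\<in>UNIV.
       matrix_inv (comps \<A> h c p) $ i $ j * comps \<A> (ricci \<A> h) c p $ i $ j)"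

definition schouten :: "('m, 'n::finite) chart set \<Rightarrow> ('m, 'n) tensor2 \<Rightarrow> ('m, 'n) tensor2" where
  "schouten \<A> h p X Y =
     1 / (real CARD('n) - 2) *
       (ricci \<A> h p X Y - scalar_curvature \<A> h p / (2 * (real CARD('n) - 1)) * h p X Y)"

definition nondegenerate_at ::
    "('m, 'n::finite) chart set \<Rightarrow> ('m, 'n) tensor2 \<Rightarrow> 'm \<Rightarrow> bool" where
  "nondegenerate_at \<A> B p \<longleftrightarrow>
     (\<forall>X\<in>tangent_space \<A> p. (\<forall>Y\<in>tangent_space \<A> p. B p X Y = 0) \<longrightarrow> X = (\<lambda>c. 0))"

text \<open>
  The tensor $\sum A_{ia} A_{jb}\, g^{ab}\, du^i \otimes du^j$, where \<open>X c $ i\<close> is the value of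
  $du^i$ on \<open>X\<close> in the chart \<open>c\<close>.
\<close>

definition dual_tensor ::
    "('m, 'n::finite) chart set \<Rightarrow> ('m, 'n) tensor2 \<Rightarrow> ('m, 'n) tensor2 \<Rightarrow> ('m, 'n) tensor2" where
  "dual_tensor \<A> g A p X Y =
     chart_invariant \<A> p (\<lambda>c. \<Sum>i\<in>UNIV. \<Sum>j\<in>UNIV. \<Sum>a\<in>UNIV. \<Sum>b\<in>UNIV.
       comps \<A> A c p $ i $ a * comps \<A> A c p $ j $ b * matrix_inv (comps \<A> g c p) $ a $ b
         * X c $ i * Y c $ j)"

end

theory Submission
  imports Defs
begin

text \<open>
  Let \<open>u\<^sup>-\<^sup>2 g\<close> be flat, with gradient \<open>P\<close> of \<open>u\<close>, Schouten endomorphism \<open>S\<close> and \<open>w = g(P, P) / (2 u)\<close>.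
  Then the curvature of \<open>g\<close> is the Kulkarni-Nomizu product of the metric with the Schouten tensor
  and \<open>\<nabla>P = w - u S\<close>. Differentiating once more and using the Ricci identity gives
  \<open>dw = - g(P, S)\<close> and the Codazzi equation for \<open>S\<close>. By the latter, where \<open>S\<close> is invertible,
  \<open>S\<close> intertwines the connection of the dual metric \<open>g(S, S)\<close> with that of \<open>g\<close>; so the curvature
  of the dual metric is conjugate to that of \<open>g\<close>, and its Schouten endomorphism is the inverse
  of \<open>S\<close>, that is, its Schouten tensor is the same. Moreover \<open>w\<close> and \<open>u\<close> exchange roles, so
  \<open>w\<^sup>-\<^sup>2\<close> times the dual metric is flat where \<open>w\<close> is positive, that is, where \<open>P\<close> does not vanish.
  A zero of \<open>P\<close> is removed by composing the flat metric with an inversion. The inversion needs a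
  position vector field of the flat metric, which solves a linear integrable system.
\<close>

section \<open>Smooth functions on open sets\<close>

text \<open>Conformal flatness asserts that some factor exists, so the dual metric needs an explicit
  flat factor. Producing it avoids the Weyl and Cotton tensors and treats n = 3 and n >= 4 alike.
  Writing the factor of g as u^-2 instead of exp (2 s) makes the equations linear: du = g(P, .), cd
  P = w - u S, dw = - g(P, S .) is a closed linear system for (u, P, w), and g(P, P) = 2 u w is
  compatible with it. The substitution (u, P, w, S) -> (w, - S^-1 P, u, S^-1), with g replaced by
  g(S ., S .), preserves the whole system; this involution is the source of the factor w^-2.
  Inversion is the case S = 0 of the same system: on a flat metric h, the triple (r, X, 1) with
  position field X and r = h(X, X) / 2 is a solution, so r^-2 h is flat as well. The only
  obstruction is a critical point of the given factor, since w = 0 there. Changing the factor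
  changes u, P and w but not S, because S is recovered from the curvature by traces.\<close>

definition dd :: "'a::real_normed_vector \<Rightarrow> ('a \<Rightarrow> 'b::real_normed_vector) \<Rightarrow> 'a \<Rightarrow> 'b" where
  "dd v f x = frechet_derivative f (at x) v"

lemma dd_eq:
  assumes "(f has_derivative f') (at x)"
  shows "dd v f x = f' v"
  using frechet_derivative_at[OF assms] by (simp add: dd_def)

lemma differentiable_has_dd:
  assumes "f differentiable (at x)"
  shows "(f has_derivative (\<lambda>v. dd v f x)) (at x)"
  using assms by (simp add: dd_def frechet_derivative_works)

lemma linear_dd:
  assumes "f differentiable (at x)"
  shows "linear (\<lambda>v. dd v f x)"
  using has_derivative_linear[OF differentiable_has_dd[OF assms]] .

lemma has_derivative_cong_open:
  assumes "open S" "x \<in> S" "\<And>y. y \<in> S \<Longrightarrow> f y = g y"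
  shows "(f has_derivative D) (at x) \<longleftrightarrow> (g has_derivative D) (at x)"
  using has_derivative_transform_within_open[of f D x UNIV S g]
    has_derivative_transform_within_open[of g D x UNIV S f] assms by auto

lemma has_derivative_transfer_open:
  "(g has_derivative D) (at x) \<Longrightarrow> open S \<Longrightarrow> x \<in> S \<Longrightarrow> (\<And>y. y \<in> S \<Longrightarrow> f y = g y) \<Longrightarrow>
    (f has_derivative D) (at x)"
  using has_derivative_cong_open[of S x f g D] by simp

lemma differentiable_cong_open:
  assumes "open S" "x \<in> S" "\<And>y. y \<in> S \<Longrightarrow> f y = g y"
  shows "f differentiable (at x) \<longleftrightarrow> g differentiable (at x)"
  using has_derivative_cong_open[OF assms] by (simp add: differentiable_def)

text \<open>\<open>frechet_derivative\<close> is a choice among all derivatives. Agreement on an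
  open set makes the two sets of candidates equal, so the choices agree even where no derivative
  exists.\<close>

lemma dd_cong_open:
  assumes "open S" "x \<in> S" "\<And>y. y \<in> S \<Longrightarrow> f y = g y"
  shows "dd v f x = dd v g x"
  using has_derivative_cong_open[OF assms] by (simp add: dd_def frechet_derivative_def)

lemma Ck_on_Suc_dd:
  "Ck_on (Suc k) S f \<longleftrightarrow> (\<forall>x\<in>S. f differentiable (at x)) \<and> (\<forall>v. Ck_on k S (dd v f))"
  by (simp add: dd_def[abs_def])

lemma Ck_on_SucI:
  "(\<And>x. x \<in> S \<Longrightarrow> f differentiable (at x)) \<Longrightarrow> (\<And>v. Ck_on k S (dd v f)) \<Longrightarrow> Ck_on (Suc k) S f"
  by (simp add: Ck_on_Suc_dd del: Ck_on.simps)

lemma Ck_on_SucD: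
  assumes "Ck_on (Suc k) S f"
  shows "x \<in> S \<Longrightarrow> f differentiable (at x)" "Ck_on k S (dd v f)"
  using assms by (simp_all add: Ck_on_Suc_dd del: Ck_on.simps)

lemma Ck_on_cong:
  assumes "open S" "\<And>x. x \<in> S \<Longrightarrow> f x = g x"
  shows "Ck_on k S f \<longleftrightarrow> Ck_on k S g"
  using assms(2)
proof (induction k arbitrary: f g)
  case 0
  then show ?case by (simp cong: continuous_on_cong)
next
  case (Suc k)
  have "Ck_on k S (dd v f) \<longleftrightarrow> Ck_on k S (dd v g)" for v
    by (rule Suc.IH) (rule dd_cong_open[OF assms(1) _ Suc.prems])
  then show ?case
    unfolding Ck_on_Suc_dd using differentiable_cong_open[OF assms(1) _ Suc.prems] by auto
qed

lemma Ck_on_transfer: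
  "Ck_on k S g \<Longrightarrow> open S \<Longrightarrow> (\<And>x. x \<in> S \<Longrightarrow> f x = g x) \<Longrightarrow> Ck_on k S f"
  using Ck_on_cong[of S f g k] by simp

lemma smooth_on_cong:
  assumes "open S" "\<And>x. x \<in> S \<Longrightarrow> f x = g x"
  shows "smooth_on S f \<longleftrightarrow> smooth_on S g"
  unfolding smooth_on_def using Ck_on_cong[OF assms(1), of f g] assms(2) by simp

lemma smooth_on_transfer:
  "smooth_on S g \<Longrightarrow> open S \<Longrightarrow> (\<And>x. x \<in> S \<Longrightarrow> f x = g x) \<Longrightarrow> smooth_on S f"
  using smooth_on_cong[of S f g] by simp

lemma Ck_on_subset: "Ck_on k S f \<Longrightarrow> T \<subseteq> S \<Longrightarrow> Ck_on k T f"
proof (induction k arbitrary: f)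
  case 0
  then show ?case by (auto intro: continuous_on_subset)
next
  case (Suc k)
  then show ?case unfolding Ck_on_Suc_dd by blast
qed

lemma smooth_on_subset: "smooth_on S f \<Longrightarrow> T \<subseteq> S \<Longrightarrow> smooth_on T f"
  unfolding smooth_on_def using Ck_on_subset by blast

lemma Ck_on_local:
  assumes "\<And>x. x \<in> S \<Longrightarrow> \<exists>T. open T \<and> x \<in> T \<and> Ck_on k T f"
  shows "Ck_on k S f"
  using assms
proof (induction k arbitrary: f)
  case 0
  have "isCont f x" if "x \<in> S" for x
    using 0[OF that] continuous_on_eq_continuous_at by auto
  then show ?case by (simp add: continuous_at_imp_continuous_on)
next
  case (Suc k)
  have "f differentiable (at x)" if "x \<in> S" for x
    using Suc.prems[OF that] Ck_on_SucD(1) by metis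
  moreover have "Ck_on k S (dd v f)" for v
    by (rule Suc.IH) (meson Suc.prems Ck_on_SucD(2))
  ultimately show ?case unfolding Ck_on_Suc_dd by blast
qed

lemma smooth_on_local:
  assumes "\<And>x. x \<in> S \<Longrightarrow> \<exists>T. open T \<and> x \<in> T \<and> smooth_on T f"
  shows "smooth_on S f"
  unfolding smooth_on_def
  by (intro allI Ck_on_local) (use assms smooth_on_def in blast)

text \<open>Removes the order of differentiability: smoothness passes to every directional
  derivative, so later arguments need not count derivatives.\<close>

lemma smooth_on_unfold:
  "smooth_on S f \<longleftrightarrow> (\<forall>x\<in>S. f differentiable (at x)) \<and> (\<forall>v. smooth_on S (dd v f))"
proof
  assume "smooth_on S f"
  then have "\<And>k. Ck_on (Suc k) S f" by (simp add: smooth_on_def del: Ck_on.simps)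
  then show "(\<forall>x\<in>S. f differentiable (at x)) \<and> (\<forall>v. smooth_on S (dd v f))"
    unfolding Ck_on_Suc_dd smooth_on_def by blast
next
  assume a: "(\<forall>x\<in>S. f differentiable (at x)) \<and> (\<forall>v. smooth_on S (dd v f))"
  have "Ck_on k S f" for k
  proof (cases k)
    case 0
    then show ?thesis using a
      by (simp add: continuous_at_imp_continuous_on differentiable_imp_continuous_within)
  next
    case (Suc j)
    then show ?thesis using a by (simp add: Ck_on_Suc_dd smooth_on_def del: Ck_on.simps)
  qed
  then show "smooth_on S f" by (simp add: smooth_on_def)
qed

lemma smooth_on_differentiable: "smooth_on S f \<Longrightarrow> x \<in> S \<Longrightarrow> f differentiable (at x)"
  using smooth_on_unfold by blast

lemma smooth_on_dd: "smooth_on S f \<Longrightarrow> smooth_on S (dd v f)"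
  using smooth_on_unfold by blast

lemma smooth_on_has_dd:
  "smooth_on S f \<Longrightarrow> x \<in> S \<Longrightarrow> (f has_derivative (\<lambda>v. dd v f x)) (at x)"
  by (simp add: differentiable_has_dd smooth_on_differentiable)

lemma smooth_on_continuous: "smooth_on S f \<Longrightarrow> continuous_on S f"
  by (metis smooth_on_def Ck_on.simps(1))

lemma Ck_on_Suc_imp: "Ck_on (Suc k) S f \<Longrightarrow> Ck_on k S f"
proof (induction k arbitrary: f)
  case 0
  then show ?case
    by (simp add: continuous_at_imp_continuous_on differentiable_imp_continuous_within)
next
  case (Suc k)
  then show ?case using Ck_on_Suc_dd by metis
qed

lemma Ck_on_const: "Ck_on k S (\<lambda>x. c)"
proof (induction k arbitrary: c)
  case (Suc k)
  have "dd v (\<lambda>x. c) = (\<lambda>x. 0)" for v :: 'a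
    using dd_eq[OF has_derivative_const] by blast
  then show ?case using Suc by (simp add: dd_def[abs_def])
qed simp

lemma Ck_on_bounded_linear:
  assumes "bounded_linear L"
  shows "Ck_on k S L"
proof (cases k)
  case 0
  then show ?thesis using assms by (simp add: linear_continuous_on)
next
  case (Suc j)
  have "dd v L = (\<lambda>x. L v)" for v
    using dd_eq[OF bounded_linear_imp_has_derivative[OF assms]] by blast
  then show ?thesis
    unfolding Suc Ck_on_Suc_dd
    using Ck_on_const bounded_linear_imp_differentiable[OF assms] by metis
qed

lemma Ck_on_add:
  assumes "open S" "Ck_on k S f" "Ck_on k S g"
  shows "Ck_on k S (\<lambda>x. f x + g x)"
  using assms(2,3)
proof (induction k arbitrary: f g)
  case 0
  then show ?case by (simp add: continuous_on_add)
next
  case (Suc k)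
  have d: "f differentiable (at x)" "g differentiable (at x)" if "x \<in> S" for x
    using Suc.prems that by auto
  have eq: "dd v (\<lambda>x. f x + g x) x = dd v f x + dd v g x" if "x \<in> S" for v x
    using dd_eq[OF has_derivative_add[OF differentiable_has_dd differentiable_has_dd]] d[OF that] by blast
  have "Ck_on k S (\<lambda>x. dd v f x + dd v g x)" for v
    by (rule Suc.IH[OF Ck_on_SucD(2)[OF Suc.prems(1)] Ck_on_SucD(2)[OF Suc.prems(2)]])
  then have "Ck_on k S (dd v (\<lambda>x. f x + g x))" for v
    by (rule Ck_on_transfer[OF _ assms(1) eq])
  then show ?case by (rule Ck_on_SucI[rotated]) (rule differentiable_add[OF d])
qed

lemma Ck_on_bilinear:
  assumes "open S" "bounded_bilinear b" "Ck_on k S f" "Ck_on k S g"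
  shows "Ck_on k S (\<lambda>x. b (f x) (g x))"
  using assms(3,4)
proof (induction k arbitrary: f g)
  case 0
  then show ?case using bounded_bilinear.continuous_on[OF assms(2)] by simp
next
  case (Suc k)
  have d: "f differentiable (at x)" "g differentiable (at x)" if "x \<in> S" for x
    using Suc.prems that by auto
  note h = bounded_bilinear.FDERIV[OF assms(2) differentiable_has_dd differentiable_has_dd]
  have eq: "dd v (\<lambda>x. b (f x) (g x)) x = b (f x) (dd v g x) + b (dd v f x) (g x)" if "x \<in> S" for v x
    using dd_eq[OF h] d[OF that] by blast
  have "Ck_on k S (\<lambda>x. b (f x) (dd v g x) + b (dd v f x) (g x))" for v
    by (intro Ck_on_add[OF assms(1)] Suc.IH Ck_on_SucD(2)[OF Suc.prems(1)]
        Ck_on_SucD(2)[OF Suc.prems(2)] Ck_on_Suc_imp[OF Suc.prems(1)] Ck_on_Suc_imp[OF Suc.prems(2)])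
  then have "Ck_on k S (dd v (\<lambda>x. b (f x) (g x)))" for v
    by (rule Ck_on_transfer[OF _ assms(1) eq])
  then show ?case by (rule Ck_on_SucI[rotated]) (rule differentiableI[OF h[OF d]])
qed

lemma Ck_on_sum:
  assumes "open S" "\<And>i. i \<in> I \<Longrightarrow> Ck_on k S (f i)"
  shows "Ck_on k S (\<lambda>x. \<Sum>i\<in>I. f i x)"
  using assms(2)
  by (induction I rule: infinite_finite_induct) (auto simp: Ck_on_const intro: Ck_on_add[OF assms(1)])

lemma dd_compose:
  fixes f :: "'a::real_normed_vector \<Rightarrow> 'b::euclidean_space"
  assumes "f differentiable (at x)" "g differentiable (at (f x))"
  shows "dd v (\<lambda>x. g (f x)) x = dd (dd v f x) g (f x)"
  by (rule dd_eq) (rule has_derivative_compose[OF differentiable_has_dd differentiable_has_dd]; fact)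

lemma dd_euclidean:
  fixes g :: "'b::euclidean_space \<Rightarrow> 'c::real_normed_vector"
  assumes "g differentiable (at x)"
  shows "dd v g x = (\<Sum>b\<in>Basis. (v \<bullet> b) *\<^sub>R dd b g x)"
proof -
  interpret linear "\<lambda>v. dd v g x" by (rule linear_dd[OF assms])
  have "dd v g x = dd (\<Sum>b\<in>Basis. (v \<bullet> b) *\<^sub>R b) g x" by (simp add: euclidean_representation)
  also have "\<dots> = (\<Sum>b\<in>Basis. (v \<bullet> b) *\<^sub>R dd b g x)" by (simp add: sum scale)
  finally show ?thesis .
qed

text \<open>In the chain rule the direction \<open>dd v f x\<close> moves with \<open>x\<close>,
  whereas \<open>Ck_on\<close> controls derivatives in fixed directions only. Expanding the moving
  direction in a basis of the intermediate space reduces the claim to fixed directions and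
  products.\<close>

lemma Ck_on_compose:
  fixes f :: "'a::real_normed_vector \<Rightarrow> 'b::euclidean_space"
  assumes "open S" "open T" "f ` S \<subseteq> T" "Ck_on k S f" "Ck_on k T g"
  shows "Ck_on k S (\<lambda>x. g (f x))"
  using assms(4,5)
proof (induction k arbitrary: g)
  case 0
  then show ?case using assms(3) by (auto intro: continuous_on_compose2)
next
  case (Suc k)
  have d: "f differentiable (at x)" "g differentiable (at (f x))" if "x \<in> S" for x
    using Suc.prems assms(3) that by auto
  have eq: "dd v (\<lambda>x. g (f x)) x = (\<Sum>b\<in>Basis. (dd v f x \<bullet> b) *\<^sub>R dd b g (f x))" if "x \<in> S" for v x
    using dd_compose[OF d[OF that]] dd_euclidean[OF d(2)[OF that], of "dd v f x"] by simp
  have "Ck_on k S (\<lambda>x. \<Sum>b\<in>Basis. (dd v f x \<bullet> b) *\<^sub>R dd b g (f x))" for v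
  proof (intro Ck_on_sum[OF assms(1)] Ck_on_bilinear[OF assms(1) bounded_bilinear_scaleR])
    fix b :: 'b
    show "Ck_on k S (\<lambda>x. dd v f x \<bullet> b)"
      by (rule Ck_on_bilinear[OF assms(1) bounded_bilinear_inner])
         (rule Ck_on_SucD(2)[OF Suc.prems(1)] Ck_on_const)+
    show "Ck_on k S (\<lambda>x. dd b g (f x))"
      by (rule Suc.IH[OF Ck_on_Suc_imp[OF Suc.prems(1)] Ck_on_SucD(2)[OF Suc.prems(2)]])
  qed
  then have "Ck_on k S (dd v (\<lambda>x. g (f x)))" for v
    by (rule Ck_on_transfer[OF _ assms(1) eq])
  then show ?case
    by (rule Ck_on_SucI[rotated]) (rule differentiable_compose[OF d(2,1)])
qed

section \<open>Closure properties of smooth functions\<close>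

lemma smooth_on_const [simp]: "smooth_on S (\<lambda>x. c)"
  by (simp add: smooth_on_def Ck_on_const)

lemma smooth_on_bounded_linear: "bounded_linear L \<Longrightarrow> smooth_on S L"
  by (simp add: smooth_on_def Ck_on_bounded_linear)

lemma smooth_on_add:
  "open S \<Longrightarrow> smooth_on S f \<Longrightarrow> smooth_on S g \<Longrightarrow> smooth_on S (\<lambda>x. f x + g x)"
  by (simp add: smooth_on_def Ck_on_add)

lemma smooth_on_bilinear:
  "open S \<Longrightarrow> bounded_bilinear b \<Longrightarrow> smooth_on S f \<Longrightarrow> smooth_on S g \<Longrightarrow> smooth_on S (\<lambda>x. b (f x) (g x))"
  by (simp add: smooth_on_def Ck_on_bilinear)

lemma smooth_on_sum:
  "open S \<Longrightarrow> (\<And>i. i \<in> I \<Longrightarrow> smooth_on S (f i)) \<Longrightarrow> smooth_on S (\<lambda>x. \<Sum>i\<in>I. f i x)"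
  by (simp add: smooth_on_def Ck_on_sum)

lemma smooth_on_compose:
  fixes f :: "'a::real_normed_vector \<Rightarrow> 'b::euclidean_space"
  shows "open S \<Longrightarrow> open T \<Longrightarrow> f ` S \<subseteq> T \<Longrightarrow> smooth_on S f \<Longrightarrow> smooth_on T g \<Longrightarrow> smooth_on S (\<lambda>x. g (f x))"
  by (simp add: smooth_on_def Ck_on_compose)

lemma smooth_on_linear_compose:
  fixes f :: "'a::real_normed_vector \<Rightarrow> 'b::euclidean_space"
  shows "open S \<Longrightarrow> smooth_on S f \<Longrightarrow> bounded_linear L \<Longrightarrow> smooth_on S (\<lambda>x. L (f x))"
  by (rule smooth_on_compose[of S UNIV]) (auto intro: smooth_on_bounded_linear)

lemmas smooth_on_scaleR = smooth_on_bilinear[OF _ bounded_bilinear_scaleR]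
lemmas smooth_on_mult = smooth_on_bilinear[OF _ bounded_bilinear_mult]
lemmas smooth_on_inner = smooth_on_bilinear[OF _ bounded_bilinear_inner]

lemma smooth_on_uminus:
  assumes "open S" "smooth_on S f"
  shows "smooth_on S (\<lambda>x. - f x)"
  using smooth_on_scaleR[OF assms(1) smooth_on_const[of _ "-1"] assms(2)] by simp

lemma smooth_on_diff:
  assumes "open S" "smooth_on S f" "smooth_on S g"
  shows "smooth_on S (\<lambda>x. f x - g x)"
  using smooth_on_add[OF assms(1,2) smooth_on_uminus[OF assms(1,3)]] by simp

lemma smooth_on_prod:
  fixes f :: "'i \<Rightarrow> 'a::real_normed_vector \<Rightarrow> real"
  assumes "open S" "\<And>i. i \<in> I \<Longrightarrow> smooth_on S (f i)"
  shows "smooth_on S (\<lambda>x. \<Prod>i\<in>I. f i x)"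
  using assms(2)
  by (induction I rule: infinite_finite_induct) (auto intro: smooth_on_mult[OF assms(1)])

text \<open>Bootstrap: if the derivative is at least as regular as the function, as for
  \<open>exp\<close> and \<open>inverse\<close>, then each order of differentiability yields the
  next.\<close>

lemma smooth_on_if_Ck_derivative:
  assumes "open S" "\<And>x. x \<in> S \<Longrightarrow> (f has_real_derivative f' x) (at x)"
    and "\<And>k. Ck_on k S f \<Longrightarrow> Ck_on k S f'"
  shows "smooth_on S f"
proof -
  have d: "(f has_derivative (\<lambda>v. f' x * v)) (at x)" if "x \<in> S" for x
    using assms(2)[OF that] by (simp add: has_field_derivative_def)
  have "Ck_on k S f" for k
  proof (induction k)
    case 0
    then show ?case using d
      by (auto intro!: continuous_at_imp_continuous_on has_derivative_continuous)
  next
    case (Suc k)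
    have "Ck_on k S (\<lambda>x. f' x * v)" for v
      by (rule Ck_on_bilinear[OF assms(1) bounded_bilinear_mult assms(3)[OF Suc] Ck_on_const])
    then have "Ck_on k S (dd v f)" for v
      by (rule Ck_on_transfer[OF _ assms(1) dd_eq[OF d]])
    then show ?case by (rule Ck_on_SucI[rotated]) (use d differentiableI in blast)
  qed
  then show ?thesis by (simp add: smooth_on_def)
qed

lemma smooth_on_exp_real: "smooth_on UNIV (exp :: real \<Rightarrow> real)"
  by (rule smooth_on_if_Ck_derivative[where f' = exp]) auto

lemma smooth_on_inverse_real: "smooth_on (-{0}) (inverse :: real \<Rightarrow> real)"
proof (rule smooth_on_if_Ck_derivative[where f' = "\<lambda>x. - 1 * (inverse x * inverse x)"])
  fix x :: real assume "x \<in> -{0}"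
  then show "(inverse has_real_derivative - 1 * (inverse x * inverse x)) (at x)"
    by (auto intro!: derivative_eq_intros simp: power2_eq_square)
next
  fix k assume a: "Ck_on k (-{0::real}) inverse"
  show "Ck_on k (-{0::real}) (\<lambda>x. - 1 * (inverse x * inverse x))"
    by (intro Ck_on_bilinear[OF _ bounded_bilinear_mult] Ck_on_const a) auto
qed auto

lemma smooth_on_ln_real: "smooth_on {0<..} (ln :: real \<Rightarrow> real)"
proof (rule smooth_on_if_Ck_derivative[where f' = inverse])
  show "Ck_on k {0<..} (inverse :: real \<Rightarrow> real)" for k
    using smooth_on_subset[OF smooth_on_inverse_real, of "{0<..}"] by (auto simp: smooth_on_def)
qed (auto intro!: derivative_eq_intros simp: divide_simps)

lemma smooth_on_exp: "open S \<Longrightarrow> smooth_on S f \<Longrightarrow> smooth_on S (\<lambda>x. exp (f x :: real))"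
  by (rule smooth_on_compose[OF _ open_UNIV _ _ smooth_on_exp_real]) auto

lemma smooth_on_inverse:
  "open S \<Longrightarrow> smooth_on S f \<Longrightarrow> (\<And>x. x \<in> S \<Longrightarrow> f x \<noteq> 0) \<Longrightarrow> smooth_on S (\<lambda>x. inverse (f x :: real))"
  by (rule smooth_on_compose[OF _ _ _ _ smooth_on_inverse_real]) auto

lemma smooth_on_divide:
  "open S \<Longrightarrow> smooth_on S f \<Longrightarrow> smooth_on S g \<Longrightarrow> (\<And>x. x \<in> S \<Longrightarrow> g x \<noteq> 0) \<Longrightarrow>
    smooth_on S (\<lambda>x. f x / (g x :: real))"
  unfolding divide_inverse by (intro smooth_on_mult smooth_on_inverse)

lemma smooth_on_ln:
  "open S \<Longrightarrow> smooth_on S f \<Longrightarrow> (\<And>x. x \<in> S \<Longrightarrow> f x > 0) \<Longrightarrow> smooth_on S (\<lambda>x. ln (f x :: real))"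
  by (rule smooth_on_compose[OF _ _ _ _ smooth_on_ln_real]) auto

lemma smooth_on_euclidean_iff:
  fixes f :: "'a::real_normed_vector \<Rightarrow> 'b::euclidean_space"
  assumes "open S"
  shows "smooth_on S f \<longleftrightarrow> (\<forall>b\<in>Basis. smooth_on S (\<lambda>x. f x \<bullet> b))"
proof
  show "smooth_on S f \<Longrightarrow> \<forall>b\<in>Basis. smooth_on S (\<lambda>x. f x \<bullet> b)"
    by (intro ballI smooth_on_inner assms smooth_on_const)
  assume "\<forall>b\<in>Basis. smooth_on S (\<lambda>x. f x \<bullet> b)"
  then have "smooth_on S (\<lambda>x. \<Sum>b\<in>Basis. (f x \<bullet> b) *\<^sub>R b)"
    by (intro smooth_on_sum smooth_on_scaleR assms smooth_on_const) auto
  then show "smooth_on S f" by (simp add: euclidean_representation)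
qed

lemma smooth_on_vec_iff:
  fixes f :: "'a::real_normed_vector \<Rightarrow> 'b::euclidean_space ^ 'n"
  assumes "open S"
  shows "smooth_on S f \<longleftrightarrow> (\<forall>i. smooth_on S (\<lambda>x. f x $ i))"
proof
  show "smooth_on S f \<Longrightarrow> \<forall>i. smooth_on S (\<lambda>x. f x $ i)"
    by (rule allI, rule smooth_on_linear_compose[OF assms _ bounded_linear_vec_nth])
  assume a: "\<forall>i. smooth_on S (\<lambda>x. f x $ i)"
  show "smooth_on S f"
  proof (rule smooth_on_euclidean_iff[OF assms, THEN iffD2], rule ballI)
    fix b :: "'b ^ 'n" assume "b \<in> Basis"
    then obtain i u where "b = axis i u" by (auto simp: Basis_vec_def)
    then have "(\<lambda>x. f x \<bullet> b) = (\<lambda>x. f x $ i \<bullet> u)" by (simp add: inner_axis)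
    moreover have "smooth_on S (\<lambda>x. f x $ i \<bullet> u)"
      by (rule smooth_on_inner[OF assms a[rule_format] smooth_on_const])
    ultimately show "smooth_on S (\<lambda>x. f x \<bullet> b)" by simp
  qed
qed

lemma smooth_on_vec_lambda:
  fixes f :: "'n::finite \<Rightarrow> 'a::real_normed_vector \<Rightarrow> 'b::euclidean_space"
  assumes "open S" "\<And>i. smooth_on S (f i)"
  shows "smooth_on S (\<lambda>x. \<chi> i. f i x)"
  using assms by (simp add: smooth_on_vec_iff)

section \<open>Determinants and inverse matrices\<close>

lemma smooth_on_det:
  fixes G :: "'a::real_normed_vector \<Rightarrow> real ^ 'n ^ 'n"
  assumes "open S" "smooth_on S G"
  shows "smooth_on S (\<lambda>x. det (G x))"
proof -
  have "smooth_on S (\<lambda>x. G x $ i $ j)" for i j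
    using assms by (simp add: smooth_on_vec_iff)
  then show ?thesis unfolding det_def
    by (intro smooth_on_sum smooth_on_mult smooth_on_prod assms(1) smooth_on_const) auto
qed

lemma matrix_inv_det:
  fixes A :: "real ^ 'n ^ 'n"
  assumes "det A \<noteq> 0"
  shows "A ** matrix_inv A = mat 1" "matrix_inv A ** A = mat 1"
proof -
  have "\<exists>B. A ** B = mat 1 \<and> B ** A = mat 1"
    using assms by (simp add: invertible_det_nz[symmetric] invertible_def)
  then have "A ** matrix_inv A = mat 1 \<and> matrix_inv A ** A = mat 1"
    unfolding matrix_inv_def by (rule someI_ex)
  then show "A ** matrix_inv A = mat 1" "matrix_inv A ** A = mat 1" by auto
qed

lemma matrix_inv_vec:
  fixes A :: "real ^ 'n ^ 'n"
  assumes "det A \<noteq> 0"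
  shows "A *v (matrix_inv A *v x) = x" "matrix_inv A *v (A *v x) = x"
  using matrix_inv_det[OF assms] by (simp_all add: matrix_vector_mul_assoc)

text \<open>Cramer's rule exhibits the entries of the inverse as quotients of determinants, which
  gives smoothness of the inverse without differentiating inversion.\<close>

lemma matrix_inv_cramer:
  fixes A :: "real ^ 'n ^ 'n"
  assumes "det A \<noteq> 0"
  shows "matrix_inv A $ k $ l = det (\<chi> i j. if j = k then axis l 1 $ i else A $ i $ j) / det A"
proof -
  have "A *v (matrix_inv A *v axis l 1) = axis l 1"
    by (rule matrix_inv_vec[OF assms])
  then have "matrix_inv A *v axis l 1 = (\<chi> k. det (\<chi> i j. if j = k then axis l 1 $ i else A $ i $ j) / det A)"
    using cramer[OF assms] by blast
  then have "(matrix_inv A *v axis l 1) $ k = det (\<chi> i j. if j = k then axis l 1 $ i else A $ i $ j) / det A"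
    by simp
  then show ?thesis by (simp add: matrix_vector_mult_basis column_def)
qed

lemma smooth_on_matrix_inv:
  fixes G :: "'a::real_normed_vector \<Rightarrow> real ^ 'n ^ 'n"
  assumes "open S" "smooth_on S G" "\<And>x. x \<in> S \<Longrightarrow> det (G x) \<noteq> 0"
  shows "smooth_on S (\<lambda>x. matrix_inv (G x))"
proof -
  have g: "smooth_on S (\<lambda>x. G x $ i $ j)" for i j
    using assms by (simp add: smooth_on_vec_iff)
  have "smooth_on S (\<lambda>x. matrix_inv (G x) $ k $ l)" for k l
  proof -
    have "smooth_on S (\<lambda>x. if j = k then c else G x $ i $ j)" for i j and c :: real
      by (cases "j = k") (auto simp: g)
    then have "smooth_on S (\<lambda>x. det (\<chi> i j. if j = k then axis l 1 $ i else G x $ i $ j) / det (G x))"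
      by (intro smooth_on_divide smooth_on_det smooth_on_vec_lambda assms)
    then show ?thesis
      by (rule smooth_on_transfer[OF _ assms(1) matrix_inv_cramer[OF assms(3)]])
  qed
  then show ?thesis using assms(1) by (simp add: smooth_on_vec_iff)
qed

lemma smooth_on_matrix_vector_mult:
  fixes G :: "'a::real_normed_vector \<Rightarrow> real ^ 'n ^ 'm"
  assumes "open S" "smooth_on S G" "smooth_on S f"
  shows "smooth_on S (\<lambda>x. G x *v f x)"
proof (rule smooth_on_bilinear[OF assms(1) _ assms(2,3)])
  have "bilinear ((*v) :: real ^ 'n ^ 'm \<Rightarrow> real ^ 'n \<Rightarrow> real ^ 'm)"
    unfolding bilinear_def
    by (auto intro!: linearI simp: matrix_vector_right_distrib matrix_vector_mult_add_rdistrib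
        scaleR_matrix_vector_assoc[symmetric] matrix_vector_mult_scaleR)
  then show "bounded_bilinear ((*v) :: real ^ 'n ^ 'm \<Rightarrow> real ^ 'n \<Rightarrow> real ^ 'm)"
    by (simp add: bilinear_conv_bounded_bilinear)
qed

section \<open>Symmetry of second derivatives\<close>

text \<open>Mean value theorem twice: in the direction \<open>v\<close> for the difference of
  \<open>f\<close> across the side \<open>h *\<^sub>R w\<close>, then in the direction
  \<open>w\<close> for \<open>dd v f\<close>.\<close>

lemma second_difference_mvt:
  fixes f :: "'a::real_normed_vector \<Rightarrow> real"
  assumes f: "\<And>y. y \<in> S \<Longrightarrow> f differentiable (at y)"
    and df: "\<And>y. y \<in> S \<Longrightarrow> dd v f differentiable (at y)"
    and h: "h > 0" and S: "\<And>s t. 0 \<le> s \<Longrightarrow> s \<le> h \<Longrightarrow> 0 \<le> t \<Longrightarrow> t \<le> h \<Longrightarrow> x + s *\<^sub>R v + t *\<^sub>R w \<in> S"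
  obtains s t where "0 < s" "s < h" "0 < t" "t < h"
    "f (x + h *\<^sub>R v + h *\<^sub>R w) - f (x + h *\<^sub>R v) - f (x + h *\<^sub>R w) + f x
       = h\<^sup>2 * dd w (dd v f) (x + s *\<^sub>R v + t *\<^sub>R w)"
proof -
  have d1: "((\<lambda>s. F (x + s *\<^sub>R v + t *\<^sub>R w)) has_real_derivative dd v F (x + s *\<^sub>R v + t *\<^sub>R w)) (at s)"
    if "F differentiable (at (x + s *\<^sub>R v + t *\<^sub>R w))" for s t and F :: "'a \<Rightarrow> real"
  proof -
    have a: "((\<lambda>s. x + s *\<^sub>R v + t *\<^sub>R w) has_derivative (\<lambda>k. k *\<^sub>R v)) (at s)"
      by (auto intro!: derivative_eq_intros)
    have l: "dd (k *\<^sub>R v) F y = k * dd v F y" if "F differentiable (at y)" for k y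
      using linear_scale[OF linear_dd[OF that]] by simp
    show ?thesis
      using has_derivative_compose[OF a differentiable_has_dd[OF that]] l[OF that]
      by (simp add: has_field_derivative_def mult.commute[of _ "dd v F _"])
  qed
  have d2: "((\<lambda>t. F (x + s *\<^sub>R v + t *\<^sub>R w)) has_real_derivative dd w F (x + s *\<^sub>R v + t *\<^sub>R w)) (at t)"
    if "F differentiable (at (x + s *\<^sub>R v + t *\<^sub>R w))" for s t and F :: "'a \<Rightarrow> real"
  proof -
    have a: "((\<lambda>t. x + s *\<^sub>R v + t *\<^sub>R w) has_derivative (\<lambda>k. k *\<^sub>R w)) (at t)"
      by (auto intro!: derivative_eq_intros)
    have l: "dd (k *\<^sub>R w) F y = k * dd w F y" if "F differentiable (at y)" for k y
      using linear_scale[OF linear_dd[OF that]] by simp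
    show ?thesis
      using has_derivative_compose[OF a differentiable_has_dd[OF that]] l[OF that]
      by (simp add: has_field_derivative_def mult.commute[of _ "dd w F _"])
  qed
  define G where "G s = f (x + s *\<^sub>R v + h *\<^sub>R w) - f (x + s *\<^sub>R v + 0 *\<^sub>R w)" for s
  have "\<exists>s. 0 < s \<and> s < h \<and> G h - G 0 = (h - 0) *
      (dd v f (x + s *\<^sub>R v + h *\<^sub>R w) - dd v f (x + s *\<^sub>R v + 0 *\<^sub>R w))"
  proof (rule MVT2[OF h])
    fix s assume "0 \<le> s" "s \<le> h"
    then show "(G has_real_derivative dd v f (x + s *\<^sub>R v + h *\<^sub>R w) - dd v f (x + s *\<^sub>R v + 0 *\<^sub>R w)) (at s)"
      unfolding G_def[abs_def] by (intro DERIV_diff d1 f S) (use h in auto)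
  qed
  then obtain s where s: "0 < s" "s < h" and G: "G h - G 0 = h *
      (dd v f (x + s *\<^sub>R v + h *\<^sub>R w) - dd v f (x + s *\<^sub>R v + 0 *\<^sub>R w))" by auto
  have "\<exists>t. 0 < t \<and> t < h \<and> dd v f (x + s *\<^sub>R v + h *\<^sub>R w) - dd v f (x + s *\<^sub>R v + 0 *\<^sub>R w)
      = (h - 0) * dd w (dd v f) (x + s *\<^sub>R v + t *\<^sub>R w)"
  proof (rule MVT2[OF h])
    fix t assume "0 \<le> t" "t \<le> h"
    then show "((\<lambda>t. dd v f (x + s *\<^sub>R v + t *\<^sub>R w)) has_real_derivative dd w (dd v f) (x + s *\<^sub>R v + t *\<^sub>R w)) (at t)"
      by (intro d2 df S) (use s in auto)
  qed
  then obtain t where t: "0 < t" "t < h" and "dd v f (x + s *\<^sub>R v + h *\<^sub>R w) - dd v f (x + s *\<^sub>R v + 0 *\<^sub>R w)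
      = h * dd w (dd v f) (x + s *\<^sub>R v + t *\<^sub>R w)" by auto
  then have "G h - G 0 = h\<^sup>2 * dd w (dd v f) (x + s *\<^sub>R v + t *\<^sub>R w)"
    unfolding G by (simp add: power2_eq_square)
  then show ?thesis using that[OF s t] unfolding G_def by simp
qed

text \<open>The second difference over a parallelogram is symmetric in \<open>v\<close> and
  \<open>w\<close>. Hence on small parallelograms the two mixed derivatives agree at two nearby
  points, and continuity excludes a gap at \<open>x\<close>.\<close>

lemma clairaut_real:
  fixes f :: "'a::real_normed_vector \<Rightarrow> real"
  assumes "open S" "smooth_on S f" "x \<in> S"
  shows "dd w (dd v f) x = dd v (dd w f) x"
proof (rule ccontr)
  assume neq: "dd w (dd v f) x \<noteq> dd v (dd w f) x"
  \<comment> \<open>Half of the supposed gap: two equal numbers cannot lie within \<open>e\<close>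
    of two values that are \<open>2 * e\<close> apart.\<close>
  define e where "e = \<bar>dd w (dd v f) x - dd v (dd w f) x\<bar> / 2"
  have e: "e > 0" using neq by (simp add: e_def)
  have "isCont (dd w (dd v f)) x" "isCont (dd v (dd w f)) x"
    using smooth_on_continuous[OF smooth_on_dd[OF smooth_on_dd[OF assms(2)]]] assms
    by (auto simp: continuous_on_eq_continuous_at)
  then obtain d1 d2 where d: "d1 > 0" "d2 > 0"
    "\<And>y. dist y x < d1 \<Longrightarrow> dist (dd w (dd v f) y) (dd w (dd v f) x) < e"
    "\<And>y. dist y x < d2 \<Longrightarrow> dist (dd v (dd w f) y) (dd v (dd w f) x) < e"
    using e unfolding continuous_at_eps_delta by (metis dist_norm)
  obtain d3 where d3: "d3 > 0" "ball x d3 \<subseteq> S"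
    using assms open_contains_ball by metis
  define d where "d = min d1 (min d2 d3)"
  have dpos: "d > 0" using d d3 by (simp add: d_def)
  \<comment> \<open>Side length for which the whole parallelogram stays within distance
    \<open>d\<close> of \<open>x\<close>; the summand 1 covers the case that both directions
    vanish.\<close>
  define h where "h = d / (2 * (norm v + norm w + 1))"
  have nn: "0 \<le> norm v + norm w" by simp
  have h: "h > 0" using dpos nn by (simp add: h_def add_nonneg_pos)
  have close: "dist (x + s *\<^sub>R v + t *\<^sub>R w) x < d" if "0 \<le> s" "s \<le> h" "0 \<le> t" "t \<le> h" for s t
  proof -
    have "dist (x + s *\<^sub>R v + t *\<^sub>R w) x = norm (s *\<^sub>R v + t *\<^sub>R w)"
      by (simp add: dist_norm add.assoc)
    also have "\<dots> \<le> s * norm v + t * norm w"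
      using norm_triangle_ineq[of "s *\<^sub>R v" "t *\<^sub>R w"] that by simp
    also have "\<dots> \<le> h * norm v + h * norm w"
      using that by (intro add_mono mult_right_mono) auto
    also have "\<dots> < 2 * (h * (norm v + norm w + 1))"
    proof -
      have "0 \<le> h * norm v" "0 \<le> h * norm w" using h by auto
      moreover have "2 * (h * (norm v + norm w + 1)) = 2 * (h * norm v) + 2 * (h * norm w) + 2 * h"
        by (simp add: algebra_simps)
      ultimately show ?thesis using h by linarith
    qed
    also have "\<dots> = d"
    proof -
      have "norm v + norm w + 1 \<noteq> 0" using nn by linarith
      moreover have "2 * (d / (2 * n) * n) = d" if "n \<noteq> 0" for n :: real
        using that by simp
      ultimately show ?thesis unfolding h_def by blast
    qed
    finally show ?thesis .
  qed
  have inS: "x + s *\<^sub>R v + t *\<^sub>R w \<in> S" if "0 \<le> s" "s \<le> h" "0 \<le> t" "t \<le> h" for s t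
    using close[OF that] d3 by (auto simp: d_def dist_commute)
  have inS': "x + s *\<^sub>R w + t *\<^sub>R v \<in> S" if "0 \<le> s" "s \<le> h" "0 \<le> t" "t \<le> h" for s t
    using inS[of t s] that by (simp add: add_ac)
  note sm = smooth_on_differentiable[OF assms(2)] smooth_on_differentiable[OF smooth_on_dd[OF assms(2)]]
  obtain s t where st: "0 < s" "s < h" "0 < t" "t < h"
    "f (x + h *\<^sub>R v + h *\<^sub>R w) - f (x + h *\<^sub>R v) - f (x + h *\<^sub>R w) + f x
       = h\<^sup>2 * dd w (dd v f) (x + s *\<^sub>R v + t *\<^sub>R w)"
    by (rule second_difference_mvt[of S f v h x w, OF sm h inS])
  obtain s' t' where st': "0 < s'" "s' < h" "0 < t'" "t' < h"
    "f (x + h *\<^sub>R w + h *\<^sub>R v) - f (x + h *\<^sub>R w) - f (x + h *\<^sub>R v) + f x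
       = h\<^sup>2 * dd v (dd w f) (x + s' *\<^sub>R w + t' *\<^sub>R v)"
    by (rule second_difference_mvt[of S f w h x v, OF sm h inS'])
  have "h\<^sup>2 * dd w (dd v f) (x + s *\<^sub>R v + t *\<^sub>R w) = h\<^sup>2 * dd v (dd w f) (x + s' *\<^sub>R w + t' *\<^sub>R v)"
    using st(5) st'(5) by (simp only: add.assoc add.commute[of "h *\<^sub>R w" "h *\<^sub>R v"])
  moreover have "x + s' *\<^sub>R w + t' *\<^sub>R v = x + t' *\<^sub>R v + s' *\<^sub>R w" by simp
  ultimately have "dd w (dd v f) (x + s *\<^sub>R v + t *\<^sub>R w) = dd v (dd w f) (x + t' *\<^sub>R v + s' *\<^sub>R w)"
    using h by (metis mult_cancel_left power_eq_0_iff less_irrefl)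
  moreover have "dist (dd w (dd v f) (x + s *\<^sub>R v + t *\<^sub>R w)) (dd w (dd v f) x) < e"
    using close[of s t] st by (intro d) (simp add: d_def)
  moreover have "dist (dd v (dd w f) (x + t' *\<^sub>R v + s' *\<^sub>R w)) (dd v (dd w f) x) < e"
    using close[of t' s'] st' by (intro d) (simp add: d_def)
  ultimately show False unfolding e_def dist_real_def by (simp add: abs_if split: if_splits)
qed

lemma dd_inner_const:
  assumes "f differentiable (at x)"
  shows "dd v (\<lambda>y. f y \<bullet> b) x = dd v f x \<bullet> b"
  by (rule dd_eq) (rule has_derivative_inner_left[OF differentiable_has_dd[OF assms]])

lemma clairaut:
  fixes f :: "'a::real_normed_vector \<Rightarrow> 'b::euclidean_space"
  assumes S: "open S" and f: "smooth_on S f" and x: "x \<in> S"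
  shows "dd w (dd v f) x = dd v (dd w f) x"
proof (rule euclidean_eqI)
  fix b :: 'b
  have sb: "smooth_on S (\<lambda>y. f y \<bullet> b)" by (intro smooth_on_inner assms smooth_on_const)
  have eq: "dd v (dd w f) x \<bullet> b = dd v (dd w (\<lambda>y. f y \<bullet> b)) x" for v w
  proof -
    have "dd v (dd w f) x \<bullet> b = dd v (\<lambda>y. dd w f y \<bullet> b) x"
      by (rule dd_inner_const[symmetric], rule smooth_on_differentiable[OF smooth_on_dd[OF f] x])
    also have "\<dots> = dd v (dd w (\<lambda>y. f y \<bullet> b)) x"
      by (rule dd_cong_open[OF S x], rule dd_inner_const[symmetric], rule smooth_on_differentiable[OF f])
    finally show ?thesis .
  qed
  show "dd w (dd v f) x \<bullet> b = dd v (dd w f) x \<bullet> b"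
    unfolding eq by (rule clairaut_real[OF S sb x])
qed

section \<open>Smooth families of linear and bilinear maps\<close>

text \<open>Smoothness is demanded for each fixed argument only. In finite dimension this amounts to
  smoothness of the matrix entries.\<close>

definition smooth_lin :: "'a::real_normed_vector set \<Rightarrow> ('a \<Rightarrow> 'u::euclidean_space \<Rightarrow> 'c::euclidean_space) \<Rightarrow> bool" where
  "smooth_lin S T \<longleftrightarrow> (\<forall>p\<in>S. linear (T p)) \<and> (\<forall>u. smooth_on S (\<lambda>p. T p u))"

definition smooth_bil ::
    "'a::real_normed_vector set \<Rightarrow> ('a \<Rightarrow> 'u::euclidean_space \<Rightarrow> 'w::euclidean_space \<Rightarrow> 'c::euclidean_space) \<Rightarrow> bool" where
  "smooth_bil S b \<longleftrightarrow> (\<forall>p\<in>S. bilinear (b p)) \<and> (\<forall>u w. smooth_on S (\<lambda>p. b p u w))"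

lemma linear_euclidean_sum:
  fixes T :: "'u::euclidean_space \<Rightarrow> 'c::real_vector"
  assumes "linear T"
  shows "T u = (\<Sum>b\<in>Basis. (u \<bullet> b) *\<^sub>R T b)"
proof -
  have "T u = T (\<Sum>b\<in>Basis. (u \<bullet> b) *\<^sub>R b)" by (simp add: euclidean_representation)
  also have "\<dots> = (\<Sum>b\<in>Basis. (u \<bullet> b) *\<^sub>R T b)"
    by (simp add: linear_sum[OF assms] linear_scale[OF assms])
  finally show ?thesis .
qed

text \<open>A Leibniz rule, obtained by expanding the argument in a basis. The first summand
  differentiates the family with its argument frozen at \<open>X x\<close>.\<close>

lemma smooth_lin_has_derivative:
  assumes S: "open S" "x \<in> S" and T: "smooth_lin S T" and X: "X differentiable (at x)"
  shows "((\<lambda>p. T p (X p)) has_derivative (\<lambda>v. dd v (\<lambda>p. T p (X x)) x + T x (dd v X x))) (at x)"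
proof -
  have lin: "linear (T p)" if "p \<in> S" for p using T that by (simp add: smooth_lin_def)
  have dT: "((\<lambda>p. T p u) has_derivative (\<lambda>v. dd v (\<lambda>p. T p u) x)) (at x)" for u
    using T S(2) by (auto simp: smooth_lin_def intro: smooth_on_has_dd)
  note dX = has_derivative_inner_left[OF differentiable_has_dd[OF X]]
  have d: "((\<lambda>p. \<Sum>b\<in>Basis. (u p \<bullet> b) *\<^sub>R T p b) has_derivative
      (\<lambda>v. \<Sum>b\<in>Basis. (u x \<bullet> b) *\<^sub>R dd v (\<lambda>p. T p b) x + (u' v \<bullet> b) *\<^sub>R T x b)) (at x)"
    if "\<And>b. ((\<lambda>p. u p \<bullet> b) has_derivative (\<lambda>v. u' v \<bullet> b)) (at x)" for u u'
    by (intro has_derivative_sum has_derivative_scaleR dT that)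
  have c: "dd v (\<lambda>p. T p u) x = (\<Sum>b\<in>Basis. (u \<bullet> b) *\<^sub>R dd v (\<lambda>p. T p b) x)" for u v
  proof -
    have "dd v (\<lambda>p. T p u) x = dd v (\<lambda>p. \<Sum>b\<in>Basis. (u \<bullet> b) *\<^sub>R T p b) x"
      by (rule dd_cong_open[OF S]) (rule linear_euclidean_sum[OF lin])
    also have "\<dots> = (\<Sum>b\<in>Basis. (u \<bullet> b) *\<^sub>R dd v (\<lambda>p. T p b) x)"
      using dd_eq[OF d[of "\<lambda>_. u" "\<lambda>_. 0"]] by simp
    finally show ?thesis .
  qed
  have "((\<lambda>p. \<Sum>b\<in>Basis. (X p \<bullet> b) *\<^sub>R T p b) has_derivative
      (\<lambda>v. dd v (\<lambda>p. T p (X x)) x + T x (dd v X x))) (at x)"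
    using d[OF dX] unfolding c[of _ "X x"] linear_euclidean_sum[OF lin[OF S(2)], of "dd _ X x"]
    by (simp add: sum.distrib)
  then show ?thesis
    by (rule has_derivative_transfer_open[OF _ S linear_euclidean_sum[OF lin]])
qed

lemma smooth_lin_dd:
  assumes "open S" "x \<in> S" "smooth_lin S T" "X differentiable (at x)"
  shows "dd v (\<lambda>p. T p (X p)) x = dd v (\<lambda>p. T p (X x)) x + T x (dd v X x)"
  by (rule dd_eq[OF smooth_lin_has_derivative[OF assms]])

lemma smooth_lin_smooth:
  assumes S: "open S" and T: "smooth_lin S T" and X: "smooth_on S X"
  shows "smooth_on S (\<lambda>p. T p (X p))"
proof (rule smooth_on_transfer[OF _ S])
  show "smooth_on S (\<lambda>p. \<Sum>b\<in>Basis. (X p \<bullet> b) *\<^sub>R T p b)"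
    using T by (intro smooth_on_sum smooth_on_scaleR smooth_on_inner S X smooth_on_const)
      (simp add: smooth_lin_def)
  show "T p (X p) = (\<Sum>b\<in>Basis. (X p \<bullet> b) *\<^sub>R T p b)" if "p \<in> S" for p
    using T that by (intro linear_euclidean_sum) (simp add: smooth_lin_def)
qed

lemma smooth_bil_left: "smooth_bil S b \<Longrightarrow> smooth_lin S (\<lambda>p u. b p u w)"
  and smooth_bil_right: "smooth_bil S b \<Longrightarrow> smooth_lin S (\<lambda>p. b p u)"
  by (auto simp: smooth_bil_def smooth_lin_def bilinear_def)

lemma smooth_bil_left_fun:
  assumes S: "open S" and b: "smooth_bil S b" and Y: "smooth_on S Y"
  shows "smooth_lin S (\<lambda>p u. b p u (Y p))"
  using smooth_lin_smooth[OF S smooth_bil_right[OF b] Y] b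
  by (auto simp: smooth_lin_def smooth_bil_def bilinear_def)

lemma smooth_bil_smooth:
  assumes S: "open S" and b: "smooth_bil S b" and X: "smooth_on S X" and Y: "smooth_on S Y"
  shows "smooth_on S (\<lambda>p. b p (X p) (Y p))"
  by (rule smooth_lin_smooth[OF S smooth_bil_left_fun[OF S b Y] X])

lemma smooth_bil_dd:
  assumes S: "open S" "x \<in> S" and b: "smooth_bil S b" and X: "smooth_on S X" and Y: "smooth_on S Y"
  shows "dd v (\<lambda>p. b p (X p) (Y p)) x =
    dd v (\<lambda>p. b p (X x) (Y x)) x + b x (dd v X x) (Y x) + b x (X x) (dd v Y x)"
  using smooth_lin_dd[OF S smooth_bil_left_fun[OF S(1) b Y] smooth_on_differentiable[OF X S(2)], of v]
    smooth_lin_dd[OF S smooth_bil_right[OF b] smooth_on_differentiable[OF Y S(2)], of v "X x"]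
  by simp

lemma smooth_linD: "smooth_lin S T \<Longrightarrow> p \<in> S \<Longrightarrow> linear (T p)"
  and smooth_lin_on: "smooth_lin S T \<Longrightarrow> smooth_on S (\<lambda>p. T p u)"
  by (auto simp: smooth_lin_def)

lemma smooth_bilD: "smooth_bil S b \<Longrightarrow> p \<in> S \<Longrightarrow> bilinear (b p)"
  and smooth_bil_on: "smooth_bil S b \<Longrightarrow> smooth_on S (\<lambda>p. b p u w)"
  by (auto simp: smooth_bil_def)

lemmas bilinear_simps = bilinear_ladd bilinear_radd bilinear_lmul bilinear_rmul
  bilinear_lneg bilinear_rneg bilinear_lsub bilinear_rsub bilinear_lzero bilinear_rzero

lemmas linear_map_simps = linear_add linear_diff linear_neg linear_scale linear_0

lemma dd_add:
  assumes "f differentiable (at x)" "g differentiable (at x)"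
  shows "dd v (\<lambda>x. f x + g x) x = dd v f x + dd v g x"
  by (rule dd_eq) (intro has_derivative_add differentiable_has_dd assms)

lemma dd_diff:
  assumes "f differentiable (at x)" "g differentiable (at x)"
  shows "dd v (\<lambda>x. f x - g x) x = dd v f x - dd v g x"
  by (rule dd_eq) (intro has_derivative_diff differentiable_has_dd assms)

lemma dd_const [simp]: "dd v (\<lambda>x. c) x = 0"
  by (rule dd_eq) (rule has_derivative_const)

section \<open>Connections and curvature\<close>

text \<open>The connection with form \<open>\<Gamma>\<close> in a trivial bundle. The fibre
  \<open>'w\<close> may differ from the space of directions: besides the tangent bundle, a bundle
  with one extra real coordinate is needed for the position vector field.\<close>

definition cd ::
    "('v::real_normed_vector \<Rightarrow> 'v \<Rightarrow> 'w::real_normed_vector \<Rightarrow> 'w) \<Rightarrow> 'v \<Rightarrow> ('v \<Rightarrow> 'w) \<Rightarrow> 'v \<Rightarrow> 'w" where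
  "cd \<Gamma> x Y p = dd x Y p + \<Gamma> p x (Y p)"

text \<open>The directions \<open>x\<close> and \<open>y\<close> stand for constant vector fields, so there is no bracket term.\<close>

definition Rm ::
    "('v::real_normed_vector \<Rightarrow> 'v \<Rightarrow> 'w::real_normed_vector \<Rightarrow> 'w) \<Rightarrow> 'v \<Rightarrow> 'v \<Rightarrow> 'v \<Rightarrow> 'w \<Rightarrow> 'w" where
  "Rm \<Gamma> p x y z = dd x (\<lambda>q. \<Gamma> q y z) p - dd y (\<lambda>q. \<Gamma> q x z) p
     + \<Gamma> p x (\<Gamma> p y z) - \<Gamma> p y (\<Gamma> p x z)"

lemma smooth_on_cd:
  assumes "open U" "smooth_bil U \<Gamma>" "smooth_on U Y"
  shows "smooth_on U (cd \<Gamma> x Y)"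
  unfolding cd_def[abs_def]
  by (rule smooth_on_add[OF assms(1) smooth_on_dd[OF assms(3)]
        smooth_bil_smooth[OF assms(1,2) smooth_on_const assms(3)]])

lemma cd_cong_open:
  assumes "open U" "p \<in> U" "\<And>q. q \<in> U \<Longrightarrow> Y q = Z q"
  shows "cd \<Gamma> x Y p = cd \<Gamma> x Z p"
  using dd_cong_open[OF assms] assms by (simp add: cd_def)

lemma cd_cd:
  assumes U: "open U" "p \<in> U" and \<Gamma>: "smooth_bil U \<Gamma>" and Y: "smooth_on U Y"
  shows "cd \<Gamma> x (cd \<Gamma> y Y) p = dd x (dd y Y) p + dd x (\<lambda>q. \<Gamma> q y (Y p)) p
    + \<Gamma> p y (dd x Y p) + \<Gamma> p x (dd y Y p) + \<Gamma> p x (\<Gamma> p y (Y p))"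
proof -
  have s: "smooth_on U (\<lambda>q. \<Gamma> q y (Y q))" by (rule smooth_bil_smooth[OF U(1) \<Gamma> smooth_on_const Y])
  have "dd x (cd \<Gamma> y Y) p = dd x (dd y Y) p + dd x (\<lambda>q. \<Gamma> q y (Y q)) p"
    unfolding cd_def[abs_def]
    by (rule dd_add[OF smooth_on_differentiable[OF smooth_on_dd[OF Y] U(2)]
          smooth_on_differentiable[OF s U(2)]])
  also have "dd x (\<lambda>q. \<Gamma> q y (Y q)) p = dd x (\<lambda>q. \<Gamma> q y (Y p)) p + \<Gamma> p y (dd x Y p)"
    using smooth_bil_dd[OF U \<Gamma> smooth_on_const Y, of x y] bilinear_lzero[OF smooth_bilD[OF \<Gamma> U(2)]] by simp
  finally show ?thesis
    unfolding cd_def[of _ _ "cd \<Gamma> y Y"] unfolding cd_def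
    by (simp add: bilinear_radd[OF smooth_bilD[OF \<Gamma> U(2)]])
qed

text \<open>In \<open>cd_cd\<close> the second derivatives of \<open>Y\<close> commute and the two
  terms with a first derivative of \<open>Y\<close> are exchanged. Only terms of order zero in
  \<open>Y\<close> survive the antisymmetrisation.\<close>

lemma ricci_identity:
  assumes U: "open U" "p \<in> U" and \<Gamma>: "smooth_bil U \<Gamma>" and Y: "smooth_on U Y"
  shows "cd \<Gamma> x (cd \<Gamma> y Y) p - cd \<Gamma> y (cd \<Gamma> x Y) p = Rm \<Gamma> p x y (Y p)"
  unfolding cd_cd[OF assms] Rm_def using clairaut[OF U(1) Y U(2), of x y] by simp

lemma Rm_swap: "Rm \<Gamma> p y x z = - Rm \<Gamma> p x y z"
  by (simp add: Rm_def)

text \<open>By the hypothesis, \<open>T\<close> carries covariant derivatives for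
  \<open>\<Gamma>\<close> to those for \<open>\<Gamma>'\<close>, hence also their commutators;
  constant sections suffice as test sections. Used with \<open>S\<close> for the dual connection and
  with the derivative of a map for isometries.\<close>

lemma Rm_gauge:
  assumes U: "open U" "p \<in> U" and \<Gamma>: "smooth_bil U \<Gamma>" "smooth_bil U \<Gamma>'" and T: "smooth_lin U T"
    and eq: "\<And>q x z. q \<in> U \<Longrightarrow> T q (\<Gamma> q x z) = dd x (\<lambda>q. T q z) q + \<Gamma>' q x (T q z)"
  shows "T p (Rm \<Gamma> p x y z) = Rm \<Gamma>' p x y (T p z)"
proof -
  have i: "T q (cd \<Gamma> x Z q) = cd \<Gamma>' x (\<lambda>q. T q (Z q)) q" if q: "q \<in> U" and Z: "smooth_on U Z" for q x Z
    using smooth_lin_dd[OF U(1) q T smooth_on_differentiable[OF Z q], of x] eq[OF q, of x "Z q"]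
    by (simp add: cd_def linear_add[OF smooth_linD[OF T q]])
  have i2: "T p (cd \<Gamma> x (cd \<Gamma> y Z) p) = cd \<Gamma>' x (cd \<Gamma>' y (\<lambda>q. T q (Z q))) p" if Z: "smooth_on U Z" for x y Z
  proof -
    have "T p (cd \<Gamma> x (cd \<Gamma> y Z) p) = cd \<Gamma>' x (\<lambda>q. T q (cd \<Gamma> y Z q)) p"
      by (rule i[OF U(2) smooth_on_cd[OF U(1) \<Gamma>(1) Z]])
    also have "\<dots> = cd \<Gamma>' x (cd \<Gamma>' y (\<lambda>q. T q (Z q))) p"
      by (rule cd_cong_open[OF U]) (rule i[OF _ Z])
    finally show ?thesis .
  qed
  have "T p (Rm \<Gamma> p x y z) = T p (cd \<Gamma> x (cd \<Gamma> y (\<lambda>_. z)) p - cd \<Gamma> y (cd \<Gamma> x (\<lambda>_. z)) p)"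
    using ricci_identity[OF U \<Gamma>(1) smooth_on_const, of x y z] by simp
  also have "\<dots> = Rm \<Gamma>' p x y (T p z)"
    unfolding linear_diff[OF smooth_linD[OF T U(2)]] i2[OF smooth_on_const]
    by (rule ricci_identity[OF U \<Gamma>(2) smooth_lin_on[OF T]])
  finally show ?thesis .
qed

text \<open>Pullback of the bundle, not of tangent vectors: only the direction slot is composed with
  the derivative of \<open>\<psi>\<close>, so no inverse of that derivative occurs. The second
  derivatives of \<open>\<psi>\<close> cancel by symmetry.\<close>

lemma Rm_pullback:
  fixes \<psi> :: "'v::euclidean_space \<Rightarrow> 'v2::euclidean_space"
  assumes U: "open U" "p \<in> U" and V: "open V" "\<psi> ` U \<subseteq> V" and \<psi>: "smooth_on U \<psi>" and \<Gamma>: "smooth_bil V \<Gamma>"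
  defines "\<Gamma>' \<equiv> \<lambda>q x. \<Gamma> (\<psi> q) (dd x \<psi> q)"
  shows "smooth_bil U \<Gamma>'" "Rm \<Gamma>' p x y z = Rm \<Gamma> (\<psi> p) (dd x \<psi> p) (dd y \<psi> p) z"
proof -
  have bil: "smooth_bil U (\<lambda>q. \<Gamma> (\<psi> q))"
    using \<Gamma> V smooth_on_compose[OF U(1) V \<psi> smooth_bil_on[OF \<Gamma>]] by (auto simp: smooth_bil_def)
  show "smooth_bil U \<Gamma>'"
    unfolding smooth_bil_def \<Gamma>'_def
  proof (intro conjI ballI allI)
    show "smooth_on U (\<lambda>p. \<Gamma> (\<psi> p) (dd u \<psi> p) w)" for u w
      by (rule smooth_bil_smooth[OF U(1) bil smooth_on_dd[OF \<psi>] smooth_on_const])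
    show "bilinear (\<lambda>x. \<Gamma> (\<psi> q) (dd x \<psi> q))" if "q \<in> U" for q
      using smooth_bilD[OF bil that] linear_dd[OF smooth_on_differentiable[OF \<psi> that]]
      unfolding bilinear_def by (auto intro: linear_compose[unfolded o_def])
  qed
  have d: "dd x (\<lambda>q. \<Gamma> (\<psi> q) (dd y \<psi> q) z) p =
    dd (dd x \<psi> p) (\<lambda>q. \<Gamma> q (dd y \<psi> p) z) (\<psi> p) + \<Gamma> (\<psi> p) (dd x (dd y \<psi>) p) z" for x y
  proof -
    have "dd x (\<lambda>q. \<Gamma> (\<psi> q) (dd y \<psi> p) z) p = dd (dd x \<psi> p) (\<lambda>q. \<Gamma> q (dd y \<psi> p) z) (\<psi> p)"
      using V U(2) by (intro dd_compose[of \<psi> p "\<lambda>q. \<Gamma> q (dd y \<psi> p) z"] smooth_on_differentiable[OF \<psi>]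
        smooth_on_differentiable[OF smooth_bil_on[OF \<Gamma>]]) auto
    then show ?thesis
      using smooth_bil_dd[OF U bil smooth_on_dd[OF \<psi>] smooth_on_const, of x y z]
        bilinear_rzero[OF smooth_bilD[OF bil U(2)]] by simp
  qed
  show "Rm \<Gamma>' p x y z = Rm \<Gamma> (\<psi> p) (dd x \<psi> p) (dd y \<psi> p) z"
    unfolding Rm_def \<Gamma>'_def d using clairaut[OF U(1) \<psi> U(2), of x y] by simp
qed

section \<open>Metrics, Levi-Civita connections and symmetries of the curvature\<close>

definition metric_field :: "'v::euclidean_space set \<Rightarrow> ('v \<Rightarrow> 'v \<Rightarrow> 'v \<Rightarrow> real) \<Rightarrow> bool" where
  "metric_field U g \<longleftrightarrow> open U \<and> smooth_bil U g \<and>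
     (\<forall>p\<in>U. (\<forall>x y. g p x y = g p y x) \<and> (\<forall>x. x \<noteq> 0 \<longrightarrow> g p x x > 0))"

text \<open>A characterisation instead of the Christoffel formula, so that connections obtained by
  conformal change or by duality can be recognised and then identified by uniqueness.\<close>

definition levi_civita ::
    "'v::euclidean_space set \<Rightarrow> ('v \<Rightarrow> 'v \<Rightarrow> 'v \<Rightarrow> real) \<Rightarrow> ('v \<Rightarrow> 'v \<Rightarrow> 'v \<Rightarrow> 'v) \<Rightarrow> bool" where
  "levi_civita U g \<Gamma> \<longleftrightarrow> smooth_bil U \<Gamma> \<and>
     (\<forall>p\<in>U. \<forall>x y. \<Gamma> p x y = \<Gamma> p y x) \<and>
     (\<forall>p\<in>U. \<forall>x y z. dd x (\<lambda>q. g q y z) p = g p (\<Gamma> p x y) z + g p y (\<Gamma> p x z))"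

lemma metric_fieldD:
  assumes "metric_field U g"
  shows "open U" "smooth_bil U g" "p \<in> U \<Longrightarrow> bilinear (g p)" "p \<in> U \<Longrightarrow> g p x y = g p y x"
    "p \<in> U \<Longrightarrow> x \<noteq> 0 \<Longrightarrow> g p x x > 0"
  using assms by (auto simp: metric_field_def smooth_bil_def)

lemma levi_civitaD:
  assumes "levi_civita U g \<Gamma>"
  shows "smooth_bil U \<Gamma>" "p \<in> U \<Longrightarrow> bilinear (\<Gamma> p)" "p \<in> U \<Longrightarrow> \<Gamma> p x y = \<Gamma> p y x"
    "p \<in> U \<Longrightarrow> dd x (\<lambda>q. g q y z) p = g p (\<Gamma> p x y) z + g p y (\<Gamma> p x z)"
  using assms by (auto simp: levi_civita_def smooth_bil_def)

lemma metric_field_nondeg: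
  assumes g: "metric_field U g" and p: "p \<in> U" and eq: "\<And>z. g p x z = g p y z"
  shows "x = y"
proof (rule ccontr)
  assume "x \<noteq> y"
  then have "g p (x - y) (x - y) > 0" using metric_fieldD(5)[OF g p] by simp
  then show False using eq[of "x - y"] bilinear_lsub[OF metric_fieldD(3)[OF g p], of x y "x - y"] by simp
qed

text \<open>Koszul's combination of three metricity equations isolates
  \<open>2 * g p (\<Gamma> x y) z\<close>. The form at a single point \<open>p\<close> allows a
  competitor that is constructed at that point only, as for isometries.\<close>

lemma koszul_uniqueness:
  assumes g: "metric_field U g" and p: "p \<in> U"
    and s: "\<And>x y. \<Gamma>1 x y = \<Gamma>1 y x" "\<And>x y. \<Gamma>2 x y = \<Gamma>2 y x"
    and c: "\<And>x y z. dd x (\<lambda>q. g q y z) p = g p (\<Gamma>1 x y) z + g p y (\<Gamma>1 x z)"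
      "\<And>x y z. dd x (\<lambda>q. g q y z) p = g p (\<Gamma>2 x y) z + g p y (\<Gamma>2 x z)"
  shows "\<Gamma>1 x y = \<Gamma>2 x y"
proof (rule metric_field_nondeg[OF g p])
  fix z
  have k: "2 * g p (\<Gamma> x y) z = dd x (\<lambda>q. g q y z) p + dd y (\<lambda>q. g q x z) p - dd z (\<lambda>q. g q x y) p"
    if "\<And>x y. \<Gamma> x y = \<Gamma> y x" "\<And>x y z. dd x (\<lambda>q. g q y z) p = g p (\<Gamma> x y) z + g p y (\<Gamma> x z)" for \<Gamma>
    unfolding that(2) using that(1)[of x z] that(1)[of y z] that(1)[of x y]
      metric_fieldD(4)[OF g p, of x "\<Gamma> y z"] metric_fieldD(4)[OF g p, of y "\<Gamma> x z"] by simp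
  show "g p (\<Gamma>1 x y) z = g p (\<Gamma>2 x y) z"
    using k[of \<Gamma>1, OF s(1) c(1)] k[of \<Gamma>2, OF s(2) c(2)] by linarith
qed

lemma levi_civita_metric_dd:
  assumes g: "metric_field U g" and lc: "levi_civita U g \<Gamma>" and p: "p \<in> U"
    and Y: "smooth_on U Y" and Z: "smooth_on U Z"
  shows "dd x (\<lambda>q. g q (Y q) (Z q)) p = g p (cd \<Gamma> x Y p) (Z p) + g p (Y p) (cd \<Gamma> x Z p)"
  unfolding smooth_bil_dd[OF metric_fieldD(1)[OF g] p metric_fieldD(2)[OF g] Y Z] cd_def
    levi_civitaD(4)[OF lc p]
  by (simp add: bilinear_simps[OF metric_fieldD(3)[OF g p]])

text \<open>Second derivatives of the function \<open>g q (Z q) (W q)\<close> commute. Expanding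
  both orders by metricity, the mixed terms cancel and the two commutators remain.\<close>

lemma Rm_skew:
  assumes g: "metric_field U g" and lc: "levi_civita U g \<Gamma>" and p: "p \<in> U"
  shows "g p (Rm \<Gamma> p x y z) w = - g p z (Rm \<Gamma> p x y w)"
proof -
  note U = metric_fieldD(1)[OF g]
  note \<Gamma> = levi_civitaD(1)[OF lc]
  note bil = metric_fieldD(3)[OF g p]
  define Z where "Z = (\<lambda>q::'a. z)"
  define W where "W = (\<lambda>q::'a. w)"
  have s: "smooth_on U Z" "smooth_on U W" by (simp_all add: Z_def W_def)
  have sc: "smooth_on U (cd \<Gamma> x Z)" "smooth_on U (cd \<Gamma> x W)" for x
    by (intro smooth_on_cd U \<Gamma> s)+
  have d: "dd x (dd y (\<lambda>q. g q (Z q) (W q))) p =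
      g p (cd \<Gamma> x (cd \<Gamma> y Z) p) w + g p (cd \<Gamma> y Z p) (cd \<Gamma> x W p)
      + (g p (cd \<Gamma> x Z p) (cd \<Gamma> y W p) + g p z (cd \<Gamma> x (cd \<Gamma> y W) p))" for x y
  proof -
    have "dd x (dd y (\<lambda>q. g q (Z q) (W q))) p
      = dd x (\<lambda>q. g q (cd \<Gamma> y Z q) (W q) + g q (Z q) (cd \<Gamma> y W q)) p"
      by (rule dd_cong_open[OF U p]) (rule levi_civita_metric_dd[OF g lc _ s])
    also have "\<dots> = dd x (\<lambda>q. g q (cd \<Gamma> y Z q) (W q)) p + dd x (\<lambda>q. g q (Z q) (cd \<Gamma> y W q)) p"
      by (rule dd_add) (rule smooth_on_differentiable[OF _ p],
          rule smooth_bil_smooth[OF U metric_fieldD(2)[OF g]], rule s sc, rule s sc)+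
    finally show ?thesis
      unfolding levi_civita_metric_dd[OF g lc p sc(1) s(2)] levi_civita_metric_dd[OF g lc p s(1) sc(2)]
      by (simp add: Z_def W_def)
  qed
  have r: "Rm \<Gamma> p x y z = cd \<Gamma> x (cd \<Gamma> y Z) p - cd \<Gamma> y (cd \<Gamma> x Z) p"
    "Rm \<Gamma> p x y w = cd \<Gamma> x (cd \<Gamma> y W) p - cd \<Gamma> y (cd \<Gamma> x W) p"
    using ricci_identity[OF U p \<Gamma> s(1), of x y] ricci_identity[OF U p \<Gamma> s(2), of x y] by (simp_all add: Z_def W_def)
  have "smooth_on U (\<lambda>q. g q (Z q) (W q))"
    by (rule smooth_bil_smooth[OF U metric_fieldD(2)[OF g] s])
  from clairaut[OF U this p, of x y] show ?thesis
    unfolding d r by (simp add: bilinear_simps[OF bil])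
qed

lemma Rm_bianchi:
  assumes U: "open U" "p \<in> U" and \<Gamma>: "smooth_bil U \<Gamma>" and s: "\<And>q x y. q \<in> U \<Longrightarrow> \<Gamma> q x y = \<Gamma> q y x"
  shows "Rm \<Gamma> p x y z + Rm \<Gamma> p y z x + Rm \<Gamma> p z x y = 0"
proof -
  have "dd u (\<lambda>q. \<Gamma> q v w) p = dd u (\<lambda>q. \<Gamma> q w v) p" for u v w
    by (rule dd_cong_open[OF U]) (rule s)
  then show ?thesis
    unfolding Rm_def s[OF U(2), of z x] s[OF U(2), of y z] s[OF U(2), of y x]
    by (simp add: algebra_simps)
qed

lemma dd_smooth_lin_linear:
  assumes S: "open S" "x \<in> S" and T: "smooth_lin S T"
  shows "linear (\<lambda>u. dd v (\<lambda>p. T p u) x)"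
proof (rule linearI)
  note d = smooth_on_differentiable[OF smooth_lin_on[OF T] S(2)]
  show "dd v (\<lambda>p. T p (u + w)) x = dd v (\<lambda>p. T p u) x + dd v (\<lambda>p. T p w) x" for u w
  proof -
    have "dd v (\<lambda>p. T p (u + w)) x = dd v (\<lambda>p. T p u + T p w) x"
      by (rule dd_cong_open[OF S]) (rule linear_add[OF smooth_linD[OF T]])
    then show ?thesis using dd_add[OF d d] by simp
  qed
  show "dd v (\<lambda>p. T p (r *\<^sub>R u)) x = r *\<^sub>R dd v (\<lambda>p. T p u) x" for r u
  proof -
    have "dd v (\<lambda>p. T p (r *\<^sub>R u)) x = dd v (\<lambda>p. r *\<^sub>R T p u) x"
      by (rule dd_cong_open[OF S]) (rule linear_scale[OF smooth_linD[OF T]])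
    also have "\<dots> = r *\<^sub>R dd v (\<lambda>p. T p u) x"
      by (rule dd_eq) (intro has_derivative_scaleR_right differentiable_has_dd d)
    finally show ?thesis .
  qed
qed

lemma Rm_linear:
  assumes U: "open U" "p \<in> U" and \<Gamma>: "smooth_bil U \<Gamma>"
  shows "linear (\<lambda>x. Rm \<Gamma> p x y z)" "linear (\<lambda>y. Rm \<Gamma> p x y z)" "linear (\<lambda>z. Rm \<Gamma> p x y z)"
proof -
  note bil = smooth_bilD[OF \<Gamma> U(2)]
  note l = dd_smooth_lin_linear[OF U smooth_bil_left[OF \<Gamma>]] dd_smooth_lin_linear[OF U smooth_bil_right[OF \<Gamma>]]
  note l' = linear_dd[OF smooth_on_differentiable[OF smooth_bil_on[OF \<Gamma>] U(2)]]
  show 1: "linear (\<lambda>x. Rm \<Gamma> p x y z)" for y z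
    unfolding Rm_def
    by (rule linearI)
      (simp_all add: bilinear_simps[OF bil] linear_add[OF l(1)] linear_add[OF l']
        linear_scale[OF l(1)] linear_scale[OF l'] algebra_simps)
  have "linear (\<lambda>y. - Rm \<Gamma> p y x z)" by (rule linear_compose_neg[OF 1])
  then show "linear (\<lambda>y. Rm \<Gamma> p x y z)" by (simp add: Rm_swap[of \<Gamma> p x])
  show "linear (\<lambda>z. Rm \<Gamma> p x y z)"
    unfolding Rm_def
    by (rule linearI)
      (simp_all add: bilinear_simps[OF bil] linear_add[OF l(2)] linear_scale[OF l(2)] algebra_simps)
qed

text \<open>Two polarisations: a quadrilinear form with the symmetries of a curvature tensor is
  determined by its sectional values.\<close>

lemma curvature_like_zero:
  fixes Q :: "'v::ab_group_add \<Rightarrow> 'v \<Rightarrow> 'v \<Rightarrow> 'v \<Rightarrow> real"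
  assumes add: "\<And>x x' y z w. Q (x + x') y z w = Q x y z w + Q x' y z w"
      "\<And>x y y' z w. Q x (y + y') z w = Q x y z w + Q x y' z w"
      "\<And>x y z z' w. Q x y (z + z') w = Q x y z w + Q x y z' w"
      "\<And>x y z w w'. Q x y z (w + w') = Q x y z w + Q x y z w'"
    and anti: "\<And>x y z w. Q y x z w = - Q x y z w" "\<And>x y z w. Q x y w z = - Q x y z w"
    and bianchi: "\<And>x y z w. Q x y z w + Q y z x w + Q z x y w = 0"
    and sec: "\<And>x y. Q x y y x = 0"
  shows "Q x y z w = 0"
proof -
  \<comment> \<open>Symmetry under exchange of pairs: the Bianchi identities for the four cyclic
    shifts of the arguments, combined with the antisymmetries.\<close>
  have pair: "Q x y z w = Q z w x y" for x y z w
    using bianchi[of x y z w] bianchi[of y z w x] bianchi[of z w x y] bianchi[of w x y z]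
      anti(1)[of x y z w] anti(1)[of y z w x] anti(1)[of z w x y] anti(1)[of w x y z]
      anti(1)[of x z y w] anti(1)[of y w z x]
      anti(2)[of x y z w] anti(2)[of y z x w] anti(2)[of z x y w] anti(2)[of z w x y]
      anti(2)[of w x y z] anti(2)[of w y z x] anti(2)[of x z w y] anti(2)[of y w x z]
    by linarith
  have a: "Q x y y w = 0" for x y w
    using sec[of "x + w" y] sec[of x y] sec[of w y] pair[of w y y x] anti(1)[of y x w y] anti(2)[of x y w y]
    unfolding add by linarith
  have b: "Q x y z w = - Q x z y w" for x y z w
    using a[of x "y + z" w] a[of x y w] a[of x z w] unfolding add by linarith
  \<comment> \<open>\<open>Q\<close> is now alternating in its first three arguments. Cyclic
    permutations of them are even, so the Bianchi identity reads
    \<open>3 * Q x y z w = 0\<close>.\<close>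
  show ?thesis
    using bianchi[of x y z w] b[of x y z w] b[of z x y w] b[of y z x w] anti(1)[of x z y w]
      anti(1)[of y x z w] anti(1)[of z y x w] by linarith
qed

text \<open>Passes from the numerators of sectional curvatures, by which flatness is defined, to the
  curvature itself.\<close>

lemma Rm_zero_of_sectional:
  assumes g: "metric_field U g" and lc: "levi_civita U g \<Gamma>" and p: "p \<in> U"
    and sec: "\<And>x y. g p (Rm \<Gamma> p x y y) x = 0"
  shows "Rm \<Gamma> p x y z = 0"
proof (rule metric_field_nondeg[OF g p])
  fix w
  note U = metric_fieldD(1)[OF g] and bil = metric_fieldD(3)[OF g p]
  note l = Rm_linear[OF U p levi_civitaD(1)[OF lc]]
  have "g p (Rm \<Gamma> p x y z) w = 0"
  proof (rule curvature_like_zero[where Q = "\<lambda>x y z w. g p (Rm \<Gamma> p x y z) w"])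
    fix x y z w
    show "g p (Rm \<Gamma> p x y w) z = - g p (Rm \<Gamma> p x y z) w"
      using Rm_skew[OF g lc p, of x y w z] metric_fieldD(4)[OF g p, of w] by simp
    show "g p (Rm \<Gamma> p x y z) w + g p (Rm \<Gamma> p y z x) w + g p (Rm \<Gamma> p z x y) w = 0"
      using Rm_bianchi[OF U p levi_civitaD(1)[OF lc] levi_civitaD(3)[OF lc], of x y z]
      by (simp add: bilinear_simps[OF bil] flip: bilinear_ladd[OF bil])
  next
    show "g p (Rm \<Gamma> p y x z) w = - g p (Rm \<Gamma> p x y z) w" for x y z w
      by (simp add: Rm_swap[of \<Gamma> p y] bilinear_simps[OF bil])
  qed (simp_all add: l[THEN linear_add] bilinear_simps[OF bil] sec)
  then show "g p (Rm \<Gamma> p x y z) w = g p 0 w"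
    by (simp add: bilinear_simps[OF bil])
qed

section \<open>Conformal change of a metric\<close>

text \<open>The Kulkarni-Nomizu product of \<open>h\<close> with the form \<open>h (S x) y\<close>,
  one index raised by \<open>h\<close>. With \<open>S\<close> half the identity it is the curvature
  of the unit sphere, whose Schouten tensor is half the metric.\<close>

definition kn :: "('v \<Rightarrow> 'v \<Rightarrow> real) \<Rightarrow> ('v::real_vector \<Rightarrow> 'v) \<Rightarrow> 'v \<Rightarrow> 'v \<Rightarrow> 'v \<Rightarrow> 'v" where
  "kn h S x y z = h (S y) z *\<^sub>R x - h (S x) z *\<^sub>R y + h y z *\<^sub>R S x - h x z *\<^sub>R S y"

lemma metric_field_conformal:
  assumes g: "metric_field U g" and s: "smooth_on U s"
  shows "metric_field U (\<lambda>q x y. exp (2 * s q) * g q x y)"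
  unfolding metric_field_def smooth_bil_def
proof (intro conjI ballI allI impI)
  note U = metric_fieldD(1)[OF g]
  show "open U" by (rule U)
  show "bilinear (\<lambda>x y. exp (2 * s p) * g p x y)" if "p \<in> U" for p
    unfolding bilinear_def
    by (auto intro!: linearI simp: bilinear_simps[OF metric_fieldD(3)[OF g that]] algebra_simps)
  show "smooth_on U (\<lambda>p. exp (2 * s p) * g p u w)" for u w
    by (intro smooth_on_mult smooth_on_exp U smooth_bil_on[OF metric_fieldD(2)[OF g]] s smooth_on_const)
qed (use metric_fieldD(4,5)[OF g] in auto)

text \<open>The classical Levi-Civita connection of \<open>exp (2 * s) * g\<close>. The gradient
  \<open>N\<close> of \<open>s\<close> is an argument because it is supplied in closed form wherever
  a specific factor is used.\<close>

definition conformal_lc ::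
    "('v::real_normed_vector \<Rightarrow> 'v \<Rightarrow> 'v \<Rightarrow> real) \<Rightarrow> ('v \<Rightarrow> real) \<Rightarrow> ('v \<Rightarrow> 'v) \<Rightarrow> ('v \<Rightarrow> 'v \<Rightarrow> 'v \<Rightarrow> 'v)
       \<Rightarrow> 'v \<Rightarrow> 'v \<Rightarrow> 'v \<Rightarrow> 'v" where
  "conformal_lc g s N \<Gamma> p x y = \<Gamma> p x y + dd x s p *\<^sub>R y + dd y s p *\<^sub>R x - g p x y *\<^sub>R N p"

text \<open>The Schouten tensor that a metric \<open>g\<close> has when \<open>exp (2 * s) * g\<close> is flat; \<open>N\<close> is the gradient of \<open>s\<close>.\<close>

definition conformal_schouten ::
    "('v::real_normed_vector \<Rightarrow> 'v \<Rightarrow> 'v \<Rightarrow> real) \<Rightarrow> ('v \<Rightarrow> real) \<Rightarrow> ('v \<Rightarrow> 'v) \<Rightarrow> ('v \<Rightarrow> 'v \<Rightarrow> 'v \<Rightarrow> 'v)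
       \<Rightarrow> 'v \<Rightarrow> 'v \<Rightarrow> 'v" where
  "conformal_schouten g s N \<Gamma> p x = cd \<Gamma> x N p - dd x s p *\<^sub>R N p + (g p (N p) (N p) / 2) *\<^sub>R x"

context
  fixes U and g :: "'v::euclidean_space \<Rightarrow> 'v \<Rightarrow> 'v \<Rightarrow> real" and \<Gamma> and s and N
  assumes g: "metric_field U g" and lc: "levi_civita U g \<Gamma>"
    and s: "smooth_on U s" and N: "smooth_on U N"
    and grad: "\<And>q x. q \<in> U \<Longrightarrow> dd x s q = g q (N q) x"
begin

lemma conformal_hess:
  assumes p: "p \<in> U"
  shows "dd x (dd y s) p = g p (cd \<Gamma> x N p) y + g p (N p) (\<Gamma> p x y)"
    "g p (cd \<Gamma> x N p) y = g p (cd \<Gamma> y N p) x"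
proof -
  show *: "dd x (dd y s) p = g p (cd \<Gamma> x N p) y + g p (N p) (\<Gamma> p x y)" for x y
  proof -
    have "dd x (dd y s) p = dd x (\<lambda>q. g q (N q) y) p"
      by (rule dd_cong_open[OF metric_fieldD(1)[OF g] p]) (rule grad)
    also have "\<dots> = g p (cd \<Gamma> x N p) y + g p (N p) (\<Gamma> p x y)"
      using levi_civita_metric_dd[OF g lc p N smooth_on_const, of x y] by (simp add: cd_def)
    finally show ?thesis .
  qed
  show "g p (cd \<Gamma> x N p) y = g p (cd \<Gamma> y N p) x"
    using clairaut[OF metric_fieldD(1)[OF g] s p, of x y] unfolding *
    by (simp add: levi_civitaD(3)[OF lc p, of x y])
qed

lemma conformal_schouten_sym:
  assumes p: "p \<in> U"
  shows "g p (conformal_schouten g s N \<Gamma> p x) y = g p x (conformal_schouten g s N \<Gamma> p y)"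
  using conformal_hess(2)[OF p, of x y] metric_fieldD(4)[OF g p, of x]
  by (simp add: conformal_schouten_def bilinear_simps[OF metric_fieldD(3)[OF g p]] grad[OF p])

lemma conformal_schouten_smooth: "smooth_lin U (conformal_schouten g s N \<Gamma>)"
  unfolding smooth_lin_def
proof (intro conjI ballI allI)
  note U = metric_fieldD(1)[OF g]
  fix p assume p: "p \<in> U"
  note l = linear_dd[OF smooth_on_differentiable[OF _ p]]
  show "linear (conformal_schouten g s N \<Gamma> p)"
    unfolding conformal_schouten_def[abs_def] cd_def
    by (rule linearI)
      (simp_all add: linear_add[OF l[OF s]] linear_add[OF l[OF N]] linear_scale[OF l[OF s]]
        linear_scale[OF l[OF N]] bilinear_simps[OF levi_civitaD(2)[OF lc p]] algebra_simps)
next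
  note U = metric_fieldD(1)[OF g]
  fix u
  have "smooth_on U (\<lambda>p. g p (N p) (N p))"
    by (rule smooth_bil_smooth[OF U metric_fieldD(2)[OF g] N N])
  then show "smooth_on U (\<lambda>p. conformal_schouten g s N \<Gamma> p u)"
    unfolding conformal_schouten_def
    by (intro smooth_on_add smooth_on_diff smooth_on_scaleR smooth_on_divide U N s smooth_on_const
        smooth_on_dd[OF s] smooth_on_cd[OF U levi_civitaD(1)[OF lc] N]) auto
qed

lemma conformal_levi_civita:
  "levi_civita U (\<lambda>q x y. exp (2 * s q) * g q x y) (conformal_lc g s N \<Gamma>)"
  unfolding levi_civita_def smooth_bil_def
proof (intro conjI ballI allI)
  note U = metric_fieldD(1)[OF g]
  show "smooth_on U (\<lambda>p. conformal_lc g s N \<Gamma> p u w)" for u w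
    unfolding conformal_lc_def
    by (intro smooth_on_add smooth_on_diff smooth_on_scaleR U N smooth_on_const smooth_on_dd[OF s]
        smooth_bil_on[OF levi_civitaD(1)[OF lc]] smooth_bil_on[OF metric_fieldD(2)[OF g]])
  fix p assume p: "p \<in> U"
  note l = linear_dd[OF smooth_on_differentiable[OF s p]]
  note bil = metric_fieldD(3)[OF g p]
  show "bilinear (conformal_lc g s N \<Gamma> p)"
    unfolding bilinear_def conformal_lc_def[abs_def]
    by (auto intro!: linearI simp: bilinear_simps[OF levi_civitaD(2)[OF lc p]] bilinear_simps[OF bil]
        linear_add[OF l] linear_scale[OF l] algebra_simps)
  show "conformal_lc g s N \<Gamma> p x y = conformal_lc g s N \<Gamma> p y x" for x y
    unfolding conformal_lc_def by (simp add: levi_civitaD(3)[OF lc p, of x] metric_fieldD(4)[OF g p, of x])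
  fix x y z
  have e: "((\<lambda>q. exp (2 * s q)) has_derivative (\<lambda>v. exp (2 * s p) * (2 * dd v s p))) (at p)"
    by (rule has_derivative_eq_rhs, rule has_derivative_exp, rule has_derivative_mult_right,
        rule smooth_on_has_dd[OF s p]) (simp add: fun_eq_iff)
  have "((\<lambda>q. exp (2 * s q) * g q y z) has_derivative
      (\<lambda>v. exp (2 * s p) * dd v (\<lambda>q. g q y z) p + exp (2 * s p) * (2 * dd v s p) * g p y z)) (at p)"
    by (rule has_derivative_mult[OF e smooth_on_has_dd[OF smooth_bil_on[OF metric_fieldD(2)[OF g]] p]])
  from dd_eq[OF this] show "dd x (\<lambda>q. exp (2 * s q) * g q y z) p =
      exp (2 * s p) * g p (conformal_lc g s N \<Gamma> p x y) z + exp (2 * s p) * g p y (conformal_lc g s N \<Gamma> p x z)"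
    unfolding conformal_lc_def levi_civitaD(4)[OF lc p]
    using metric_fieldD(4)[OF g p, of x y] metric_fieldD(4)[OF g p, of y "N p"]
    by (simp add: bilinear_simps[OF bil] grad[OF p] algebra_simps)
qed

text \<open>The classical transformation law: all derivatives at \<open>p\<close> are first
  expressed by the Hessian \<open>H\<close>, by \<open>\<Gamma>\<close> and by \<open>n\<close>,
  after which the claim is polynomial algebra.\<close>

lemma conformal_Rm:
  assumes p: "p \<in> U"
  shows "Rm (conformal_lc g s N \<Gamma>) p x y z = Rm \<Gamma> p x y z - kn (g p) (conformal_schouten g s N \<Gamma> p) x y z"
proof -
  note U = metric_fieldD(1)[OF g]
  note bil = metric_fieldD(3)[OF g p]
  note bilG = levi_civitaD(2)[OF lc p]
  note lcs = levi_civitaD(1)[OF lc]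
  define n where "n = N p"
  define H where "H x = cd \<Gamma> x N p" for x
  have dN: "dd x N p = H x - \<Gamma> p x n" for x by (simp add: H_def n_def cd_def)
  have d: "dd x (\<lambda>q. conformal_lc g s N \<Gamma> q y z) p = dd x (\<lambda>q. \<Gamma> q y z) p
     + (g p (H x) y + g p n (\<Gamma> p x y)) *\<^sub>R z + (g p (H x) z + g p n (\<Gamma> p x z)) *\<^sub>R y
     - ((g p (\<Gamma> p x y) z + g p y (\<Gamma> p x z)) *\<^sub>R n + g p y z *\<^sub>R (H x - \<Gamma> p x n))" for x y z
  proof -
    have "((\<lambda>q. conformal_lc g s N \<Gamma> q y z) has_derivative (\<lambda>v. dd v (\<lambda>q. \<Gamma> q y z) p
      + dd v (dd y s) p *\<^sub>R z + dd v (dd z s) p *\<^sub>R y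
      - (g p y z *\<^sub>R dd v N p + dd v (\<lambda>q. g q y z) p *\<^sub>R N p))) (at p)"
      unfolding conformal_lc_def
      by (intro has_derivative_diff has_derivative_add has_derivative_scaleR
          has_derivative_scaleR_left smooth_on_has_dd[OF _ p] N smooth_on_dd[OF s]
          smooth_bil_on[OF metric_fieldD(2)[OF g]] smooth_bil_on[OF lcs])
    from dd_eq[OF this] show ?thesis
      unfolding conformal_hess(1)[OF p] levi_civitaD(4)[OF lc p] dN
      by (simp add: n_def H_def)
  qed
  have G: "conformal_lc g s N \<Gamma> p x y = \<Gamma> p x y + g p n x *\<^sub>R y + g p n y *\<^sub>R x - g p x y *\<^sub>R n" for x y
    by (simp add: conformal_lc_def grad[OF p] n_def)
  have B: "conformal_schouten g s N \<Gamma> p x = H x - g p n x *\<^sub>R n + (g p n n / 2) *\<^sub>R x" for x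
    by (simp add: conformal_schouten_def H_def n_def grad[OF p])
  \<comment> \<open>The symmetries of the metric and of \<open>\<Gamma>\<close>, oriented as rewrite
    rules so that equal terms reach one normal form.\<close>
  have sg: "g p x n = g p n x" "g p y n = g p n y" "g p z n = g p n z" "g p z x = g p x z" "g p z y = g p y z"
    "g p y x = g p x y" "g p (\<Gamma> p y z) x = g p x (\<Gamma> p y z)" "g p (\<Gamma> p x z) y = g p y (\<Gamma> p x z)"
     "g p (\<Gamma> p x y) z = g p z (\<Gamma> p x y)" "\<Gamma> p y x = \<Gamma> p x y" "\<Gamma> p z x = \<Gamma> p x z" "\<Gamma> p z y = \<Gamma> p y z"
    using metric_fieldD(4)[OF g p] levi_civitaD(3)[OF lc p] by auto
  have Hs: "g p (H y) x = g p (H x) y"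
    unfolding H_def by (rule conformal_hess(2)[OF p])
  show ?thesis
  \<comment> \<open>Pairing with an arbitrary \<open>v\<close> turns the vector identity into one
    between real polynomials.\<close>
  proof (rule vector_eq_ldot[THEN iffD1], rule allI)
    fix v
    show "v \<bullet> Rm (conformal_lc g s N \<Gamma>) p x y z = v \<bullet> (Rm \<Gamma> p x y z - kn (g p) (conformal_schouten g s N \<Gamma> p) x y z)"
      unfolding Rm_def d unfolding G B kn_def
      by (simp add: bilinear_simps[OF bil] bilinear_simps[OF bilG] sg Hs inner_simps algebra_simps)
  qed
qed

end

section \<open>The linear system of a flat conformal factor\<close>

lemma cd_scale:
  assumes p: "p \<in> U" and \<Gamma>: "smooth_bil U \<Gamma>" and f: "smooth_on U f" and Y: "smooth_on U Y"
  shows "cd \<Gamma> x (\<lambda>q. f q *\<^sub>R Y q) p = dd x f p *\<^sub>R Y p + f p *\<^sub>R cd \<Gamma> x Y p"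
  unfolding cd_def
  by (simp add: dd_eq[OF has_derivative_scaleR[OF smooth_on_has_dd[OF f p] smooth_on_has_dd[OF Y p]]]
      bilinear_simps[OF smooth_bilD[OF \<Gamma> p]] algebra_simps)

lemma cd_diff:
  assumes p: "p \<in> U" and \<Gamma>: "smooth_bil U \<Gamma>" and Y: "smooth_on U Y" and Z: "smooth_on U Z"
  shows "cd \<Gamma> x (\<lambda>q. Y q - Z q) p = cd \<Gamma> x Y p - cd \<Gamma> x Z p"
  unfolding cd_def
  by (simp add: dd_diff[OF smooth_on_differentiable[OF Y p] smooth_on_differentiable[OF Z p]]
      bilinear_simps[OF smooth_bilD[OF \<Gamma> p]] algebra_simps)

text \<open>\<open>w\<close> is a function of its own, tied to the others by \<open>norm_P\<close>,
  so that \<open>u\<close> and \<open>w\<close> appear on an equal footing: duality exchanges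
  them.\<close>

locale conformally_flat_data =
  fixes U :: "'v::euclidean_space set" and g :: "'v \<Rightarrow> 'v \<Rightarrow> 'v \<Rightarrow> real" and \<Gamma> S u P w
  assumes g: "metric_field U g" and lc: "levi_civita U g \<Gamma>" and S: "smooth_lin U S"
    and u: "smooth_on U u" and P: "smooth_on U P" and w: "smooth_on U w"
    and u_pos: "p \<in> U \<Longrightarrow> u p > 0"
    and curv: "p \<in> U \<Longrightarrow> Rm \<Gamma> p x y z = kn (g p) (S p) x y z"
    and S_sym: "p \<in> U \<Longrightarrow> g p (S p x) y = g p x (S p y)"
    and grad: "p \<in> U \<Longrightarrow> dd x u p = g p (P p) x"
    and dP: "p \<in> U \<Longrightarrow> cd \<Gamma> x P p = w p *\<^sub>R x - u p *\<^sub>R S p x"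
    and norm_P: "p \<in> U \<Longrightarrow> g p (P p) (P p) = 2 * u p * w p"
begin

lemmas U = metric_fieldD(1)[OF g]
lemmas G = levi_civitaD(1)[OF lc]

text \<open>Differentiate \<open>norm_P\<close>. The terms with \<open>w p * g p (P p) x\<close> on
  both sides cancel by \<open>grad\<close> and \<open>dP\<close>, and the positive factor
  \<open>u p\<close> divides out.\<close>

lemma dd_w:
  assumes p: "p \<in> U"
  shows "dd x w p = - g p (P p) (S p x)"
proof -
  note bil = metric_fieldD(3)[OF g p]
  have "dd x (\<lambda>q. g q (P q) (P q)) p = dd x (\<lambda>q. 2 * (u q * w q)) p"
    by (rule dd_cong_open[OF U p]) (simp add: norm_P)
  also have "\<dots> = 2 * (u p * dd x w p + dd x u p * w p)"
    by (rule dd_eq[where f' = "\<lambda>x. 2 * (u p * dd x w p + dd x u p * w p)"])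
      (intro has_derivative_mult_right has_derivative_mult smooth_on_has_dd[OF _ p] u w)
  finally have "2 * (u p * dd x w p + dd x u p * w p) = 2 * g p (P p) (cd \<Gamma> x P p)"
    unfolding levi_civita_metric_dd[OF g lc p P P] using metric_fieldD(4)[OF g p, of "P p" "cd \<Gamma> x P p"] by simp
  then have "u p * dd x w p = - (u p * g p (P p) (S p x))"
    unfolding dP[OF p] grad[OF p] by (simp add: bilinear_simps[OF bil] algebra_simps)
  then show ?thesis using u_pos[OF p] by (metis mult_cancel_left mult_minus_right less_irrefl)
qed

text \<open>Apply the connection to \<open>u S y = w y - cd y P\<close> and antisymmetrise: the curvature term of the
  Ricci identity cancels the derivatives of \<open>u\<close> and \<open>w\<close>.\<close>

lemma codazzi:
  assumes p: "p \<in> U"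
  shows "cd \<Gamma> x (\<lambda>q. S q y) p = cd \<Gamma> y (\<lambda>q. S q x) p"
proof -
  note bil = metric_fieldD(3)[OF g p]
  note Ss = smooth_lin_on[OF S]
  have e: "u p *\<^sub>R cd \<Gamma> x (\<lambda>q. S q y) p =
      dd x w p *\<^sub>R y + w p *\<^sub>R \<Gamma> p x y - cd \<Gamma> x (cd \<Gamma> y P) p - dd x u p *\<^sub>R S p y" for x y
  proof -
    have "dd x u p *\<^sub>R S p y + u p *\<^sub>R cd \<Gamma> x (\<lambda>q. S q y) p = cd \<Gamma> x (\<lambda>q. u q *\<^sub>R S q y) p"
      by (rule cd_scale[OF p G u Ss, symmetric])
    also have "\<dots> = cd \<Gamma> x (\<lambda>q. w q *\<^sub>R y - cd \<Gamma> y P q) p"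
      by (rule cd_cong_open[OF U p]) (simp add: dP)
    also have "\<dots> = cd \<Gamma> x (\<lambda>q. w q *\<^sub>R y) p - cd \<Gamma> x (cd \<Gamma> y P) p"
      by (rule cd_diff[OF p G smooth_on_scaleR[OF U w smooth_on_const] smooth_on_cd[OF U G P]])
    also have "cd \<Gamma> x (\<lambda>q. w q *\<^sub>R y) p = dd x w p *\<^sub>R y + w p *\<^sub>R \<Gamma> p x y"
      using cd_scale[OF p G w smooth_on_const, of x y] by (simp add: cd_def)
    finally show ?thesis by (simp add: algebra_simps)
  qed
  have "u p *\<^sub>R cd \<Gamma> x (\<lambda>q. S q y) p - u p *\<^sub>R cd \<Gamma> y (\<lambda>q. S q x) p = 0"
  proof -
    have "u p *\<^sub>R cd \<Gamma> x (\<lambda>q. S q y) p - u p *\<^sub>R cd \<Gamma> y (\<lambda>q. S q x) p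
      = dd x w p *\<^sub>R y - dd y w p *\<^sub>R x - dd x u p *\<^sub>R S p y + dd y u p *\<^sub>R S p x
        - (cd \<Gamma> x (cd \<Gamma> y P) p - cd \<Gamma> y (cd \<Gamma> x P) p)"
      unfolding e levi_civitaD(3)[OF lc p, of y x] by simp
    also have "\<dots> = 0"
      unfolding ricci_identity[OF U p G P] curv[OF p] kn_def dd_w[OF p] grad[OF p]
      using metric_fieldD(4)[OF g p, of "P p"] by simp
    finally show ?thesis .
  qed
  then show ?thesis using u_pos[OF p] by simp
qed

end

context
  fixes U and g :: "'v::euclidean_space \<Rightarrow> 'v \<Rightarrow> 'v \<Rightarrow> real" and \<Gamma> and s and N
  assumes g: "metric_field U g" and lc: "levi_civita U g \<Gamma>"
    and s: "smooth_on U s" and N: "smooth_on U N"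
    and grad: "\<And>q x. q \<in> U \<Longrightarrow> dd x s q = g q (N q) x"
begin

text \<open>Here \<open>u = exp (- s)\<close> and \<open>P\<close> is its gradient. Differentiating
  the exponential in \<open>P\<close> absorbs the quadratic term
  \<open>dd x s p *\<^sub>R N p\<close> of \<open>conformal_schouten\<close>, which is why
  \<open>dP\<close> comes out linear.\<close>

lemma conformally_flat_data_of_flat:
  assumes flat: "\<And>p x y z. p \<in> U \<Longrightarrow> Rm (conformal_lc g s N \<Gamma>) p x y z = 0"
  shows "conformally_flat_data U g \<Gamma> (conformal_schouten g s N \<Gamma>) (\<lambda>q. exp (- s q))
    (\<lambda>q. (- exp (- s q)) *\<^sub>R N q) (\<lambda>q. exp (- s q) * g q (N q) (N q) / 2)"
proof (standard; (rule g lc conformal_schouten_smooth[OF g lc s N grad])?)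
  note U = metric_fieldD(1)[OF g]
  show e: "smooth_on U (\<lambda>q. exp (- s q))"
    by (intro smooth_on_exp smooth_on_uminus U s)
  show e': "smooth_on U (\<lambda>q. (- exp (- s q)) *\<^sub>R N q)"
    by (intro smooth_on_scaleR smooth_on_uminus U e N)
  show "smooth_on U (\<lambda>q. exp (- s q) * g q (N q) (N q) / 2)"
    by (intro smooth_on_divide smooth_on_mult U e smooth_on_const smooth_bil_smooth[OF U metric_fieldD(2)[OF g] N N]) simp
  fix p x y assume p: "p \<in> U"
  note bil = metric_fieldD(3)[OF g p]
  show "Rm \<Gamma> p x y z = kn (g p) (conformal_schouten g s N \<Gamma> p) x y z" for z
    using conformal_Rm[OF g lc s N grad p, of x y z] flat[OF p] by simp
  show "g p (conformal_schouten g s N \<Gamma> p x) y = g p x (conformal_schouten g s N \<Gamma> p y)"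
    by (rule conformal_schouten_sym[OF g lc s N grad p])
  have d: "dd x (\<lambda>q. exp (- s q)) p = - exp (- s p) * dd x s p" for x
  proof -
    have "((\<lambda>q. exp (- s q)) has_derivative (\<lambda>v. - exp (- s p) * dd v s p)) (at p)"
      by (rule has_derivative_eq_rhs, rule has_derivative_exp, rule has_derivative_minus,
        rule smooth_on_has_dd[OF s p]) (simp add: fun_eq_iff)
    from dd_eq[OF this] show ?thesis .
  qed
  show "dd x (\<lambda>q. exp (- s q)) p = g p (- exp (- s p) *\<^sub>R N p) x"
    by (simp add: d grad[OF p] bilinear_simps[OF bil])
  show "g p (- exp (- s p) *\<^sub>R N p) (- exp (- s p) *\<^sub>R N p) = 2 * exp (- s p) * (exp (- s p) * g p (N p) (N p) / 2)"
    by (simp add: bilinear_simps[OF bil])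
  have "dd x (\<lambda>q. - exp (- s q)) p = exp (- s p) * dd x s p"
  proof -
    have "((\<lambda>q. - exp (- s q)) has_derivative (\<lambda>v. - dd v (\<lambda>q. exp (- s q)) p)) (at p)"
      by (intro has_derivative_minus smooth_on_has_dd[OF e p])
    from dd_eq[OF this, of x] show ?thesis unfolding d by simp
  qed
  then show "cd \<Gamma> x (\<lambda>q. - exp (- s q) *\<^sub>R N q) p
      = (exp (- s p) * g p (N p) (N p) / 2) *\<^sub>R x - exp (- s p) *\<^sub>R conformal_schouten g s N \<Gamma> p x"
    unfolding cd_scale[OF p levi_civitaD(1)[OF lc] smooth_on_uminus[OF U e] N] conformal_schouten_def
    by (simp add: algebra_simps)
qed simp_all

end

section \<open>The dual metric on an open set of the coordinate space\<close>

locale conformally_flat_dual = conformally_flat_data +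
  fixes T
  assumes T: "smooth_lin U T" and TS: "p \<in> U \<Longrightarrow> T p (S p x) = x" and ST: "p \<in> U \<Longrightarrow> S p (T p x) = x"
begin

text \<open>With \<open>A = g (S x) y\<close>, contracting two copies of \<open>A\<close> by the
  inverse metric gives this form.\<close>

definition g' where "g' p x y = g p (S p x) (S p y)"
text \<open>The connection conjugated by \<open>S\<close>: the one for which \<open>S\<close>
  becomes parallel as a map into the bundle carrying \<open>\<Gamma>\<close>.\<close>

definition \<Gamma>' where "\<Gamma>' p x y = T p (cd \<Gamma> x (\<lambda>q. S q y) p)"

lemma g'_T: "p \<in> U \<Longrightarrow> g' p (T p x) y = g p x (S p y)"
  by (simp add: g'_def ST)

lemma S_injective: "p \<in> U \<Longrightarrow> x \<noteq> 0 \<Longrightarrow> S p x \<noteq> 0"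
  using TS[of p x] linear_0[OF smooth_linD[OF T]] by fastforce

lemma metric_field_dual: "metric_field U g'"
  unfolding metric_field_def smooth_bil_def
proof (intro conjI ballI allI impI)
  show "open U" by (rule U)
  show "smooth_on U (\<lambda>p. g' p u w)" for u w
    unfolding g'_def by (rule smooth_bil_smooth[OF U metric_fieldD(2)[OF g] smooth_lin_on[OF S] smooth_lin_on[OF S]])
  fix p assume p: "p \<in> U"
  show "bilinear (g' p)"
    unfolding bilinear_def g'_def
    by (auto intro!: linearI simp: bilinear_simps[OF metric_fieldD(3)[OF g p]]
        linear_map_simps[OF smooth_linD[OF S p]])
  show "g' p x y = g' p y x" for x y unfolding g'_def by (rule metric_fieldD(4)[OF g p])
  show "0 < g' p x x" if "x \<noteq> 0" for x
    unfolding g'_def by (rule metric_fieldD(5)[OF g p S_injective[OF p that]])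
qed

lemma S_\<Gamma>': "p \<in> U \<Longrightarrow> S p (\<Gamma>' p x y) = dd x (\<lambda>q. S q y) p + \<Gamma> p x (S p y)"
  by (simp add: \<Gamma>'_def ST cd_def)

text \<open>Metricity is inherited, since \<open>S\<close> is isometric from \<open>g'\<close> to
  \<open>g\<close> and intertwines the connections. Vanishing torsion is exactly the Codazzi
  equation.\<close>

lemma levi_civita_dual: "levi_civita U g' \<Gamma>'"
  unfolding levi_civita_def smooth_bil_def
proof (intro conjI ballI allI)
  show "smooth_on U (\<lambda>p. \<Gamma>' p x y)" for x y
    unfolding \<Gamma>'_def by (rule smooth_lin_smooth[OF U T smooth_on_cd[OF U G smooth_lin_on[OF S]]])
  fix p assume p: "p \<in> U"
  note l = linear_dd[OF smooth_on_differentiable[OF smooth_lin_on[OF S] p]] dd_smooth_lin_linear[OF U p S]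
  show "bilinear (\<Gamma>' p)"
    unfolding bilinear_def \<Gamma>'_def cd_def
    by (auto intro!: linearI simp: linear_map_simps[OF smooth_linD[OF T p]] linear_map_simps[OF smooth_linD[OF S p]]
       linear_map_simps[OF l(1)] linear_map_simps[OF l(2)] bilinear_simps[OF levi_civitaD(2)[OF lc p]] algebra_simps)
  show "\<Gamma>' p x y = \<Gamma>' p y x" for x y by (simp add: \<Gamma>'_def codazzi[OF p])
  show "dd x (\<lambda>q. g' q y z) p = g' p (\<Gamma>' p x y) z + g' p y (\<Gamma>' p x z)" for x y z
    unfolding g'_def levi_civita_metric_dd[OF g lc p smooth_lin_on[OF S] smooth_lin_on[OF S]]
    by (simp add: \<Gamma>'_def ST[OF p])
qed

text \<open>Conjugating \<open>kn (g p) (S p)\<close> by \<open>S\<close> exchanges its two pairs of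
  terms: those with the factors \<open>x\<close>, \<open>y\<close> acquire \<open>T\<close>, and
  those with \<open>S x\<close>, \<open>S y\<close> lose \<open>S\<close>. The result is the same
  product for \<open>g'\<close> and \<open>T\<close>.\<close>

lemma Rm_dual:
  assumes p: "p \<in> U"
  shows "Rm \<Gamma>' p x y z = kn (g' p) (T p) x y z"
proof -
  have "S p (Rm \<Gamma>' p x y z) = Rm \<Gamma> p x y (S p z)"
    by (rule Rm_gauge[OF U p levi_civitaD(1)[OF levi_civita_dual] G S S_\<Gamma>'])
  then have "Rm \<Gamma>' p x y z = T p (Rm \<Gamma> p x y (S p z))" using TS[OF p] by metis
  also have "\<dots> = kn (g' p) (T p) x y z"
    unfolding curv[OF p] kn_def g'_T[OF p]
    by (simp add: linear_map_simps[OF smooth_linD[OF T p]] TS[OF p] g'_def)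
  finally show ?thesis .
qed

lemma cd_dual:
  assumes p: "p \<in> U" and Y: "smooth_on U Y"
  shows "cd \<Gamma>' x Y p = T p (cd \<Gamma> x (\<lambda>q. S q (Y q)) p)"
  unfolding cd_def smooth_lin_dd[OF U p S smooth_on_differentiable[OF Y p]] \<Gamma>'_def
  by (simp add: linear_map_simps[OF smooth_linD[OF T p]] TS[OF p])

text \<open>The data \<open>w\<close>, \<open>- T P\<close>, \<open>u\<close> play for
  \<open>g'\<close> and \<open>T\<close> the roles of \<open>u\<close>, \<open>P\<close>,
  \<open>w\<close>. Translated back to a factor \<open>exp (2 * s)\<close>, this means
  \<open>s = - ln w\<close> with gradient \<open>T P\<close> divided by \<open>w\<close>.\<close>

theorem dual_conformally_flat:
  assumes w_pos: "\<And>p. p \<in> U \<Longrightarrow> w p > 0"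
  obtains \<Gamma>c where "levi_civita U (\<lambda>q x y. exp (2 * - ln (w q)) * g' q x y) \<Gamma>c"
    "\<And>p x y z. p \<in> U \<Longrightarrow> Rm \<Gamma>c p x y z = 0"
proof
  define s where "s q = - ln (w q)" for q
  define N where "N q = inverse (w q) *\<^sub>R T q (P q)" for q
  have iw: "smooth_on U (\<lambda>q. inverse (w q))"
    by (intro smooth_on_inverse U w) (use w_pos in fastforce)
  have s: "smooth_on U s"
    unfolding s_def[abs_def] by (intro smooth_on_uminus smooth_on_ln U w w_pos)
  have N: "smooth_on U N"
    unfolding N_def[abs_def] by (rule smooth_on_scaleR[OF U iw smooth_lin_smooth[OF U T P]])
  have grad': "dd x s p = g' p (N p) x" if p: "p \<in> U" for p x
  proof -
    have "(s has_derivative (\<lambda>x. - (inverse (w p) * dd x w p))) (at p)"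
      unfolding s_def[abs_def]
      by (rule has_derivative_minus, rule has_derivative_eq_rhs, rule has_derivative_ln[where g = w and x = p, OF w_pos[OF p]],
        rule smooth_on_has_dd[OF w p]) (simp add: fun_eq_iff mult.commute)
    from dd_eq[OF this] show ?thesis
      unfolding dd_w[OF p] N_def
      by (simp add: bilinear_simps[OF metric_fieldD(3)[OF metric_field_dual p]] g'_T[OF p])
  qed
  show "levi_civita U (\<lambda>q x y. exp (2 * - ln (w q)) * g' q x y) (conformal_lc g' s N \<Gamma>')"
    using conformal_levi_civita[OF metric_field_dual levi_civita_dual s N grad'] by (simp add: s_def[abs_def])
  fix p x y z assume p: "p \<in> U"
  have wp: "w p \<noteq> 0" using w_pos[OF p] by simp
  \<comment> \<open>Enough for flatness: the correction term in \<open>conformal_Rm\<close> then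
    equals the curvature found in \<open>Rm_dual\<close>.\<close>
  have "conformal_schouten g' s N \<Gamma>' p x = T p x" for x
  proof -
    have di: "dd x (\<lambda>q. inverse (w q)) p = inverse (w p) * inverse (w p) * g p (P p) (S p x)"
    proof -
      have "((\<lambda>q. inverse (w q)) has_derivative (\<lambda>x. - (inverse (w p) * dd x w p * inverse (w p)))) (at p)"
        by (rule Deriv.has_derivative_inverse[OF wp smooth_on_has_dd[OF w p]])
      from dd_eq[OF this] show ?thesis unfolding dd_w[OF p] by simp
    qed
    have "cd \<Gamma> x (\<lambda>q. S q (N q)) p = cd \<Gamma> x (\<lambda>q. inverse (w q) *\<^sub>R P q) p"
      by (rule cd_cong_open[OF U p])
        (simp add: N_def linear_map_simps[OF smooth_linD[OF S]] ST)
    also have "\<dots> = (inverse (w p) * inverse (w p) * g p (P p) (S p x)) *\<^sub>R P p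
        + inverse (w p) *\<^sub>R (w p *\<^sub>R x - u p *\<^sub>R S p x)"
      unfolding cd_scale[OF p G iw P] di dP[OF p] ..
    finally have ce: "cd \<Gamma> x (\<lambda>q. S q (N q)) p = (inverse (w p) * inverse (w p) * g p (P p) (S p x)) *\<^sub>R P p
        + inverse (w p) *\<^sub>R (w p *\<^sub>R x - u p *\<^sub>R S p x)" .
    have c: "cd \<Gamma>' x N p = (inverse (w p) * inverse (w p) * g p (P p) (S p x)) *\<^sub>R T p (P p)
        + T p x - (inverse (w p) * u p) *\<^sub>R x"
      unfolding cd_dual[OF p N] ce
      using wp by (simp add: linear_map_simps[OF smooth_linD[OF T p]] TS[OF p] algebra_simps)
    \<comment> \<open>By \<open>norm_P\<close> the squared length is proportional to
      \<open>u p\<close>, which cancels the \<open>u\<close> term left over in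
      \<open>c\<close>.\<close>
    have n: "g' p (N p) (N p) = 2 * (inverse (w p) * u p)"
      using wp by (simp add: N_def bilinear_simps[OF metric_fieldD(3)[OF metric_field_dual p]] g'_T[OF p] ST[OF p] norm_P[OF p])
    have "dd x s p = inverse (w p) * g p (P p) (S p x)"
      unfolding grad'[OF p] by (simp add: N_def bilinear_simps[OF metric_fieldD(3)[OF metric_field_dual p]] g'_T[OF p])
    then show ?thesis
      unfolding conformal_schouten_def c n by (simp add: N_def algebra_simps)
  qed
  then have "conformal_schouten g' s N \<Gamma>' p = T p" by blast
  then show "Rm (conformal_lc g' s N \<Gamma>') p x y z = 0"
    using conformal_Rm[OF metric_field_dual levi_civita_dual s N grad' p, of x y z] Rm_dual[OF p] by simp
qed

end

lemma smooth_bil_subset: "smooth_bil S b \<Longrightarrow> T \<subseteq> S \<Longrightarrow> smooth_bil T b"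
  unfolding smooth_bil_def by (blast intro: smooth_on_subset)

lemma smooth_lin_subset: "smooth_lin S f \<Longrightarrow> T \<subseteq> S \<Longrightarrow> smooth_lin T f"
  unfolding smooth_lin_def by (blast intro: smooth_on_subset)

section \<open>Integrals depending on a parameter\<close>

lemma Ck_on_has_dd:
  "Ck_on (Suc k) S f \<Longrightarrow> x \<in> S \<Longrightarrow> (f has_derivative (\<lambda>v. dd v f x)) (at x)"
  by (intro differentiable_has_dd Ck_on_SucD(1))

lemma continuous_on_compose_Pair:
  assumes "continuous_on W h" "V \<times> T \<subseteq> W"
  shows "continuous_on (V \<times> T) (\<lambda>(x, t). h (x, t))" "x \<in> V \<Longrightarrow> continuous_on T (\<lambda>t. h (x, t))"
proof -
  show "continuous_on (V \<times> T) (\<lambda>(x, t). h (x, t))"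
    using continuous_on_subset[OF assms] by simp
  show "continuous_on T (\<lambda>t. h (x, t))" if "x \<in> V"
    by (rule continuous_on_compose2[OF assms(1)]) (use that assms(2) in \<open>auto intro!: continuous_intros\<close>)
qed

text \<open>The open \<open>W\<close> around the closed strip is needed because \<open>Ck_on\<close>
  asks for full derivatives in the product space; only the directions \<open>(v, 0)\<close> enter
  the result.\<close>

lemma has_derivative_param_integral:
  fixes h :: "'v::euclidean_space \<times> real \<Rightarrow> 'w::euclidean_space"
  assumes V: "open V" "convex V" and W: "open W" "V \<times> {0..1} \<subseteq> W"
    and h: "Ck_on (Suc 0) W h" and x: "x \<in> V"
  shows "((\<lambda>x. integral {0..1} (\<lambda>t. h (x, t))) has_derivative
    (\<lambda>v. integral {0..1} (\<lambda>t. dd (v, 0) h (x, t)))) (at x)"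
proof -
  \<comment> \<open>\<open>leibniz_rule\<close> expects the derivative as a continuous family of
    bounded linear maps.\<close>
  define D where "D x t = Blinfun (\<lambda>v. dd (v, 0) h (x, t))" for x t
  have hd: "((\<lambda>x. h (x, t)) has_derivative (\<lambda>v. dd (v, 0) h (x, t))) (at x)" if "x \<in> V" "t \<in> {0..1}" for x t
  proof -
    have "((\<lambda>x. (x, t)) has_derivative (\<lambda>v. (v, 0))) (at x)"
      by (auto intro!: derivative_eq_intros)
    moreover have "(x, t) \<in> W" using that W by blast
    ultimately show ?thesis using has_derivative_compose[OF _ Ck_on_has_dd[OF h]] by blast
  qed
  have D: "blinfun_apply (D x t) = (\<lambda>v. dd (v, 0) h (x, t))" if "x \<in> V" "t \<in> {0..1}" for x t
    unfolding D_def by (rule bounded_linear_Blinfun_apply[OF has_derivative_bounded_linear[OF hd[OF that]]])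
  have cont: "continuous_on W (dd v h)" for v
    using Ck_on_SucD(2)[OF h] by simp
  \<comment> \<open>Continuity in operator norm may be tested on basis vectors, where it is
    continuity of \<open>dd (j, 0) h\<close>.\<close>
  have contD: "continuous_on (V \<times> cbox 0 1) (\<lambda>(x, t). D x t)"
    unfolding continuous_on_def
  proof (intro ballI tendsto_componentwise1)
    fix z :: "'v \<times> real" and j :: 'v assume z: "z \<in> V \<times> cbox 0 1"
    have "((\<lambda>(x, t). dd (j, 0) h (x, t)) \<longlongrightarrow> (\<lambda>(x, t). dd (j, 0) h (x, t)) z) (at z within V \<times> cbox 0 1)"
      using continuous_on_compose_Pair(1)[OF cont W(2), of "(j, 0)"] z by (auto simp: continuous_on_def)
    then show "((\<lambda>z. blinfun_apply (case z of (x, t) \<Rightarrow> D x t) j) \<longlongrightarrow> blinfun_apply (case z of (x, t) \<Rightarrow> D x t) j)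
       (at z within V \<times> cbox 0 1)"
      by (rule Lim_transform_within[OF _ zero_less_one, THEN tendsto_eq_rhs]) (use z in \<open>auto simp: D split_beta\<close>)
  qed
  have int: "(\<lambda>t. h (y, t)) integrable_on cbox 0 1" if "y \<in> V" for y
  proof -
    have "continuous_on W h"
      using h has_derivative_continuous[OF Ck_on_has_dd[OF h]] by (simp add: continuous_at_imp_continuous_on)
    then show ?thesis
      using integrable_continuous_real[OF continuous_on_compose_Pair(2)[OF _ W(2) that]] by simp
  qed
  have "((\<lambda>x. integral (cbox 0 1) (\<lambda>t. h (x, t))) has_derivative blinfun_apply (integral (cbox 0 1) (D x))) (at x within V)"
    by (rule leibniz_rule[OF _ int contD x V(2)]) (use D hd in \<open>auto intro: has_derivative_at_withinI\<close>)
  moreover have eq: "blinfun_apply (integral (cbox 0 1) (D x)) v = integral {0..1} (\<lambda>t. dd (v, 0) h (x, t))" for v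
  proof -
    have "D x integrable_on cbox 0 1"
    proof -
      have "continuous_on {0..1} (\<lambda>t. (\<lambda>(x, t). D x t) (x, t))"
        by (rule continuous_on_compose2[OF contD]) (use x in \<open>auto intro!: continuous_intros\<close>)
      then show ?thesis using integrable_continuous_real by fastforce
    qed
    from integral_linear[OF this blinfun.bounded_linear_left, of v]
    have "blinfun_apply (integral (cbox 0 1) (D x)) v = integral {0..1} (\<lambda>t. blinfun_apply (D x t) v)"
      by (simp add: o_def)
    also have "\<dots> = integral {0..1} (\<lambda>t. dd (v, 0) h (x, t))"
      by (rule integral_cong) (simp add: D[OF x])
    finally show ?thesis .
  qed
  then have "blinfun_apply (integral (cbox 0 1) (D x)) = (\<lambda>v. integral {0..1} (\<lambda>t. dd (v, 0) h (x, t)))" by blast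
  ultimately show ?thesis using x V(1) by (simp add: at_within_open[OF x V(1)])
qed

lemma dd_param_integral:
  fixes h :: "'v::euclidean_space \<times> real \<Rightarrow> 'w::euclidean_space"
  assumes "open V" "convex V" "open W" "V \<times> {0..1} \<subseteq> W" "Ck_on (Suc 0) W h" "x \<in> V"
  shows "dd v (\<lambda>x. integral {0..1} (\<lambda>t. h (x, t))) x = integral {0..1} (\<lambda>t. dd (v, 0) h (x, t))"
  by (rule dd_eq[OF has_derivative_param_integral[OF assms]])

text \<open>A derivative of the integral is an integral of the same kind, with
  \<open>dd (v, 0) h\<close> as integrand; hence \<open>h\<close> is arbitrary in the
  induction.\<close>

lemma Ck_on_param_integral:
  fixes h :: "'v::euclidean_space \<times> real \<Rightarrow> 'w::euclidean_space"
  assumes V: "open V" "convex V" and W: "open W" "V \<times> {0..1} \<subseteq> W"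
    and h: "Ck_on k W h"
  shows "Ck_on k V (\<lambda>x. integral {0..1} (\<lambda>t. h (x, t)))"
  using h
proof (induction k arbitrary: h)
  case 0
  then show ?case
    using integral_continuous_on_param[of V 0 1 "\<lambda>x t. h (x, t)"] continuous_on_compose_Pair(1)[of W h V "{0..1}"] W(2)
    by simp
next
  case (Suc k)
  have h1: "Ck_on (Suc 0) W h" using Suc.prems
  proof (induction k)
    case (Suc k) then show ?case using Ck_on_Suc_imp by blast
  qed
  show ?case
  proof (rule Ck_on_SucI)
    show "(\<lambda>x. integral {0..1} (\<lambda>t. h (x, t))) differentiable at x" if "x \<in> V" for x
      using has_derivative_param_integral[OF V W h1 that] differentiableI by blast
    show "Ck_on k V (dd v (\<lambda>x. integral {0..1} (\<lambda>t. h (x, t))))" for v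
      by (rule Ck_on_transfer[OF Suc.IH V(1) dd_param_integral[OF V W h1]])
        (rule Ck_on_SucD(2)[OF Suc.prems])
  qed
qed

lemma smooth_on_param_integral:
  fixes h :: "'v::euclidean_space \<times> real \<Rightarrow> 'w::euclidean_space"
  assumes "open V" "convex V" "open W" "V \<times> {0..1} \<subseteq> W" "smooth_on W h"
  shows "smooth_on V (\<lambda>x. integral {0..1} (\<lambda>t. h (x, t)))"
  unfolding smooth_on_def
  by (intro allI Ck_on_param_integral[OF assms(1-4)]) (use assms(5) in \<open>simp add: smooth_on_def\<close>)

section \<open>Parallel sections of flat connections\<close>

lemma smooth_bil_bounded:
  assumes b: "smooth_bil U b" and K: "compact K" "K \<subseteq> U"
  obtains C where "C > 0" "\<And>p x y. p \<in> K \<Longrightarrow> norm (b p x y) \<le> C * norm x * norm y"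
proof -
  define M where "M p = (\<Sum>i\<in>Basis. \<Sum>j\<in>Basis. norm (b p i j))" for p
  have "continuous_on K M"
    unfolding M_def[abs_def]
    by (intro continuous_intros continuous_on_subset[OF smooth_on_continuous[OF smooth_bil_on[OF b]] K(2)])
  then have "bounded (M ` K)" by (intro compact_imp_bounded compact_continuous_image K)
  then obtain C where C: "C > 0" "\<And>p. p \<in> K \<Longrightarrow> norm (M p) \<le> C" by (auto simp: bounded_pos)
  have "norm (b p x y) \<le> C * norm x * norm y" if p: "p \<in> K" for p x y
  proof -
    have bil: "bilinear (b p)" using smooth_bilD[OF b] p K(2) by blast
    have "b p x y = (\<Sum>i\<in>Basis. (x \<bullet> i) *\<^sub>R b p i y)"
      by (rule linear_euclidean_sum[of "\<lambda>x. b p x y"]) (use bil in \<open>simp add: bilinear_def\<close>)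
    also have "\<dots> = (\<Sum>i\<in>Basis. (x \<bullet> i) *\<^sub>R (\<Sum>j\<in>Basis. (y \<bullet> j) *\<^sub>R b p i j))"
      by (intro sum.cong refl arg_cong2[where f = scaleR] linear_euclidean_sum) (use bil in \<open>simp add: bilinear_def\<close>)
    also have "norm \<dots> \<le> (\<Sum>i\<in>Basis. norm x * (\<Sum>j\<in>Basis. norm y * norm (b p i j)))"
    proof (rule order_trans[OF norm_sum sum_mono])
      fix i :: 'b assume i: "i \<in> Basis"
      have "norm (\<Sum>j\<in>Basis. (y \<bullet> j) *\<^sub>R b p i j) \<le> (\<Sum>j\<in>Basis. norm y * norm (b p i j))"
        by (rule order_trans[OF norm_sum sum_mono]) (auto intro!: mult_right_mono Basis_le_norm)
      then show "norm ((x \<bullet> i) *\<^sub>R (\<Sum>j\<in>Basis. (y \<bullet> j) *\<^sub>R b p i j)) \<le> norm x * (\<Sum>j\<in>Basis. norm y * norm (b p i j))"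
        using Basis_le_norm[OF i, of x] by (simp add: mult_mono)
    qed
    also have "\<dots> = norm x * norm y * M p"
      by (simp add: M_def sum_distrib_left mult_ac)
    also have "\<dots> \<le> norm x * norm y * C"
      using C(2)[OF p] by (intro mult_left_mono) auto
    finally show ?thesis by (simp add: mult_ac)
  qed
  with C(1) that show ?thesis by blast
qed

text \<open>The explicit rate depends on \<open>A\<close> only, so it is uniform in the point when
  the lemma is applied to functions.\<close>

lemma geometric_convergence:
  fixes f :: "nat \<Rightarrow> 'a::banach"
  assumes A: "\<And>k. norm (f (Suc k) - f k) \<le> A / 2 ^ k"
  obtains l where "f \<longlonglongrightarrow> l" "\<And>k. norm (f k - l) \<le> 2 * A / 2 ^ k"
proof -
  have A0: "A \<ge> 0" using order_trans[OF norm_ge_zero A[of 0]] by simp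
  \<comment> \<open>The subtracted tail makes the bound telescope, so that the induction on
    \<open>m\<close> closes.\<close>
  have step: "norm (f (k + m) - f k) \<le> 2 * A / 2 ^ k - 2 * A / 2 ^ (k + m)" for k m
  proof (induction m)
    case (Suc m)
    have "norm (f (k + Suc m) - f k) \<le> norm (f (Suc (k + m)) - f (k + m)) + norm (f (k + m) - f k)"
      using norm_triangle_ineq[of "f (Suc (k + m)) - f (k + m)" "f (k + m) - f k"] by simp
    also have "\<dots> \<le> A / 2 ^ (k + m) + (2 * A / 2 ^ k - 2 * A / 2 ^ (k + m))"
      using A[of "k + m"] Suc by (rule add_mono)
    also have "\<dots> = 2 * A / 2 ^ k - 2 * A / 2 ^ (k + Suc m)" by (simp add: field_simps)
    finally show ?case .
  qed simp
  have step': "norm (f n - f k) \<le> 2 * A / 2 ^ k" if "n \<ge> k" for n k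
  proof -
    have "0 \<le> 2 * A / 2 ^ n" using A0 by simp
    then show ?thesis using step[of k "n - k"] that by simp
  qed
  have lim0: "(\<lambda>k. 2 * A / 2 ^ k) \<longlonglongrightarrow> 0"
    using tendsto_mult_right_zero[OF LIMSEQ_inverse_realpow_zero[of 2], of "2 * A"]
    by (simp add: divide_inverse)
  have "Cauchy f"
  proof (rule metric_CauchyI)
    fix e :: real assume "e > 0"
    then have "\<forall>\<^sub>F k in sequentially. 2 * A / 2 ^ k < e / 2"
      by (intro order_tendstoD[OF lim0]) simp
    then obtain K where K: "2 * A / 2 ^ K < e / 2" by (auto simp: eventually_sequentially)
    have "dist (f m) (f n) < e" if "m \<ge> K" "n \<ge> K" for m n
    proof -
      have "dist (f m) (f K) < e / 2" "dist (f n) (f K) < e / 2"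
        using step'[OF that(1)] step'[OF that(2)] K by (auto simp: dist_norm)
      then show ?thesis by (rule dist_triangle_half_l)
    qed
    then show "\<exists>M. \<forall>m\<ge>M. \<forall>n\<ge>M. dist (f m) (f n) < e" by blast
  qed
  then obtain l where l: "f \<longlonglongrightarrow> l" using convergent_eq_Cauchy by blast
  have "norm (f k - l) \<le> 2 * A / 2 ^ k" for k
  proof (rule Lim_norm_ubound[where f = "\<lambda>n. f k - f n"])
    show "(\<lambda>n. f k - f n) \<longlonglongrightarrow> f k - l" by (intro tendsto_intros l)
    show "\<forall>\<^sub>F n in sequentially. norm (f k - f n) \<le> 2 * A / 2 ^ k"
      by (rule eventually_sequentiallyI[of k]) (metis step' norm_minus_commute)
  qed simp
  then show ?thesis using that l by blast
qed

text \<open>Picard iteration along the rays from \<open>p0\<close>. By flatness, the covariant derivatives of the iterates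
  satisfy a contracting recursion up to the differences of the iterates, so they tend to zero.\<close>

theorem linear_frobenius:
  fixes \<Gamma> :: "'v::euclidean_space \<Rightarrow> 'v \<Rightarrow> 'w::euclidean_space \<Rightarrow> 'w"
  assumes U: "open U" "p0 \<in> U" and \<Gamma>: "smooth_bil U \<Gamma>"
    and flat: "\<And>p x y z. p \<in> U \<Longrightarrow> Rm \<Gamma> p x y z = 0"
  obtains B F where "open B" "convex B" "p0 \<in> B" "B \<subseteq> U" "smooth_on B F" "F p0 = F0"
    "\<And>p x. p \<in> B \<Longrightarrow> cd \<Gamma> x F p = 0"
proof -
  obtain r0 where r0: "r0 > 0" "cball p0 r0 \<subseteq> U" using U open_contains_cball by blast
  obtain C where C: "C > 0" "\<And>p x y. p \<in> cball p0 r0 \<Longrightarrow> norm (\<Gamma> p x y) \<le> C * norm x * norm y"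
    using smooth_bil_bounded[OF \<Gamma> compact_cball r0(2)] by blast
  \<comment> \<open>With \<open>C * \<delta>\<close> at most 1/8, differences of iterates shrink by
    that factor in each step, and each of the two terms in the integrand of \<open>defect\<close> is
    at most an eighth of the previous bound.\<close>
  define \<delta> where "\<delta> = min r0 (1 / (8 * C))"
  have \<delta>: "\<delta> > 0" "\<delta> \<le> r0" "C * \<delta> \<le> 1 / 8"
  proof -
    show "\<delta> > 0" "\<delta> \<le> r0" using r0 C by (auto simp: \<delta>_def)
    have "C * \<delta> \<le> C * (1 / (8 * C))" using C(1) by (intro mult_left_mono) (auto simp: \<delta>_def)
    then show "C * \<delta> \<le> 1 / 8" using C(1) by simp
  qed
  define B where "B = ball p0 \<delta>"
  have B: "open B" "convex B" "p0 \<in> B" "B \<subseteq> U" "B \<subseteq> cball p0 r0"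
    using \<delta> r0 by (auto simp: B_def)
  note \<Gamma>B = smooth_bilD[OF \<Gamma> subsetD[OF B(4)]]
  have bnd: "norm (\<Gamma> p x y) \<le> C * norm x * norm y" if "p \<in> B" for p x y
    using C(2) that B(5) by blast
  have \<Gamma>_B: "smooth_bil B \<Gamma>"
    by (rule smooth_bil_subset[OF \<Gamma> B(4)])
  \<comment> \<open>The segment from \<open>p0\<close> to \<open>x\<close>, as a function of the
    pair, so that the results on parametric integrals apply.\<close>
  define c where "c z = p0 + snd z *\<^sub>R (fst z - p0)" for z :: "'v \<times> real"
  define W where "W = {z. fst z \<in> B \<and> c z \<in> B}"
  have "continuous_on UNIV c" unfolding c_def[abs_def] by (intro continuous_intros)
  then have "open (c -` B)" "open (fst -` B :: ('v \<times> real) set)"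
    using B(1) by (auto intro!: open_vimage continuous_intros)
  then have "open (fst -` B \<inter> c -` B)" by blast
  moreover have "W = fst -` B \<inter> c -` B" by (auto simp: W_def)
  ultimately have W: "open W" by simp
  have cB: "c (x, t) \<in> B" if "x \<in> B" "t \<in> {0..1}" for x t
  proof -
    have "c (x, t) = (1 - t) *\<^sub>R p0 + t *\<^sub>R x" by (simp add: c_def algebra_simps)
    then show ?thesis using convexD[OF B(2,3) that(1), of "1 - t" t] that(2) by simp
  qed
  have BW: "B \<times> {0..1} \<subseteq> W" using cB by (auto simp: W_def)
  have c_smooth: "smooth_on W c"
    unfolding c_def[abs_def]
    by (intro smooth_on_add smooth_on_scaleR smooth_on_diff W smooth_on_const
        smooth_on_bounded_linear bounded_linear_fst bounded_linear_snd)
  have cW: "c ` W \<subseteq> B" by (auto simp: W_def)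
  have \<xi>: "norm (x - p0) \<le> \<delta>" if "x \<in> B" for x
    using that by (simp add: B_def dist_norm norm_minus_commute)
  have dc1: "dd (v, 0) c (x, t) = t *\<^sub>R v" for v x t
    by (rule dd_eq[of c "\<lambda>z. snd z *\<^sub>R (x - p0) + t *\<^sub>R fst z", THEN trans])
      (auto simp: c_def[abs_def] intro!: derivative_eq_intros)
  have \<Gamma>c: "smooth_bil W (\<lambda>z. \<Gamma> (c z))"
    using \<Gamma>B cW smooth_on_compose[OF W B(1) cW c_smooth smooth_bil_on[OF \<Gamma>_B]] by (auto simp: smooth_bil_def)
  define h where "h F z = \<Gamma> (c z) (fst z - p0) (F (c z))" for F z
  \<comment> \<open>A parallel \<open>F\<close> with value \<open>F0\<close> at \<open>p0\<close> is
    a fixed point: this is its equation integrated along the segment.\<close>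
  define \<Phi> where "\<Phi> F x = F0 - integral {0..1} (\<lambda>t. h F (x, t))" for F x
  have Fc: "smooth_on W (\<lambda>z. F (c z))" if "smooth_on B F" for F :: "'v \<Rightarrow> 'w"
    by (rule smooth_on_compose[OF W B(1) cW c_smooth that])
  have h_smooth: "smooth_on W (h F)" if "smooth_on B F" for F
    unfolding h_def
    by (rule smooth_bil_smooth[OF W \<Gamma>c smooth_on_diff[OF W smooth_on_bounded_linear[OF bounded_linear_fst] smooth_on_const] Fc[OF that]])
  have \<Phi>_smooth: "smooth_on B (\<Phi> F)" if "smooth_on B F" for F
    unfolding \<Phi>_def
    by (intro smooth_on_diff B smooth_on_const smooth_on_param_integral[OF B(1,2) W BW] h_smooth that)
  define G where "G F v q = \<Gamma> q v (F q)" for F v q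
  have G_smooth: "smooth_on B (G F v)" if "smooth_on B F" for F v
    unfolding G_def by (rule smooth_bil_smooth[OF B(1) \<Gamma>_B smooth_on_const that])
  \<comment> \<open>\<open>v\<close> acts twice, through the direction of the segment and through
    its points; the latter move by \<open>t *\<^sub>R v\<close>.\<close>
  have dh: "dd (v, 0) (h F) (x, t) = G F v (c (x, t)) + t *\<^sub>R dd v (G F (x - p0)) (c (x, t))"
    if F: "smooth_on B F" and x: "x \<in> B" and t: "t \<in> {0..1}" for F v x t
  proof -
    have z: "(x, t) \<in> W" using x t BW by blast
    have cz: "c (x, t) \<in> B" by (rule cB[OF x t])
    note dGc = smooth_on_differentiable[OF G_smooth[OF F] cz]
    have e: "dd (v, 0) (\<lambda>z. fst z - p0) (x, t) = v"
      by (rule dd_eq[of _ fst, THEN trans]) (auto intro!: derivative_eq_intros)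
    have "dd (v, 0) (\<lambda>z. \<Gamma> (c z) (x - p0) (F (c z))) (x, t)
        = dd (v, 0) (\<lambda>z. \<Gamma> (c z) (x - p0) (F (c (x, t)))) (x, t) + \<Gamma> (c (x, t)) (x - p0) (dd (v, 0) (\<lambda>z. F (c z)) (x, t))"
      using smooth_bil_dd[OF W z \<Gamma>c smooth_on_const Fc[OF F], of "(v, 0)" "x - p0"]
        bilinear_lzero[OF smooth_bilD[OF \<Gamma>c z]] by simp
    then have "dd (v, 0) (h F) (x, t) = \<Gamma> (c (x, t)) v (F (c (x, t))) + dd (v, 0) (\<lambda>z. G F (x - p0) (c z)) (x, t)"
      unfolding h_def[abs_def]
      using smooth_bil_dd[OF W z \<Gamma>c smooth_on_diff[OF W smooth_on_bounded_linear[OF bounded_linear_fst]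
          smooth_on_const] Fc[OF F], of "(v, 0)" p0] e by (simp add: G_def)
    also have "dd (v, 0) (\<lambda>z. G F (x - p0) (c z)) (x, t) = dd (t *\<^sub>R v) (G F (x - p0)) (c (x, t))"
      using dd_compose[OF smooth_on_differentiable[OF c_smooth z] dGc, of "(v, 0)"] dc1 by simp
    also have "\<dots> = t *\<^sub>R dd v (G F (x - p0)) (c (x, t))" by (rule linear_scale[OF linear_dd[OF dGc]])
    finally show ?thesis by (simp add: G_def)
  qed
  \<comment> \<open>The integrand is the derivative of \<open>t *\<^sub>R G F v (c (x, t))\<close>,
    which vanishes at \<open>t = 0\<close>. This writes the boundary term \<open>G F v x\<close> as
    an integral comparable with that in \<open>dh\<close>.\<close>
  have ftc: "((\<lambda>t. G F v (c (x, t)) + t *\<^sub>R dd (x - p0) (G F v) (c (x, t))) has_integral G F v x) {0..1}"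
    if F: "smooth_on B F" and x: "x \<in> B" for F v x
  proof -
    have "((\<lambda>t. t *\<^sub>R G F v (c (x, t))) has_vector_derivative
       G F v (c (x, t)) + t *\<^sub>R dd (x - p0) (G F v) (c (x, t))) (at t within {0..1})" if t: "t \<in> {0..1}" for t
    proof -
      have "((\<lambda>t. c (x, t)) has_vector_derivative (x - p0)) (at t within {0..1})"
        by (auto simp: c_def intro!: derivative_eq_intros)
      from vector_derivative_diff_chain_within[OF this, of "G F v" "\<lambda>v'. dd v' (G F v) (c (x, t))"]
      have "((\<lambda>t. G F v (c (x, t))) has_vector_derivative dd (x - p0) (G F v) (c (x, t))) (at t within {0..1})"
        using has_derivative_at_withinI[OF smooth_on_has_dd[OF G_smooth[OF F] cB[OF x t]]] by (simp add: o_def)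
      then show ?thesis
        by (auto intro!: derivative_eq_intros)
    qed
    from fundamental_theorem_of_calculus[OF zero_le_one this] show ?thesis by (simp add: c_def)
  qed
  \<comment> \<open>Subtracting \<open>dh\<close> from \<open>ftc\<close> leaves the antisymmetrised
    derivative of \<open>\<Gamma>\<close> applied to \<open>F\<close>, which flatness turns into
    covariant derivatives of \<open>F\<close>. The last term corrects for the boundary value
    containing \<open>F\<close> instead of \<open>\<Phi> F\<close>.\<close>
  have defect: "cd \<Gamma> v (\<Phi> F) x = integral {0..1} (\<lambda>t. t *\<^sub>R (\<Gamma> (c (x, t)) v (cd \<Gamma> (x - p0) F (c (x, t)))
        - \<Gamma> (c (x, t)) (x - p0) (cd \<Gamma> v F (c (x, t))))) + \<Gamma> x v (\<Phi> F x - F x)"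
    if F: "smooth_on B F" and x: "x \<in> B" for F v x
  proof -
    have h1: "Ck_on (Suc 0) W (h F)" using h_smooth[OF F] by (simp add: smooth_on_def del: Ck_on.simps)
    have "dd v (\<Phi> F) x = - integral {0..1} (\<lambda>t. dd (v, 0) (h F) (x, t))"
      unfolding \<Phi>_def[abs_def]
      using dd_eq[OF has_derivative_diff[OF has_derivative_const
            has_derivative_param_integral[OF B(1,2) W BW h1 x]]] by simp
    also have "integral {0..1} (\<lambda>t. dd (v, 0) (h F) (x, t))
        = integral {0..1} (\<lambda>t. G F v (c (x, t)) + t *\<^sub>R dd v (G F (x - p0)) (c (x, t)))"
      by (rule integral_cong) (rule dh[OF F x])
    finally have d1: "dd v (\<Phi> F) x = - integral {0..1} (\<lambda>t. G F v (c (x, t)) + t *\<^sub>R dd v (G F (x - p0)) (c (x, t)))" .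
    have "continuous_on {0..1} (\<lambda>t. dd (v, 0) (h F) (x, t))"
      by (rule continuous_on_compose_Pair(2)[OF smooth_on_continuous[OF smooth_on_dd[OF h_smooth[OF F]]] BW x])
    then have "continuous_on {0..1} (\<lambda>t. G F v (c (x, t)) + t *\<^sub>R dd v (G F (x - p0)) (c (x, t)))"
      by (rule continuous_on_eq) (rule dh[OF F x])
    then have i1: "(\<lambda>t. G F v (c (x, t)) + t *\<^sub>R dd v (G F (x - p0)) (c (x, t))) integrable_on {0..1}"
      by (rule integrable_continuous_real)
    have "dd v (\<Phi> F) x + G F v x = integral {0..1} (\<lambda>t. (G F v (c (x, t)) + t *\<^sub>R dd (x - p0) (G F v) (c (x, t)))
        - (G F v (c (x, t)) + t *\<^sub>R dd v (G F (x - p0)) (c (x, t))))"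
      unfolding d1 using ftc[OF F x, of v] i1 by (subst integral_diff) (auto simp: has_integral_iff)
    also have "\<dots> = integral {0..1} (\<lambda>t. t *\<^sub>R (\<Gamma> (c (x, t)) v (cd \<Gamma> (x - p0) F (c (x, t)))
        - \<Gamma> (c (x, t)) (x - p0) (cd \<Gamma> v F (c (x, t)))))"
    proof (rule integral_cong)
      fix t :: real assume t: "t \<in> {0..1}"
      define q where "q = c (x, t)"
      have q: "q \<in> B" unfolding q_def by (rule cB[OF x t])
      have dG: "dd x (G F y) q = dd x (\<lambda>p. \<Gamma> p y (F q)) q + \<Gamma> q y (dd x F q)" for x y
        unfolding G_def
        using smooth_bil_dd[OF B(1) q \<Gamma>_B smooth_on_const F, of x y] bilinear_lzero[OF \<Gamma>B[OF q]] by simp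
      have "dd (x - p0) (G F v) q - dd v (G F (x - p0)) q
          = \<Gamma> q v (cd \<Gamma> (x - p0) F q) - \<Gamma> q (x - p0) (cd \<Gamma> v F q)"
        using flat[OF subsetD[OF B(4) q], of "x - p0" v "F q"] unfolding dG Rm_def cd_def bilinear_radd[OF \<Gamma>B[OF q]]
        by (simp add: algebra_simps)
      then show "G F v (c (x, t)) + t *\<^sub>R dd (x - p0) (G F v) (c (x, t))
        - (G F v (c (x, t)) + t *\<^sub>R dd v (G F (x - p0)) (c (x, t)))
        = t *\<^sub>R (\<Gamma> (c (x, t)) v (cd \<Gamma> (x - p0) F (c (x, t))) - \<Gamma> (c (x, t)) (x - p0) (cd \<Gamma> v F (c (x, t))))"
        unfolding q_def by (simp flip: scaleR_diff_right)
    qed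
    finally show ?thesis unfolding cd_def[of _ v "\<Phi> F"] G_def
      by (simp add: bilinear_rsub[OF \<Gamma>B[OF x]] algebra_simps)
  qed
  define Fs where "Fs k = (\<Phi> ^^ k) (\<lambda>_. F0)" for k
  have Fs_Suc: "Fs (Suc k) = \<Phi> (Fs k)" for k by (simp add: Fs_def)
  have Fs_smooth: "smooth_on B (Fs k)" for k
    by (induction k) (auto simp: Fs_Suc intro: \<Phi>_smooth, simp add: Fs_def)
  have hcont: "continuous_on {0..1} (\<lambda>t. h F (x, t))" if "smooth_on B F" "x \<in> B" for F x
    by (rule continuous_on_compose_Pair(2)[OF smooth_on_continuous[OF h_smooth[OF that(1)]] BW that(2)])
  define A where "A = norm F0"
  have h_bound: "norm (\<Gamma> (c (x, t)) (x - p0) y) \<le> norm y / 8" if "x \<in> B" "t \<in> {0..1}" for x t y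
  proof -
    have "norm (\<Gamma> (c (x, t)) (x - p0) y) \<le> C * norm (x - p0) * norm y" by (rule bnd[OF cB[OF that]])
    also have "\<dots> \<le> C * \<delta> * norm y" using \<xi>[OF that(1)] C(1) by (intro mult_right_mono mult_left_mono) auto
    also have "\<dots> \<le> (1 / 8) * norm y" using \<delta>(3) by (intro mult_right_mono) auto
    finally show ?thesis by simp
  qed
  have a: "x \<in> B \<Longrightarrow> norm (Fs (Suc k) x - Fs k x) \<le> A / 2 ^ k" for k x
  proof (induction k arbitrary: x)
    case 0
    have "norm (integral {0..1} (\<lambda>t. h (Fs 0) (x, t))) \<le> A * (1 - 0)"
    proof (rule integral_bound)
      fix t :: real assume t: "t \<in> {0..1}"
      show "norm (h (Fs 0) (x, t)) \<le> A"
        using order_trans[OF h_bound[OF 0 t, of F0], of "norm F0"] by (simp add: h_def Fs_def A_def)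
    qed (use hcont[OF Fs_smooth 0] in auto)
    then show ?case unfolding Fs_Suc \<Phi>_def by (simp add: Fs_def)
  next
    case (Suc k)
    have i: "(\<lambda>t. h (Fs j) (x, t)) integrable_on {0..1}" for j
      by (rule integrable_continuous_real[OF hcont[OF Fs_smooth Suc.prems]])
    have "Fs (Suc (Suc k)) x - Fs (Suc k) x = \<Phi> (Fs (Suc k)) x - \<Phi> (Fs k) x"
      by (simp only: Fs_Suc)
    also have "\<dots> = integral {0..1} (\<lambda>t. h (Fs k) (x, t) - h (Fs (Suc k)) (x, t))"
      by (simp add: \<Phi>_def integral_diff[OF i i])
    also have "norm \<dots> \<le> A / 2 ^ Suc k * (1 - 0)"
    proof (rule integral_bound)
      fix t :: real assume t: "t \<in> {0..1}"
      have "h (Fs k) (x, t) - h (Fs (Suc k)) (x, t) = \<Gamma> (c (x, t)) (x - p0) (Fs k (c (x, t)) - Fs (Suc k) (c (x, t)))"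
        by (simp add: h_def bilinear_rsub[OF \<Gamma>B[OF cB[OF Suc.prems t]]])
      also have "norm \<dots> \<le> norm (Fs k (c (x, t)) - Fs (Suc k) (c (x, t))) / 8"
        by (rule h_bound[OF Suc.prems t])
      also have "\<dots> \<le> A / 2 ^ k / 8"
        using Suc.IH[OF cB[OF Suc.prems t]] by (simp add: norm_minus_commute)
      also have "\<dots> \<le> A / 2 ^ Suc k" by (simp add: A_def field_simps)
      finally show "norm (h (Fs k) (x, t) - h (Fs (Suc k)) (x, t)) \<le> A / 2 ^ Suc k" .
    qed (auto intro!: continuous_intros hcont Fs_smooth Suc.prems)
    finally show ?case by simp
  qed
  \<comment> \<open>The first summand bounds the contribution of the difference of iterates by a
    quarter of \<open>M / 2 ^ k\<close>, as much as the integral contributes; together they give the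
    factor 1/2. The second starts the induction at the constant iterate.\<close>
  define M where "M = 4 * C * A + C * norm F0"
  have M: "M \<ge> 0" "C * A \<le> M / 4" using C(1) by (auto simp: M_def A_def)
  have e: "x \<in> B \<Longrightarrow> norm (cd \<Gamma> v (Fs k) x) \<le> M / 2 ^ k * norm v" for k x v
  proof (induction k arbitrary: x v)
    case 0
    have "norm (cd \<Gamma> v (Fs 0) x) \<le> C * norm v * norm F0" using bnd[OF 0, of v F0] by (simp add: Fs_def cd_def)
    also have "\<dots> \<le> M * norm v" using C(1) by (simp add: M_def A_def algebra_simps)
    finally show ?case by simp
  next
    case (Suc k)
    define e where "e = M / 2 ^ k"
    have e0: "e \<ge> 0" using M(1) by (simp add: e_def)
    let ?D = "\<lambda>t. t *\<^sub>R (\<Gamma> (c (x, t)) v (cd \<Gamma> (x - p0) (Fs k) (c (x, t))) - \<Gamma> (c (x, t)) (x - p0) (cd \<Gamma> v (Fs k) (c (x, t))))"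
    have "norm (integral {0..1} ?D) \<le> (e / 4 * norm v) * (1 - 0)"
    proof (rule integral_bound)
      have cc: "continuous_on {0..1} (\<lambda>t. f (c (x, t)))" if "smooth_on B f" for f :: "'v \<Rightarrow> 'w"
        by (rule continuous_on_compose_Pair(2)[OF smooth_on_continuous[OF Fc[OF that]] BW Suc.prems])
      show "continuous_on {0..1} ?D"
        by (intro continuous_intros cc smooth_bil_smooth[OF B(1) \<Gamma>_B smooth_on_const] smooth_on_cd[OF B(1) \<Gamma>_B] Fs_smooth)
    next
      fix t :: real assume t: "t \<in> {0..1}"
      note q = cB[OF Suc.prems t]
      have n1: "norm (\<Gamma> (c (x, t)) v (cd \<Gamma> (x - p0) (Fs k) (c (x, t)))) \<le> e / 8 * norm v"
      proof -
        have "norm (\<Gamma> (c (x, t)) v (cd \<Gamma> (x - p0) (Fs k) (c (x, t)))) \<le> C * norm v * (e * norm (x - p0))"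
          using C(1) by (intro order_trans[OF bnd[OF q]] mult_left_mono Suc.IH[OF q, folded e_def]) auto
        also have "\<dots> \<le> C * norm v * (e * \<delta>)"
          using C(1) e0 \<xi>[OF Suc.prems] by (intro mult_left_mono) auto
        also have "\<dots> = (C * \<delta>) * (e * norm v)" by (simp add: mult_ac)
        also have "\<dots> \<le> (1 / 8) * (e * norm v)" using \<delta>(3) e0 by (intro mult_right_mono) auto
        finally show ?thesis by simp
      qed
      have n2: "norm (\<Gamma> (c (x, t)) (x - p0) (cd \<Gamma> v (Fs k) (c (x, t)))) \<le> e / 8 * norm v"
        using order_trans[OF h_bound[OF Suc.prems t] divide_right_mono[OF Suc.IH[OF q, folded e_def]]] by simp
      have "norm (?D t) \<le> 1 * (e / 8 * norm v + e / 8 * norm v)"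
        unfolding norm_scaleR using t n1 n2
        by (intro mult_mono order_trans[OF norm_triangle_ineq4 add_mono]) auto
      then show "norm (?D t) \<le> e / 4 * norm v" by simp
    qed simp
    moreover have "norm (\<Gamma> x v (\<Phi> (Fs k) x - Fs k x)) \<le> e / 4 * norm v"
    proof -
      have "norm (\<Gamma> x v (\<Phi> (Fs k) x - Fs k x)) \<le> C * norm v * (A / 2 ^ k)"
        using C(1) a[OF Suc.prems, of k] unfolding Fs_Suc
        by (intro order_trans[OF bnd[OF Suc.prems]] mult_left_mono) auto
      also have "\<dots> = (C * A) * (norm v / 2 ^ k)" by simp
      also have "\<dots> \<le> (M / 4) * (norm v / 2 ^ k)" using M(2) by (intro mult_right_mono) auto
      finally show ?thesis by (simp add: e_def)
    qed
    ultimately have "norm (cd \<Gamma> v (Fs (Suc k)) x) \<le> e / 4 * norm v + e / 4 * norm v"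
      unfolding Fs_Suc defect[OF Fs_smooth Suc.prems]
      by (intro order_trans[OF norm_triangle_ineq add_mono]) auto
    then show ?case by (simp add: e_def)
  qed
  have "\<exists>l. (\<lambda>k. Fs k x) \<longlonglongrightarrow> l \<and> (\<forall>k. norm (Fs k x - l) \<le> 2 * A / 2 ^ k)" if "x \<in> B" for x
    using geometric_convergence[of "\<lambda>k. Fs k x", OF a[OF that]] by metis
  then obtain F where F: "\<And>x. x \<in> B \<Longrightarrow> (\<lambda>k. Fs k x) \<longlonglongrightarrow> F x"
    "\<And>x k. x \<in> B \<Longrightarrow> norm (Fs k x - F x) \<le> 2 * A / 2 ^ k" by metis
  \<comment> \<open>The covariant derivatives of the iterates tend to zero uniformly on
    \<open>B\<close>, so their ordinary derivatives converge uniformly to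
    \<open>- \<Gamma> x v (F x)\<close> and the limit may be differentiated.\<close>
  have "\<exists>g. \<forall>x\<in>B. (\<lambda>k. Fs k x) \<longlonglongrightarrow> g x \<and> (g has_derivative (\<lambda>v. - \<Gamma> x v (F x))) (at x within B)"
  proof (rule has_derivative_sequence[where f = Fs and ?x0.0 = p0 and l = "F p0" and f' = "\<lambda>n x v. dd v (Fs n) x"])
    show "convex B" "p0 \<in> B" "(\<lambda>n. Fs n p0) \<longlonglongrightarrow> F p0" by (rule B F(1)[OF B(3)])+
    show "(Fs n has_derivative (\<lambda>v. dd v (Fs n) x)) (at x within B)" if "x \<in> B" for n x
      by (rule has_derivative_at_withinI[OF smooth_on_has_dd[OF Fs_smooth that]])
    fix \<epsilon> :: real assume "\<epsilon> > 0"
    have "(\<lambda>k. (M + 2 * C * A) / 2 ^ k) \<longlonglongrightarrow> 0"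
      using tendsto_mult_right_zero[OF LIMSEQ_inverse_realpow_zero[of 2], of "M + 2 * C * A"]
      by (simp add: divide_inverse)
    then have "\<forall>\<^sub>F k in sequentially. (M + 2 * C * A) / 2 ^ k < \<epsilon>"
      using \<open>\<epsilon> > 0\<close> by (rule order_tendstoD)
    then show "\<forall>\<^sub>F n in sequentially. \<forall>x\<in>B. \<forall>v. norm (dd v (Fs n) x - - \<Gamma> x v (F x)) \<le> \<epsilon> * norm v"
    proof (eventually_elim, intro ballI allI)
      fix k x v assume k: "(M + 2 * C * A) / 2 ^ k < \<epsilon>" and x: "x \<in> B"
      have "dd v (Fs k) x - - \<Gamma> x v (F x) = cd \<Gamma> v (Fs k) x - \<Gamma> x v (Fs k x - F x)"
        by (simp add: cd_def bilinear_rsub[OF \<Gamma>B[OF x]])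
      also have "norm \<dots> \<le> M / 2 ^ k * norm v + C * norm v * (2 * A / 2 ^ k)"
        using C(1) by (intro order_trans[OF norm_triangle_ineq4 add_mono] e[OF x]
            order_trans[OF bnd[OF x]] mult_left_mono F(2)[OF x]) auto
      also have "\<dots> = (M + 2 * C * A) / 2 ^ k * norm v" by (simp add: field_simps)
      also have "\<dots> \<le> \<epsilon> * norm v" using k by (intro mult_right_mono) auto
      finally show "norm (dd v (Fs k) x - - \<Gamma> x v (F x)) \<le> \<epsilon> * norm v" .
    qed
  qed
  then obtain g where g: "\<And>x. x \<in> B \<Longrightarrow> (\<lambda>k. Fs k x) \<longlonglongrightarrow> g x"
    "\<And>x. x \<in> B \<Longrightarrow> (g has_derivative (\<lambda>v. - \<Gamma> x v (F x))) (at x within B)" by blast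
  have gF: "g x = F x" if "x \<in> B" for x using LIMSEQ_unique[OF g(1) F(1)] that by blast
  have dF: "(F has_derivative (\<lambda>v. - \<Gamma> x v (F x))) (at x)" if x: "x \<in> B" for x
    by (rule has_derivative_transfer_open[OF _ B(1) x gF[symmetric]])
      (use g(2)[OF x] in \<open>simp_all add: at_within_open[OF x B(1)]\<close>)
  \<comment> \<open>The derivative is a smooth linear expression in \<open>F\<close> itself, so
    regularity improves by one order at a time.\<close>
  have "Ck_on k B F" for k
  proof (induction k)
    case 0
    then show ?case using dF by (auto intro!: continuous_at_imp_continuous_on has_derivative_continuous)
  next
    case (Suc k)
    have "Ck_on k B (\<lambda>x. \<Sum>b\<in>Basis. (F x \<bullet> b) *\<^sub>R - \<Gamma> x v b)" for v
    proof (intro Ck_on_sum[OF B(1)] Ck_on_bilinear[OF B(1) bounded_bilinear_scaleR]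
        Ck_on_bilinear[OF B(1) bounded_bilinear_inner Suc Ck_on_const])
      show "Ck_on k B (\<lambda>x. - \<Gamma> x v b)" for b
        using smooth_on_uminus[OF B(1) smooth_bil_on[OF \<Gamma>_B]] by (simp add: smooth_on_def)
    qed
    then have "Ck_on k B (dd v F)" for v
    proof (rule Ck_on_transfer[OF _ B(1)])
      fix x assume x: "x \<in> B"
      show "dd v F x = (\<Sum>b\<in>Basis. (F x \<bullet> b) *\<^sub>R - \<Gamma> x v b)"
        unfolding dd_eq[OF dF[OF x]]
        using linear_euclidean_sum[OF smooth_linD[OF smooth_bil_right[OF \<Gamma>_B] x], of v "F x"]
        by (simp add: sum_negf)
    qed
    then show ?case by (rule Ck_on_SucI[rotated]) (use dF differentiableI in blast)
  qed
  then have "smooth_on B F" by (simp add: smooth_on_def)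
  moreover have "Fs k p0 = F0" for k
  proof (cases k)
    case (Suc j)
    have h0: "h (Fs j) (p0, t) = 0" for t
      by (simp add: h_def c_def bilinear_lzero[OF \<Gamma>B[OF B(3)]])
    show ?thesis by (simp add: Suc Fs_Suc \<Phi>_def h0)
  qed (simp add: Fs_def)
  then have "F p0 = F0" using LIMSEQ_unique[OF F(1)[OF B(3)]] by simp
  moreover have "cd \<Gamma> v F x = 0" if "x \<in> B" for x v
    by (simp add: cd_def dd_eq[OF dF[OF that]])
  ultimately show ?thesis using that B by blast
qed

section \<open>Coordinate expressions\<close>

definition mform :: "real ^ 'n ^ 'n \<Rightarrow> real ^ 'n \<Rightarrow> real ^ 'n \<Rightarrow> real" where
  "mform M x y = x \<bullet> (M *v y)"

lemma mform_axis: "mform M (axis i 1) (axis j 1) = M $ i $ j"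
  by (simp add: mform_def inner_axis' matrix_vector_mult_basis column_def)

lemma bilinear_mform: "bilinear (mform M)"
  unfolding bilinear_def mform_def
  by (auto intro!: linearI simp: inner_simps matrix_vector_right_distrib matrix_vector_mult_scaleR)

lemma mform_sum: "mform M x y = (\<Sum>i\<in>UNIV. \<Sum>j\<in>UNIV. M $ i $ j * x $ i * y $ j)"
  by (simp add: mform_def inner_vec_def matrix_vector_mult_def sum_distrib_left mult_ac)

lemma linear_sum_axis:
  fixes T :: "real ^ 'n \<Rightarrow> 'c::real_vector"
  assumes "linear T"
  shows "T x = (\<Sum>i\<in>UNIV. x $ i *\<^sub>R T (axis i 1))"
proof -
  have "T x = T (\<Sum>i\<in>UNIV. x $ i *\<^sub>R axis i 1)"
    using basis_expansion[of x] by (simp add: scalar_mult_eq_scaleR)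
  also have "\<dots> = (\<Sum>i\<in>UNIV. x $ i *\<^sub>R T (axis i 1))"
    by (simp add: linear_sum[OF assms] linear_scale[OF assms])
  finally show ?thesis .
qed

lemma bilinear_mform_eq:
  assumes "bilinear h"
  shows "h x y = mform (\<chi> i j. h (axis i 1) (axis j 1)) x y"
proof -
  have l: "linear (\<lambda>x. h x y)" "linear (h x)" for x y
    using assms by (auto simp: bilinear_def)
  have "h x y = (\<Sum>i\<in>UNIV. x $ i *\<^sub>R h (axis i 1) y)"
    by (rule linear_sum_axis[OF l(1)])
  also have "\<dots> = (\<Sum>i\<in>UNIV. x $ i *\<^sub>R (\<Sum>j\<in>UNIV. y $ j *\<^sub>R h (axis i 1) (axis j 1)))"
    by (subst linear_sum_axis[OF l(2)]) rule
  finally have "h x y = (\<Sum>i\<in>UNIV. x $ i *\<^sub>R (\<Sum>j\<in>UNIV. y $ j *\<^sub>R h (axis i 1) (axis j 1)))" .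
  then show ?thesis by (simp add: mform_sum sum_distrib_left mult_ac)
qed

lemma smooth_bil_mform:
  assumes "open U" "smooth_on U G"
  shows "smooth_bil U (\<lambda>p. mform (G p))"
  unfolding smooth_bil_def
  by (auto simp: bilinear_mform mform_def
      intro!: smooth_on_inner smooth_on_matrix_vector_mult assms smooth_on_const)

lemma mform_pos_det:
  assumes "\<And>x. x \<noteq> 0 \<Longrightarrow> mform M x x > 0"
  shows "det M \<noteq> 0"
proof -
  have "inj ((*v) M)"
  proof (rule linear_injective_0[THEN iffD2, OF matrix_vector_mul_linear], intro allI impI)
    fix x assume "M *v x = 0"
    then have "mform M x x = 0" by (simp add: mform_def)
    then show "x = 0" using assms[of x] by fastforce
  qed
  then show ?thesis using det_nz_iff_inj[OF matrix_vector_mul_linear, of M] by simp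
qed

text \<open>Raising the index of the covector \<open>b\<close>. Both gradients and Christoffel
  symbols are instances.\<close>

lemma mform_matrix_inv:
  fixes h :: "real ^ 'n \<Rightarrow> real ^ 'n \<Rightarrow> real"
  assumes h: "bilinear h" "\<And>x y. h x y = h y x" "\<And>x. x \<noteq> 0 \<Longrightarrow> h x x > 0" and b: "linear b"
  shows "h (matrix_inv (\<chi> i j. h (axis i 1) (axis j 1)) *v (\<chi> l. b (axis l 1))) z = b z"
proof -
  define M where "M = (\<chi> i j. h (axis i 1) (axis j 1))"
  have M: "h x y = mform M x y" for x y unfolding M_def by (rule bilinear_mform_eq[OF h(1)])
  then have "det M \<noteq> 0" using mform_pos_det h(3) by metis
  then have "h z (matrix_inv M *v (\<chi> l. b (axis l 1))) = z \<bullet> (\<chi> l. b (axis l 1))"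
    unfolding M by (simp add: mform_def matrix_inv_vec)
  also have "\<dots> = b z"
    using linear_sum_axis[OF b, of z] by (simp add: inner_vec_def)
  finally show ?thesis unfolding M_def h(2)[of z] .
qed

lemma smooth_sharp:
  fixes g :: "real ^ 'n \<Rightarrow> real ^ 'n \<Rightarrow> real ^ 'n \<Rightarrow> real"
  assumes g: "metric_field U g" and b: "smooth_on U (\<lambda>p. (\<chi> l. b p (axis l 1)) :: real ^ 'n)"
  shows "smooth_on U (\<lambda>p. matrix_inv (\<chi> i j. g p (axis i 1) (axis j 1)) *v (\<chi> l. b p (axis l 1)))"
proof -
  note U = metric_fieldD(1)[OF g]
  have M: "smooth_on U (\<lambda>p. (\<chi> i j. g p (axis i 1) (axis j 1)) :: real ^ 'n ^ 'n)"
    by (intro smooth_on_vec_lambda U smooth_bil_on[OF metric_fieldD(2)[OF g]])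
  have "det (\<chi> i j. g p (axis i 1) (axis j 1)) \<noteq> 0" if p: "p \<in> U" for p
    by (rule mform_pos_det, subst bilinear_mform_eq[OF metric_fieldD(3)[OF g p], symmetric])
      (rule metric_fieldD(5)[OF g p])
  then show ?thesis
    by (intro smooth_on_matrix_vector_mult smooth_on_matrix_inv U M b)
qed

lemma gradient_exists:
  fixes g :: "real ^ 'n \<Rightarrow> real ^ 'n \<Rightarrow> real ^ 'n \<Rightarrow> real"
  assumes g: "metric_field U g" and s: "smooth_on U s"
  obtains N where "smooth_on U N" "\<And>p x. p \<in> U \<Longrightarrow> dd x s p = g p (N p) x"
proof
  show "smooth_on U (\<lambda>p. matrix_inv (\<chi> i j. g p (axis i 1) (axis j 1)) *v (\<chi> l. dd (axis l 1) s p))"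
    by (rule smooth_sharp[OF g]) (intro smooth_on_vec_lambda metric_fieldD(1)[OF g] smooth_on_dd s)
  show "dd x s p = g p (matrix_inv (\<chi> i j. g p (axis i 1) (axis j 1)) *v (\<chi> l. dd (axis l 1) s p)) x"
    if p: "p \<in> U" for p x
    by (rule mform_matrix_inv[symmetric])
      (use metric_fieldD[OF g] p linear_dd[OF smooth_on_differentiable[OF s p]] in auto)
qed

lemma smooth_lin_inverse:
  fixes S :: "real ^ 'n \<Rightarrow> real ^ 'n \<Rightarrow> real ^ 'n"
  assumes U: "open U" and S: "smooth_lin U S" and inj: "\<And>p. p \<in> U \<Longrightarrow> inj (S p)"
  obtains T where "smooth_lin U T" "\<And>p x. p \<in> U \<Longrightarrow> T p (S p x) = x" "\<And>p x. p \<in> U \<Longrightarrow> S p (T p x) = x"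
proof
  have M: "smooth_on U (\<lambda>p. matrix (S p))"
    unfolding matrix_def
    by (intro smooth_on_vec_lambda U smooth_on_vec_iff[OF U, THEN iffD1, rule_format] smooth_lin_on[OF S])
  have mv: "matrix (S p) *v x = S p x" if "p \<in> U" for p x
    using linear_sum_axis[OF smooth_linD[OF S that], of x]
    by (simp add: matrix_def matrix_vector_mult_def vec_eq_iff mult.commute)
  have det: "det (matrix (S p)) \<noteq> 0" if "p \<in> U" for p
    using det_nz_iff_inj[OF smooth_linD[OF S that]] inj[OF that] by simp
  show "smooth_lin U (\<lambda>p x. matrix_inv (matrix (S p)) *v x)"
    unfolding smooth_lin_def
    by (intro conjI ballI allI matrix_vector_mul_linear smooth_on_matrix_vector_mult U smooth_on_matrix_inv M det smooth_on_const)
  show "matrix_inv (matrix (S p)) *v S p x = x" "S p (matrix_inv (matrix (S p)) *v x) = x" if "p \<in> U" for p x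
    using matrix_inv_vec[OF det[OF that], of x] mv[OF that] by simp_all
qed

section \<open>Christoffel symbols as a Levi-Civita connection\<close>

text \<open>The Christoffel symbols extended bilinearly: Koszul's formula for constant vector fields
  \<open>x\<close> and \<open>y\<close>, followed by raising the index.\<close>

definition lc_matrix :: "(real ^ 'n \<Rightarrow> real ^ 'n ^ 'n) \<Rightarrow> real ^ 'n \<Rightarrow> real ^ 'n \<Rightarrow> real ^ 'n \<Rightarrow> real ^ 'n" where
  "lc_matrix G p x y = matrix_inv (G p) *v (\<chi> l. (dd x (\<lambda>q. mform (G q) y (axis l 1)) p
     + dd y (\<lambda>q. mform (G q) x (axis l 1)) p - dd (axis l 1) (\<lambda>q. mform (G q) x y) p) / 2)"

lemma christoffel_lc_matrix: "christoffel G k i j p = lc_matrix G p (axis i 1) (axis j 1) $ k"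
  by (simp add: christoffel_def lc_matrix_def mform_axis partial_def dd_def matrix_vector_mult_def
      sum_distrib_left mult_ac)

context
  fixes U and G :: "real ^ 'n \<Rightarrow> real ^ 'n ^ 'n"
  assumes g: "metric_field U (\<lambda>p. mform (G p))"
begin

lemma lc_matrix_koszul:
  assumes p: "p \<in> U"
  shows "mform (G p) (lc_matrix G p x y) z = (dd x (\<lambda>q. mform (G q) y z) p
     + dd y (\<lambda>q. mform (G q) x z) p - dd z (\<lambda>q. mform (G q) x y) p) / 2"
proof -
  note U = metric_fieldD(1)[OF g]
  define b where "b z = (dd x (\<lambda>q. mform (G q) y z) p
     + dd y (\<lambda>q. mform (G q) x z) p - dd z (\<lambda>q. mform (G q) x y) p) / 2" for z
  note l = dd_smooth_lin_linear[OF U p smooth_bil_right[OF metric_fieldD(2)[OF g]]]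
    linear_dd[OF smooth_on_differentiable[OF smooth_bil_on[OF metric_fieldD(2)[OF g]] p]]
  have "linear b"
    unfolding b_def by (rule linearI) (simp_all add: linear_add[OF l(1)] linear_add[OF l(2)]
      linear_scale[OF l(1)] linear_scale[OF l(2)] field_simps)
  have M: "(\<chi> i j. mform (G p) (axis i 1) (axis j 1)) = G p"
    by (simp add: mform_axis vec_eq_iff)
  show ?thesis
    using mform_matrix_inv[of "mform (G p)" b z, OF metric_fieldD(3)[OF g p] metric_fieldD(4)[OF g p]
        metric_fieldD(5)[OF g p] \<open>linear b\<close>]
    unfolding M by (simp add: lc_matrix_def b_def)
qed

lemma lc_matrix_levi_civita: "levi_civita U (\<lambda>p. mform (G p)) (lc_matrix G)"
  unfolding levi_civita_def smooth_bil_def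
proof (intro conjI ballI allI)
  note U = metric_fieldD(1)[OF g]
  show "smooth_on U (\<lambda>p. lc_matrix G p x y)" for x y
  proof -
    have M: "(\<chi> i j. mform (G p) (axis i 1) (axis j 1)) = G p" for p
      by (simp add: mform_axis vec_eq_iff)
    show ?thesis
      using smooth_sharp[OF g, of "\<lambda>p z. (dd x (\<lambda>q. mform (G q) y z) p
         + dd y (\<lambda>q. mform (G q) x z) p - dd z (\<lambda>q. mform (G q) x y) p) / 2"]
      unfolding M lc_matrix_def
      by (simp add: smooth_on_vec_lambda smooth_on_divide smooth_on_diff smooth_on_add smooth_on_dd U
          smooth_bil_on[OF metric_fieldD(2)[OF g]])
  qed
  fix p assume p: "p \<in> U"
  note bil = metric_fieldD(3)[OF g p]
  note l = dd_smooth_lin_linear[OF U p smooth_bil_right[OF metric_fieldD(2)[OF g]]]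
    dd_smooth_lin_linear[OF U p smooth_bil_left[OF metric_fieldD(2)[OF g]]]
    linear_dd[OF smooth_on_differentiable[OF smooth_bil_on[OF metric_fieldD(2)[OF g]] p]]
  show "bilinear (lc_matrix G p)"
    unfolding bilinear_def
    by (auto intro!: linearI metric_field_nondeg[OF g p]
      simp: lc_matrix_koszul[OF p] bilinear_simps[OF bil] l[THEN linear_add] l[THEN linear_scale] field_simps)
  have sym: "dd u (\<lambda>q. mform (G q) x y) p = dd u (\<lambda>q. mform (G q) y x) p" for u x y
    by (rule dd_cong_open[OF U p]) (rule metric_fieldD(4)[OF g])
  show "lc_matrix G p x y = lc_matrix G p y x" for x y
    by (rule metric_field_nondeg[OF g p]) (simp add: lc_matrix_koszul[OF p] sym[of _ x y])
  show "dd x (\<lambda>q. mform (G q) y z) p = mform (G p) (lc_matrix G p x y) z + mform (G p) y (lc_matrix G p x z)" for x y z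
    unfolding metric_fieldD(4)[OF g p, of y] lc_matrix_koszul[OF p]
    using sym[of x y z] sym[of y z x] sym[of z x y] by (simp add: field_simps)
qed

lemma riemann_comp_Rm:
  assumes p: "p \<in> U"
  shows "riemann_comp G l i j k p = Rm (lc_matrix G) p (axis i 1) (axis j 1) (axis k 1) $ l"
proof -
  note lc = lc_matrix_levi_civita
  have d: "partial i (christoffel G l j k) p = dd (axis i 1) (\<lambda>q. lc_matrix G q (axis j 1) (axis k 1)) p $ l" for i j k
    unfolding partial_def dd_def[symmetric] christoffel_lc_matrix[abs_def]
    using dd_inner_const[OF smooth_on_differentiable[OF smooth_bil_on[OF levi_civitaD(1)[OF lc]] p], of "axis i 1" _ _ "axis l 1"]
    by (simp add: inner_axis)
  have s: "(\<Sum>m\<in>UNIV. christoffel G l i m p * christoffel G m j k p)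
     = lc_matrix G p (axis i 1) (lc_matrix G p (axis j 1) (axis k 1)) $ l" for i j k
    unfolding christoffel_lc_matrix
    using linear_sum_axis[of "lc_matrix G p (axis i 1)" "lc_matrix G p (axis j 1) (axis k 1)"]
      levi_civitaD(2)[OF lc p] by (simp add: bilinear_def mult.commute)
  show ?thesis
    unfolding riemann_comp_def d sum_subtractf s Rm_def by simp
qed

lemma riemann_comp_sum:
  assumes p: "p \<in> U"
  shows "(\<chi> l. \<Sum>i\<in>UNIV. \<Sum>j\<in>UNIV. \<Sum>k\<in>UNIV. riemann_comp G l i j k p * x $ i * y $ j * z $ k)
    = Rm (lc_matrix G) p x y z"
proof -
  note l = Rm_linear[OF metric_fieldD(1)[OF g] p levi_civitaD(1)[OF lc_matrix_levi_civita]]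
  have "Rm (lc_matrix G) p x y z = (\<Sum>i\<in>UNIV. x $ i *\<^sub>R (\<Sum>j\<in>UNIV. y $ j *\<^sub>R (\<Sum>k\<in>UNIV. z $ k *\<^sub>R
      Rm (lc_matrix G) p (axis i 1) (axis j 1) (axis k 1))))"
    by (subst linear_sum_axis[OF l(1)], subst linear_sum_axis[OF l(2)], subst linear_sum_axis[OF l(3)]) rule
  then show ?thesis
    by (simp add: vec_eq_iff riemann_comp_Rm[OF p] sum_distrib_left mult_ac)
qed

end

section \<open>Flat conformal factors without critical points\<close>

lemma Rm_cong_open:
  assumes U: "open U" "p \<in> U" and eq: "\<And>q x y. q \<in> U \<Longrightarrow> \<Gamma>1 q x y = \<Gamma>2 q x y"
  shows "Rm \<Gamma>1 p x y z = Rm \<Gamma>2 p x y z"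
proof -
  have "dd u (\<lambda>q. \<Gamma>1 q v w) p = dd u (\<lambda>q. \<Gamma>2 q v w) p" for u v w
    by (rule dd_cong_open[OF U]) (rule eq)
  then show ?thesis by (simp add: Rm_def eq[OF U(2)])
qed

lemma levi_civita_unique:
  assumes g: "metric_field U g" and lc: "levi_civita U g \<Gamma>1" "levi_civita U g \<Gamma>2" and p: "p \<in> U"
  shows "\<Gamma>1 p x y = \<Gamma>2 p x y"
  by (rule koszul_uniqueness[OF g p]) (use levi_civitaD[OF lc(1)] levi_civitaD[OF lc(2)] p in blast)+

lemma levi_civita_Rm_unique:
  assumes g: "metric_field U g" and lc: "levi_civita U g \<Gamma>1" "levi_civita U g \<Gamma>2" and p: "p \<in> U"
  shows "Rm \<Gamma>1 p x y z = Rm \<Gamma>2 p x y z"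
  by (rule Rm_cong_open[OF metric_fieldD(1)[OF g] p levi_civita_unique[OF g lc]])

lemma metric_field_subset: "metric_field U g \<Longrightarrow> open V \<Longrightarrow> V \<subseteq> U \<Longrightarrow> metric_field V g"
  unfolding metric_field_def using smooth_bil_subset by blast

lemma levi_civita_subset: "levi_civita U g \<Gamma> \<Longrightarrow> V \<subseteq> U \<Longrightarrow> levi_civita V g \<Gamma>"
  unfolding levi_civita_def using smooth_bil_subset by blast

lemma levi_civita_cong:
  assumes "levi_civita U g \<Gamma>" "open U" "\<And>p x y. p \<in> U \<Longrightarrow> h p x y = g p x y"
  shows "levi_civita U h \<Gamma>"
proof -
  have "dd x (\<lambda>q. h q y z) p = dd x (\<lambda>q. g q y z) p" if "p \<in> U" for x y z p
    by (rule dd_cong_open[OF assms(2) that]) (rule assms(3))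
  then show ?thesis using assms(1,3) unfolding levi_civita_def by simp
qed

lemma (in conformally_flat_data) subset:
  assumes "open V" "V \<subseteq> U"
  shows "conformally_flat_data V g \<Gamma> S u P w"
proof
  show "metric_field V g" "levi_civita V g \<Gamma>" "smooth_lin V S" "smooth_on V u" "smooth_on V P" "smooth_on V w"
    by (rule metric_field_subset[OF g assms] levi_civita_subset[OF lc assms(2)]
      smooth_lin_subset[OF S assms(2)] smooth_on_subset[OF u assms(2)] smooth_on_subset[OF P assms(2)]
      smooth_on_subset[OF w assms(2)])+
  fix p assume "p \<in> V"
  then have p: "p \<in> U" using assms(2) by blast
  show "u p > 0" by (rule u_pos[OF p])
  show "g p (P p) (P p) = 2 * u p * w p" by (rule norm_P[OF p])
  fix x
  show "dd x u p = g p (P p) x" by (rule grad[OF p])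
  show "cd \<Gamma> x P p = w p *\<^sub>R x - u p *\<^sub>R S p x" by (rule dP[OF p])
  fix y
  show "g p (S p x) y = g p x (S p y)" by (rule S_sym[OF p])
  show "Rm \<Gamma> p x y z = kn (g p) (S p) x y z" for z by (rule curv[OF p])
qed

text \<open>Flatness may be given for any Levi-Civita connection of the rescaled metric; uniqueness
  moves it to \<open>conformal_lc\<close>. Here \<open>w\<close> is a positive multiple of the
  squared length of the gradient of \<open>s\<close>, hence positive off the critical
  points.\<close>

lemma flat_conformal_data:
  fixes g :: "real ^ 'n \<Rightarrow> real ^ 'n \<Rightarrow> real ^ 'n \<Rightarrow> real"
  assumes g: "metric_field U g" and lc: "levi_civita U g \<Gamma>" and s: "smooth_on U s"
    and lcs: "levi_civita U (\<lambda>q x y. exp (2 * s q) * g q x y) \<Gamma>s"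
    and flat: "\<And>p x y z. p \<in> U \<Longrightarrow> Rm \<Gamma>s p x y z = 0"
  obtains S u P w where "conformally_flat_data U g \<Gamma> S u P w"
    "\<And>p x. p \<in> U \<Longrightarrow> dd x s p \<noteq> 0 \<Longrightarrow> w p > 0"
proof -
  obtain N where N: "smooth_on U N" "\<And>p x. p \<in> U \<Longrightarrow> dd x s p = g p (N p) x"
    using gradient_exists[OF g s] by blast
  have "Rm (conformal_lc g s N \<Gamma>) p x y z = 0" if "p \<in> U" for p x y z
    using levi_civita_Rm_unique[OF metric_field_conformal[OF g s] conformal_levi_civita[OF g lc s N] lcs that]
      flat[OF that] by simp
  note data = conformally_flat_data_of_flat[OF g lc s N this]
  have "exp (- s p) * g p (N p) (N p) / 2 > 0" if "p \<in> U" "dd x s p \<noteq> 0" for p x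
  proof -
    have "N p \<noteq> 0"
      using that N(2)[OF that(1), of x] bilinear_lzero[OF metric_fieldD(3)[OF g that(1)]] by fastforce
    then show ?thesis using metric_fieldD(5)[OF g that(1)] by simp
  qed
  then show ?thesis using that data by blast
qed

text \<open>The conformal factor is the inverse square of \<open>r = h(X, X) / 2\<close>, half the squared distance to a
  point off the neighbourhood. Here \<open>X\<close> is a position vector field, that is, \<open>cd \<Gamma> x X = x\<close>; an extra
  coordinate that stays equal to \<open>1\<close> makes this equation homogeneous.\<close>

lemma flat_inversion:
  fixes h :: "'v::euclidean_space \<Rightarrow> 'v \<Rightarrow> 'v \<Rightarrow> real"
  assumes h: "metric_field U h" and lc: "levi_civita U h \<Gamma>" and p0: "p0 \<in> U"
    and flat: "\<And>p x y z. p \<in> U \<Longrightarrow> Rm \<Gamma> p x y z = 0"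
  obtains V s \<Gamma>s x where "open V" "p0 \<in> V" "V \<subseteq> U" "smooth_on V s"
    "levi_civita V (\<lambda>q x y. exp (2 * s q) * h q x y) \<Gamma>s"
    "\<And>p x y z. p \<in> V \<Longrightarrow> Rm \<Gamma>s p x y z = 0" "dd x s p0 \<noteq> 0"
proof -
  note U = metric_fieldD(1)[OF h]
  note G = levi_civitaD(1)[OF lc]
  \<comment> \<open>A parallel section is a pair of a field \<open>X\<close> and a constant
    \<open>f\<close> with \<open>cd \<Gamma> x X = f *\<^sub>R x\<close>.\<close>
  define \<Gamma>a where "\<Gamma>a p x F = (\<Gamma> p x (fst F) - snd F *\<^sub>R x, 0::real)" for p x and F :: "'v \<times> real"
  have \<Gamma>a: "smooth_bil U \<Gamma>a"
    unfolding smooth_bil_def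
  proof (intro conjI ballI allI)
    show "bilinear (\<Gamma>a p)" if "p \<in> U" for p
      unfolding bilinear_def \<Gamma>a_def
      by (auto intro!: linearI simp: bilinear_simps[OF smooth_bilD[OF G that]] algebra_simps)
    show "smooth_on U (\<lambda>p. \<Gamma>a p x F)" for x F
    proof (rule smooth_on_euclidean_iff[OF U, THEN iffD2], rule ballI)
      fix b :: "'v \<times> real"
      have "(\<lambda>p. \<Gamma>a p x F \<bullet> b) = (\<lambda>p. (\<Gamma> p x (fst F) - snd F *\<^sub>R x) \<bullet> fst b)"
        by (simp add: \<Gamma>a_def inner_prod_def)
      then show "smooth_on U (\<lambda>p. \<Gamma>a p x F \<bullet> b)"
        using smooth_on_inner[OF U smooth_on_diff[OF U smooth_bil_on[OF G] smooth_on_const] smooth_on_const] by simp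
    qed
  qed
  \<comment> \<open>The extra coordinate contributes only a multiple of the torsion
    \<open>\<Gamma> p x y - \<Gamma> p y x\<close>, which vanishes.\<close>
  have "Rm \<Gamma>a p x y F = 0" if p: "p \<in> U" for p x y F
  proof -
    have d: "dd x (\<lambda>q. \<Gamma>a q y F) p = (dd x (\<lambda>q. \<Gamma> q y (fst F)) p, 0)" for x y
    proof (rule dd_eq)
      have "((\<lambda>q. (\<Gamma> q y (fst F) - snd F *\<^sub>R y, 0 :: real)) has_derivative
          (\<lambda>v. (dd v (\<lambda>q. \<Gamma> q y (fst F)) p - 0, 0))) (at p)"
        by (intro has_derivative_Pair has_derivative_diff has_derivative_const smooth_on_has_dd[OF smooth_bil_on[OF G] p])
      then show "((\<lambda>q. \<Gamma>a q y F) has_derivative (\<lambda>x. (dd x (\<lambda>q. \<Gamma> q y (fst F)) p, 0))) (at p)"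
        unfolding \<Gamma>a_def by simp
    qed
    have "Rm \<Gamma>a p x y F = (Rm \<Gamma> p x y (fst F), 0)"
      unfolding Rm_def d unfolding \<Gamma>a_def
      by (simp add: bilinear_simps[OF smooth_bilD[OF G p]] levi_civitaD(3)[OF lc p, of y x] algebra_simps)
    then show ?thesis using flat[OF p] by (simp add: zero_prod_def)
  qed
  \<comment> \<open>A nonzero position vector at \<open>p0\<close> keeps the centre of the inversion
    away from \<open>p0\<close>.\<close>
  obtain v0 :: 'v where v0: "v0 \<noteq> 0" using nonempty_Basis nonzero_Basis by blast
  obtain B F where B: "open B" "convex B" "p0 \<in> B" "B \<subseteq> U" and F: "smooth_on B F" "F p0 = (v0, 1)"
    "\<And>p x. p \<in> B \<Longrightarrow> cd \<Gamma>a x F p = 0"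
    using linear_frobenius[OF U p0 \<Gamma>a \<open>\<And>F y x p. p \<in> U \<Longrightarrow> Rm \<Gamma>a p x y F = 0\<close>, of "(v0, 1)"] by blast
  define X where "X p = fst (F p)" for p
  have X: "smooth_on B X"
    unfolding X_def[abs_def] by (rule smooth_on_linear_compose[OF B(1) F(1) bounded_linear_fst])
  have dF: "dd x F p = - \<Gamma>a p x (F p)" if "p \<in> B" for x p
    using F(3)[OF that, of x] by (simp add: cd_def eq_neg_iff_add_eq_0)
  have snd: "snd (F p) = 1" if "p \<in> B" for p
  proof -
    have "((\<lambda>p. snd (F p)) has_derivative (\<lambda>v. 0)) (at p within B)" if "p \<in> B" for p
    proof -
      have "((\<lambda>p. snd (F p)) has_derivative (\<lambda>v. snd (dd v F p))) (at p)"
        by (rule has_derivative_snd[OF smooth_on_has_dd[OF F(1) that]])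
      then show ?thesis using dF[OF that] by (simp add: \<Gamma>a_def has_derivative_at_withinI)
    qed
    from has_derivative_zero_unique[OF B(2) this \<open>p \<in> B\<close> B(3)] show ?thesis using F(2) by simp
  qed
  have cdX: "cd \<Gamma> x X p = x" if p: "p \<in> B" for p x
  proof -
    have "dd x X p = fst (dd x F p)"
      unfolding X_def[abs_def]
      by (rule dd_eq[OF has_derivative_fst[OF smooth_on_has_dd[OF F(1) p]]])
    then show ?thesis using dF[OF p, of x] snd[OF p] by (simp add: cd_def \<Gamma>a_def X_def)
  qed
  note hB = metric_field_subset[OF h B(1,4)] and lcB = levi_civita_subset[OF lc B(4)]
  \<comment> \<open>The triple \<open>r\<close>, \<open>X\<close>, 1 solves the system of
    \<open>conformally_flat_data\<close> for \<open>h\<close> with \<open>S = 0\<close>; this is why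
    the inverse square of \<open>r\<close> is again a flat factor.\<close>
  define r where "r p = h p (X p) (X p) / 2" for p
  have r: "smooth_on B r"
    unfolding r_def[abs_def]
    by (intro smooth_on_divide B smooth_on_const smooth_bil_smooth[OF B(1) metric_fieldD(2)[OF hB] X X]) simp
  have dr: "dd x r p = h p (X p) x" if p: "p \<in> B" for p x
  proof -
    have "((\<lambda>p. h p (X p) (X p)) has_derivative (\<lambda>v. dd v (\<lambda>p. h p (X p) (X p)) p)) (at p)"
      by (rule smooth_on_has_dd[OF smooth_bil_smooth[OF B(1) metric_fieldD(2)[OF hB] X X] p])
    then have "(r has_derivative (\<lambda>v. dd v (\<lambda>p. h p (X p) (X p)) p / 2)) (at p)"
      unfolding r_def[abs_def]
      by (rule bounded_linear.has_derivative[OF bounded_linear_divide])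
    then have "dd x r p = dd x (\<lambda>p. h p (X p) (X p)) p / 2" by (rule dd_eq)
    then show ?thesis
      unfolding levi_civita_metric_dd[OF hB lcB p X X] cdX[OF p]
      using metric_fieldD(4)[OF hB p, of x "X p"] by simp
  qed
  define V where "V = {p \<in> B. X p \<noteq> 0}"
  have "V = B \<inter> X -` (- {0})" by (auto simp: V_def)
  then have V: "open V" "V \<subseteq> B" "p0 \<in> V"
    using continuous_open_preimage[OF smooth_on_continuous[OF X] B(1), of "-{0}"] B(3) F(2) v0
    by (auto simp: X_def)
  have rp: "r p > 0" if "p \<in> V" for p
    using that metric_fieldD(5)[OF hB, of p "X p"] by (auto simp: V_def r_def)
  note hV = metric_field_subset[OF hB V(1,2)] and lcV = levi_civita_subset[OF lcB V(2)]
  note rV = smooth_on_subset[OF r V(2)] and XV = smooth_on_subset[OF X V(2)]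
  define s where "s p = - ln (r p)" for p
  define N where "N p = (- inverse (r p)) *\<^sub>R X p" for p
  have s: "smooth_on V s"
    unfolding s_def[abs_def] by (intro smooth_on_uminus smooth_on_ln V rV rp)
  have ir: "smooth_on V (\<lambda>p. - inverse (r p))"
    by (intro smooth_on_uminus smooth_on_inverse V rV) (use rp in fastforce)
  have N: "smooth_on V N"
    unfolding N_def[abs_def] by (rule smooth_on_scaleR[OF V(1) ir XV])
  have grad: "dd x s p = h p (N p) x" if p: "p \<in> V" for p x
  proof -
    have "(s has_derivative (\<lambda>x. - (inverse (r p) * dd x r p))) (at p)"
      unfolding s_def[abs_def]
      by (rule has_derivative_minus, rule has_derivative_eq_rhs,
        rule has_derivative_ln[where g = r and x = p, OF rp[OF p]],
        rule smooth_on_has_dd[OF rV p]) (simp add: fun_eq_iff mult.commute)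
    from dd_eq[OF this] show ?thesis
      using dr[of p x] p V(2) by (auto simp: N_def bilinear_simps[OF metric_fieldD(3)[OF hV p]])
  qed
  have "Rm (conformal_lc h s N \<Gamma>) p x y z = 0" if p: "p \<in> V" for p x y z
  proof -
    have pB: "p \<in> B" using p V by blast
    have rne: "r p \<noteq> 0" using rp[OF p] by simp
    have di: "dd x (\<lambda>q. - inverse (r q)) p = inverse (r p) * inverse (r p) * h p (X p) x" for x
    proof -
      have "((\<lambda>q. - inverse (r q)) has_derivative (\<lambda>x. - (- (inverse (r p) * dd x r p * inverse (r p))))) (at p)"
        by (intro has_derivative_minus Deriv.has_derivative_inverse[OF rne smooth_on_has_dd[OF rV p]])
      from dd_eq[OF this] show ?thesis using dr[OF pB] by simp
    qed
    have "cd \<Gamma> x N p = (inverse (r p) * inverse (r p) * h p (X p) x) *\<^sub>R X p - inverse (r p) *\<^sub>R x" for x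
      unfolding N_def[abs_def] cd_scale[OF p levi_civitaD(1)[OF lcV] ir XV] di cdX[OF pB] by simp
    moreover have "h p (N p) (N p) = 2 * inverse (r p)"
      using rne by (simp add: N_def bilinear_simps[OF metric_fieldD(3)[OF hV p]] r_def)
    moreover have "h p (X p) (X p) = 2 * r p" by (simp add: r_def)
    moreover have rr: "r p * (inverse (r p) * inverse (r p)) = inverse (r p)" using rne by simp
    ultimately have "conformal_schouten h s N \<Gamma> p = (\<lambda>x. 0)"
      unfolding conformal_schouten_def[abs_def] grad[OF p]
      using rne by (simp add: N_def bilinear_simps[OF metric_fieldD(3)[OF hV p]] mult_ac rr)
    then show ?thesis
      using conformal_Rm[OF hV lcV s N grad p] flat[of p] pB B(4)
      by (auto simp: kn_def bilinear_simps[OF metric_fieldD(3)[OF hV p]])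
  qed
  \<comment> \<open>In the radial direction the derivative of \<open>s\<close> is
    \<open>- h p0 (X p0) (X p0) / r p0 = - 2\<close>.\<close>
  moreover have "dd (X p0) s p0 \<noteq> 0"
    using grad[OF V(3), of "X p0"] rp[OF V(3)]
    by (simp add: N_def bilinear_simps[OF metric_fieldD(3)[OF hV V(3)]] r_def)
  ultimately show ?thesis
    using that[OF V(1,3) subset_trans[OF V(2) B(4)] s conformal_levi_civita[OF hV lcV s N grad]] by blast
qed

text \<open>The dual factor involves \<open>ln (w p)\<close>, so \<open>w\<close> has to be positive
  near \<open>p0\<close>. If \<open>s\<close> is critical there, an inversion of the flat metric
  adds a factor \<open>s'\<close>, and \<open>s' + s\<close> has the nonzero derivative of
  \<open>s'\<close> at \<open>p0\<close>.\<close>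

theorem noncritical_conformal_data:
  fixes g :: "real ^ 'n \<Rightarrow> real ^ 'n \<Rightarrow> real ^ 'n \<Rightarrow> real"
  assumes g: "metric_field U g" and lc: "levi_civita U g \<Gamma>" and s: "smooth_on U s"
    and lcs: "levi_civita U (\<lambda>q x y. exp (2 * s q) * g q x y) \<Gamma>s"
    and flat: "\<And>p x y z. p \<in> U \<Longrightarrow> Rm \<Gamma>s p x y z = 0" and p0: "p0 \<in> U"
  obtains V S u P w where "open V" "p0 \<in> V" "V \<subseteq> U" "conformally_flat_data V g \<Gamma> S u P w"
    "\<And>p. p \<in> V \<Longrightarrow> w p > 0"
proof -
  note U = metric_fieldD(1)[OF g]
  note conclude = that
  have main: thesis
    if V: "open V" "p0 \<in> V" "V \<subseteq> U" and s: "smooth_on V s"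
      and lcs: "levi_civita V (\<lambda>q x y. exp (2 * s q) * g q x y) \<Gamma>s"
      and flat: "\<And>p x y z. p \<in> V \<Longrightarrow> Rm \<Gamma>s p x y z = 0" and nc: "dd x s p0 \<noteq> 0" for V s \<Gamma>s x
  proof -
    obtain S u P w where d: "conformally_flat_data V g \<Gamma> S u P w"
      "\<And>p x. p \<in> V \<Longrightarrow> dd x s p \<noteq> 0 \<Longrightarrow> w p > 0"
      using flat_conformal_data[OF metric_field_subset[OF g V(1,3)] levi_civita_subset[OF lc V(3)] s lcs flat] by blast
    interpret conformally_flat_data V g \<Gamma> S u P w by (rule d(1))
    let ?V = "V \<inter> w -` {0<..}"
    have "open ?V" by (rule continuous_open_preimage[OF smooth_on_continuous[OF w] V(1)]) simp
    moreover have "p0 \<in> ?V" using d(2)[OF V(2) nc] V(2) by simp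
    ultimately show thesis
      using conclude[OF _ _ _ subset[of ?V]] V(3) by auto
  qed
  show thesis
  proof (cases "\<exists>x. dd x s p0 \<noteq> 0")
    case True
    then show thesis using main[OF U p0 subset_refl s lcs flat] by blast
  next
    case False
    obtain V s' \<Gamma>' x where V: "open V" "p0 \<in> V" "V \<subseteq> U" and s': "smooth_on V s'"
      and lc': "levi_civita V (\<lambda>q x y. exp (2 * s' q) * (exp (2 * s q) * g q x y)) \<Gamma>'"
      and flat': "\<And>p x y z. p \<in> V \<Longrightarrow> Rm \<Gamma>' p x y z = 0" and nc: "dd x s' p0 \<noteq> 0"
      by (rule flat_inversion[OF metric_field_conformal[OF g s] lcs p0]) (rule flat, assumption, rule that)
    have sV: "smooth_on V s" by (rule smooth_on_subset[OF s V(3)])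
    have ss: "smooth_on V (\<lambda>q. s' q + s q)" by (rule smooth_on_add[OF V(1) s' sV])
    have "dd x (\<lambda>q. s' q + s q) p0 \<noteq> 0"
      using False nc dd_add[OF smooth_on_differentiable[OF s' V(2)] smooth_on_differentiable[OF sV V(2)]] by simp
    moreover have "levi_civita V (\<lambda>q x y. exp (2 * (s' q + s q)) * g q x y) \<Gamma>'"
      by (rule levi_civita_cong[OF lc' V(1)]) (simp add: distrib_left exp_add)
    ultimately show thesis using main[OF V ss _ flat'] by blast
  qed
qed

section \<open>Isometries and traces\<close>

context
  fixes U V :: "'v::euclidean_space set" and g h \<Gamma> \<Gamma>2 \<psi>
  assumes g: "metric_field U g" and lc: "levi_civita U g \<Gamma>"
    and h: "metric_field V h" and lc2: "levi_civita V h \<Gamma>2"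
    and \<psi>: "smooth_on U \<psi>" and \<psi>V: "\<psi> ` U \<subseteq> V"
    and iso: "\<And>p x y. p \<in> U \<Longrightarrow> g p x y = h (\<psi> p) (dd x \<psi> p) (dd y \<psi> p)"
begin

text \<open>An isometric derivative \<open>J\<close> is injective, hence bijective by dimension. So
  the right-hand side can be pulled back by \<open>J\<close> to a map \<open>\<Gamma>3\<close> at
  \<open>p\<close>, which satisfies Koszul's conditions and therefore equals
  \<open>\<Gamma> p\<close>.\<close>

lemma isometry_levi_civita:
  assumes p: "p \<in> U"
  shows "dd (\<Gamma> p x y) \<psi> p = \<Gamma>2 (\<psi> p) (dd x \<psi> p) (dd y \<psi> p) + dd x (dd y \<psi>) p"
proof -
  note U = metric_fieldD(1)[OF g] and V = metric_fieldD(1)[OF h]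
  have \<psi>p: "\<psi> p \<in> V" using p \<psi>V by blast
  note bil = metric_fieldD(3)[OF h \<psi>p]
  define J where "J x = dd x \<psi> p" for x
  have J: "linear J" unfolding J_def by (rule linear_dd[OF smooth_on_differentiable[OF \<psi> p]])
  have "inj J"
  proof (rule linear_injective_0[THEN iffD2, OF J], intro allI impI)
    fix x assume "J x = 0"
    then have "g p x x = 0" using iso[OF p, of x x] by (simp add: J_def bilinear_simps[OF bil])
    then show "x = 0" using metric_fieldD(5)[OF g p, of x] by fastforce
  qed
  then have "surj J" using linear_inj_imp_surj[OF J] by blast
  define \<Gamma>3 where "\<Gamma>3 x y = inv J (\<Gamma>2 (\<psi> p) (J x) (J y) + dd x (dd y \<psi>) p)" for x y
  have J3: "J (\<Gamma>3 x y) = \<Gamma>2 (\<psi> p) (J x) (J y) + dd x (dd y \<psi>) p" for x y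
    unfolding \<Gamma>3_def by (rule surj_f_inv_f[OF \<open>surj J\<close>])
  have b: "smooth_bil U (\<lambda>q. h (\<psi> q))"
    using metric_fieldD(3)[OF h] \<psi>V smooth_on_compose[OF U V \<psi>V \<psi> smooth_bil_on[OF metric_fieldD(2)[OF h]]]
    by (auto simp: smooth_bil_def)
  have "\<Gamma> p x y = \<Gamma>3 x y" for x y
  proof (rule koszul_uniqueness[where ?\<Gamma>1.0 = "\<Gamma> p" and ?\<Gamma>2.0 = \<Gamma>3, OF g p])
    show "\<Gamma> p x y = \<Gamma> p y x" for x y by (rule levi_civitaD(3)[OF lc p])
    show "dd x (\<lambda>q. g q y z) p = g p (\<Gamma> p x y) z + g p y (\<Gamma> p x z)" for x y z
      by (rule levi_civitaD(4)[OF lc p])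
    show "\<Gamma>3 x y = \<Gamma>3 y x" for x y
      unfolding \<Gamma>3_def using levi_civitaD(3)[OF lc2 \<psi>p] clairaut[OF U \<psi> p, of x y] by simp
    fix x y z
    have "dd x (\<lambda>q. g q y z) p = dd x (\<lambda>q. h (\<psi> q) (dd y \<psi> q) (dd z \<psi> q)) p"
      by (rule dd_cong_open[OF U p iso])
    also have "\<dots> = dd x (\<lambda>q. h (\<psi> q) (J y) (J z)) p + h (\<psi> p) (dd x (dd y \<psi>) p) (J z) + h (\<psi> p) (J y) (dd x (dd z \<psi>) p)"
      using smooth_bil_dd[OF U p b smooth_on_dd[OF \<psi>] smooth_on_dd[OF \<psi>], of x y z] by (simp add: J_def)
    also have "dd x (\<lambda>q. h (\<psi> q) (J y) (J z)) p = dd (J x) (\<lambda>q. h q (J y) (J z)) (\<psi> p)"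
      unfolding J_def
      by (rule dd_compose[OF smooth_on_differentiable[OF \<psi> p]
          smooth_on_differentiable[OF smooth_bil_on[OF metric_fieldD(2)[OF h]] \<psi>p]])
    also have "\<dots> = h (\<psi> p) (\<Gamma>2 (\<psi> p) (J x) (J y)) (J z) + h (\<psi> p) (J y) (\<Gamma>2 (\<psi> p) (J x) (J z))"
      by (rule levi_civitaD(4)[OF lc2 \<psi>p])
    finally show "dd x (\<lambda>q. g q y z) p = g p (\<Gamma>3 x y) z + g p y (\<Gamma>3 x z)"
      unfolding iso[OF p] J_def[symmetric] J3 by (simp add: bilinear_simps[OF bil])
  qed
  then show ?thesis using J3 by (simp add: J_def)
qed

text \<open>\<open>Rm_pullback\<close> handles the two direction slots. \<open>Rm_gauge\<close>,
  with the derivative of \<open>\<psi>\<close> as gauge transformation, handles the fibre slot; its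
  hypothesis is \<open>isometry_levi_civita\<close>.\<close>

lemma isometry_Rm:
  assumes p: "p \<in> U"
  shows "dd (Rm \<Gamma> p x y z) \<psi> p = Rm \<Gamma>2 (\<psi> p) (dd x \<psi> p) (dd y \<psi> p) (dd z \<psi> p)"
proof -
  note U = metric_fieldD(1)[OF g] and V = metric_fieldD(1)[OF h]
  have T: "smooth_lin U (\<lambda>q z. dd z \<psi> q)"
    unfolding smooth_lin_def
    by (intro conjI ballI allI linear_dd smooth_on_differentiable[OF \<psi>] smooth_on_dd[OF \<psi>])
  note pb = Rm_pullback[OF U p V \<psi>V \<psi> levi_civitaD(1)[OF lc2]]
  show ?thesis
    using Rm_gauge[OF U p levi_civitaD(1)[OF lc] pb(1) T] isometry_levi_civita
    by (simp add: add.commute pb(2))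
qed

end

section \<open>Traces and contractions\<close>

definition ltrace :: "(real ^ 'n \<Rightarrow> real ^ 'n) \<Rightarrow> real" where
  "ltrace L = (\<Sum>i\<in>UNIV. L (axis i 1) $ i)"

lemma ltrace_trace: "ltrace L = trace (matrix L)"
  by (simp add: ltrace_def trace_def matrix_def)

lemma ltrace_conj:
  assumes "linear J" "linear L" "linear J'" "\<And>x. J' (J x) = x"
  shows "ltrace (\<lambda>x. J (L (J' x))) = ltrace L"
proof -
  have "matrix (\<lambda>x. J (L (J' x))) = matrix J ** matrix (\<lambda>x. L (J' x))"
    using matrix_compose[of "\<lambda>x. L (J' x)" J] linear_compose[OF assms(3,2)] assms(1)
    by (simp add: o_def)
  then have "ltrace (\<lambda>x. J (L (J' x))) = trace (matrix (\<lambda>x. L (J' x)) ** matrix J)"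
    unfolding ltrace_trace by (simp only: trace_mul_sym[of "matrix J"])
  also have "matrix (\<lambda>x. L (J' x)) ** matrix J = matrix (\<lambda>x. L (J' (J x)))"
    using matrix_compose[of J "\<lambda>x. L (J' x)"] linear_compose[OF assms(3,2)] assms(1)
    by (simp add: o_def)
  finally show ?thesis by (simp add: ltrace_trace assms(4))
qed

lemma ltrace_add: "ltrace (\<lambda>x. K x + L x) = ltrace K + ltrace L"
  and ltrace_scale: "ltrace (\<lambda>x. r *\<^sub>R K x) = r * ltrace K"
  and ltrace_id: "ltrace (\<lambda>x::real ^ 'n. x) = real CARD('n)"
  by (simp_all add: ltrace_def sum.distrib sum_distrib_left axis_def)

lemma ltrace_rank_one:
  assumes "linear f"
  shows "ltrace (\<lambda>x. f x *\<^sub>R y) = f y"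
  using linear_sum_axis[OF assms, of y] by (simp add: ltrace_def mult.commute)

text \<open>The identity contributes the dimension, and each of the two rank-one terms subtracts one
  copy of \<open>h (S y) z\<close>. This is the origin of the normalisation by n - 2 in the Schouten
  tensor.\<close>

lemma ltrace_kn:
  fixes h :: "real ^ 'n \<Rightarrow> real ^ 'n \<Rightarrow> real"
  assumes h: "bilinear h" and S: "linear S" "\<And>x y. h (S x) y = h x (S y)"
  shows "ltrace (\<lambda>x. kn h S x y z) = (real CARD('n) - 2) * h (S y) z + ltrace S * h y z"
proof -
  have l: "linear (\<lambda>x. - h (S x) z)" "linear (\<lambda>x. - h x z)"
    using S(1) by (auto intro!: linearI simp: bilinear_simps[OF h] linear_map_simps[OF S(1)])
  have "(\<lambda>x. kn h S x y z) = (\<lambda>x. (h (S y) z *\<^sub>R x + (- h (S x) z) *\<^sub>R y) + (h y z *\<^sub>R S x + (- h x z) *\<^sub>R S y))"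
    by (simp add: kn_def fun_eq_iff)
  then have "ltrace (\<lambda>x. kn h S x y z) = (h (S y) z * real CARD('n) + - h (S y) z) + (h y z * ltrace S + - h (S y) z)"
    by (simp only: ltrace_add ltrace_scale ltrace_id ltrace_rank_one[OF l(1)] ltrace_rank_one[OF l(2)])
  then show ?thesis by (simp add: algebra_simps)
qed

text \<open>Both index contractions in the definitions become basis-free: the first one is that of
  \<open>dual_tensor\<close>, the second that of the scalar curvature.\<close>

lemma metric_contraction:
  fixes h :: "real ^ 'n \<Rightarrow> real ^ 'n \<Rightarrow> real"
  assumes h: "bilinear h" "\<And>x y. h x y = h y x" "\<And>x. x \<noteq> 0 \<Longrightarrow> h x x > 0"
  defines "M \<equiv> \<chi> i j. h (axis i 1) (axis j 1)"
  shows "(\<Sum>a\<in>UNIV. \<Sum>b\<in>UNIV. h x (axis a 1) * h y (axis b 1) * matrix_inv M $ a $ b) = h x y"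
    "(\<Sum>i\<in>UNIV. \<Sum>j\<in>UNIV. matrix_inv M $ i $ j * h (L (axis i 1)) (axis j 1)) = ltrace L"
proof -
  have M: "h x y = mform M x y" for x y unfolding M_def by (rule bilinear_mform_eq[OF h(1)])
  then have det: "det M \<noteq> 0" using mform_pos_det h(3) by metis
  have hx: "h x (axis b 1) = (M *v x) $ b" for x b
    using h(2)[of x "axis b 1"] M[of "axis b 1" x] by (simp add: mform_def inner_axis')
  have "(\<Sum>a\<in>UNIV. \<Sum>b\<in>UNIV. h x (axis a 1) * h y (axis b 1) * matrix_inv M $ a $ b)
      = mform (matrix_inv M) (M *v x) (M *v y)"
    unfolding hx by (simp add: mform_sum mult_ac)
  also have "\<dots> = mform M y x"
    by (simp add: mform_def matrix_inv_vec[OF det] inner_commute)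
  finally show "(\<Sum>a\<in>UNIV. \<Sum>b\<in>UNIV. h x (axis a 1) * h y (axis b 1) * matrix_inv M $ a $ b) = h x y"
    by (metis M h(2))
  have "(\<Sum>j\<in>UNIV. matrix_inv M $ i $ j * h (L (axis i 1)) (axis j 1)) = L (axis i 1) $ i" for i
  proof -
    have "(\<Sum>j\<in>UNIV. matrix_inv M $ i $ j * h (L (axis i 1)) (axis j 1)) = (matrix_inv M *v (M *v L (axis i 1))) $ i"
      unfolding hx by (simp add: matrix_vector_mult_def)
    then show ?thesis by (simp add: matrix_inv_vec[OF det])
  qed
  then show "(\<Sum>i\<in>UNIV. \<Sum>j\<in>UNIV. matrix_inv M $ i $ j * h (L (axis i 1)) (axis j 1)) = ltrace L"
    by (simp add: ltrace_def)
qed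

section \<open>Charts and tangent vectors\<close>

definition cimg :: "('m, 'n::finite) chart \<Rightarrow> 'm set \<Rightarrow> (real ^ 'n) set" where
  "cimg c W = coord c ` (cdom c \<inter> W)"

definition trans_map :: "('m, 'n::finite) chart \<Rightarrow> ('m, 'n) chart \<Rightarrow> real ^ 'n \<Rightarrow> real ^ 'n" where
  "trans_map c c' y = coord c' (param c y)"

text \<open>Extends \<open>coord_vec\<close> from basis vectors to all component vectors; it inverts
  the reading of components in the chart \<open>c\<close>.\<close>

definition mk_tvec ::
    "('m, 'n::finite) chart set \<Rightarrow> ('m, 'n) chart \<Rightarrow> 'm \<Rightarrow> real ^ 'n \<Rightarrow> ('m, 'n) tvec" where
  "mk_tvec \<A> c p v = (\<lambda>c'. if c' \<in> charts_at \<A> p then transition_deriv c c' p v else 0)"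

definition bilin_at :: "('m, 'n::finite) chart set \<Rightarrow> ('m, 'n) tensor2 \<Rightarrow> 'm \<Rightarrow> bool" where
  "bilin_at \<A> h p \<longleftrightarrow> (\<forall>X\<in>tangent_space \<A> p. \<forall>Y\<in>tangent_space \<A> p. \<forall>Z\<in>tangent_space \<A> p. \<forall>r.
     h p (tadd X Y) Z = h p X Z + h p Y Z \<and> h p (tscale r X) Z = r * h p X Z \<and>
     h p Z (tadd X Y) = h p Z X + h p Z Y \<and> h p Z (tscale r X) = r * h p Z X)"

text \<open>Built from the component matrix, hence bilinear at every point whatever the tensor is;
  it represents the tensor where that is itself bilinear.\<close>

definition loc_form ::
    "('m, 'n::finite) chart set \<Rightarrow> ('m, 'n) tensor2 \<Rightarrow> ('m, 'n) chart \<Rightarrow> real ^ 'n \<Rightarrow> real ^ 'n \<Rightarrow> real ^ 'n \<Rightarrow> real" where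
  "loc_form \<A> h c y = mform (comps \<A> h c (param c y))"

definition loc_Rm ::
    "('m, 'n::finite) chart set \<Rightarrow> ('m, 'n) tensor2 \<Rightarrow> ('m, 'n) chart \<Rightarrow> real ^ 'n
       \<Rightarrow> real ^ 'n \<Rightarrow> real ^ 'n \<Rightarrow> real ^ 'n \<Rightarrow> real ^ 'n" where
  "loc_Rm \<A> h c = Rm (lc_matrix (\<lambda>y. comps \<A> h c (param c y)))"

lemma bilin_atD:
  assumes "bilin_at \<A> h p" "X \<in> tangent_space \<A> p" "Z \<in> tangent_space \<A> p"
  shows "Y \<in> tangent_space \<A> p \<Longrightarrow> h p (tadd X Y) Z = h p X Z + h p Y Z"
    "h p (tscale r X) Z = r * h p X Z"
    "Y \<in> tangent_space \<A> p \<Longrightarrow> h p Z (tadd X Y) = h p Z X + h p Z Y"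
    "h p Z (tscale r X) = r * h p Z X"
  using assms unfolding bilin_at_def by blast+

lemma coord_vec_mk_tvec: "coord_vec \<A> c p i = mk_tvec \<A> c p (axis i 1)"
  by (simp add: coord_vec_def mk_tvec_def)

lemma transition_deriv_dd: "transition_deriv c c' p v = dd v (trans_map c c') (coord c p)"
  by (simp add: transition_deriv_def dd_def trans_map_def[abs_def])

locale smooth_manifold =
  fixes \<A> :: "('m::{t2_space, second_countable_topology}, 'n::finite) chart set"
  assumes smooth: "smooth_structure \<A>"
begin

lemma chart:
  assumes "c \<in> \<A>"
  shows "open (cdom c)" "open (coord c ` cdom c)"
    "homeomorphism (cdom c) (coord c ` cdom c) (coord c) (param c)"
  using smooth assms by (auto simp: smooth_structure_def is_chart_def)

lemma charts_atD: "c \<in> charts_at \<A> p \<Longrightarrow> c \<in> \<A>" "c \<in> charts_at \<A> p \<Longrightarrow> p \<in> cdom c"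
  by (auto simp: charts_at_def)

lemma charts_atI: "c \<in> \<A> \<Longrightarrow> p \<in> cdom c \<Longrightarrow> c \<in> charts_at \<A> p"
  by (auto simp: charts_at_def)

lemma charts_at_nonempty: obtains c where "c \<in> charts_at \<A> p"
  using smooth unfolding smooth_structure_def charts_at_def by blast

lemma param_coord [simp]: "c \<in> \<A> \<Longrightarrow> p \<in> cdom c \<Longrightarrow> param c (coord c p) = p"
  using homeomorphism_apply1[OF chart(3)] by blast

lemma cimg_iff: "c \<in> \<A> \<Longrightarrow> y \<in> cimg c W \<longleftrightarrow> y \<in> coord c ` cdom c \<and> param c y \<in> W"
  by (auto simp: cimg_def)

lemma cimgD:
  assumes "c \<in> \<A>" "y \<in> cimg c W"
  shows "param c y \<in> cdom c" "param c y \<in> W" "coord c (param c y) = y" "c \<in> charts_at \<A> (param c y)"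
  using assms by (auto simp: cimg_def charts_at_def)

lemma cimgI: "c \<in> charts_at \<A> p \<Longrightarrow> p \<in> W \<Longrightarrow> coord c p \<in> cimg c W"
  by (auto simp: cimg_def charts_at_def)

lemma open_cimg:
  assumes "c \<in> \<A>" "open W"
  shows "open (cimg c W)"
proof -
  have "cimg c W = coord c ` cdom c \<inter> param c -` W"
    using cimg_iff[OF assms(1)] by auto
  then show ?thesis
    using continuous_open_preimage[OF homeomorphism_cont2[OF chart(3)[OF assms(1)]] chart(2)[OF assms(1)] assms(2)]
    by simp
qed

lemma open_chart_preimage:
  assumes "c \<in> \<A>" "open V"
  shows "open (cdom c \<inter> coord c -` V)"
  by (rule continuous_open_preimage[OF homeomorphism_cont1[OF chart(3)[OF assms(1)]] chart(1)[OF assms(1)] assms(2)])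

lemma cimg_chart_preimage:
  assumes "c \<in> \<A>" "V \<subseteq> coord c ` cdom c"
  shows "cimg c (cdom c \<inter> coord c -` V) = V"
  using assms by (auto simp: cimg_def)

lemma trans_map_smooth: "c \<in> \<A> \<Longrightarrow> c' \<in> \<A> \<Longrightarrow> smooth_on (cimg c (cdom c')) (trans_map c c')"
  using smooth unfolding smooth_structure_def compatible_def cimg_def trans_map_def[abs_def] by blast

lemma trans_map_coord: "c \<in> \<A> \<Longrightarrow> p \<in> cdom c \<Longrightarrow> trans_map c c' (coord c p) = coord c' p"
  by (simp add: trans_map_def)

lemma trans_map_cimg: "c \<in> \<A> \<Longrightarrow> c' \<in> \<A> \<Longrightarrow> trans_map c c' ` cimg c (cdom c' \<inter> W) \<subseteq> cimg c' W"
  by (auto simp: cimg_def trans_map_def)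

lemma trans_map_differentiable:
  assumes "c \<in> charts_at \<A> p" "c' \<in> charts_at \<A> p"
  shows "trans_map c c' differentiable (at (coord c p))"
  using assms by (intro smooth_on_differentiable[OF trans_map_smooth] cimgI) (auto simp: charts_at_def)

lemma linear_transition_deriv:
  assumes "c \<in> charts_at \<A> p" "c' \<in> charts_at \<A> p"
  shows "linear (transition_deriv c c' p)"
  using linear_dd[OF trans_map_differentiable[OF assms]] by (simp add: transition_deriv_dd[abs_def])

lemma transition_deriv_self:
  assumes c: "c \<in> charts_at \<A> p"
  shows "transition_deriv c c p v = v"
proof -
  note cA = charts_atD(1)[OF c]
  have "dd v (trans_map c c) (coord c p) = dd v (\<lambda>y. y) (coord c p)"
    by (rule dd_cong_open[OF open_cimg[OF cA open_UNIV] cimgI[OF c UNIV_I]])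
      (simp add: trans_map_def cimgD[OF cA])
  also have "\<dots> = v" by (rule dd_eq[OF has_derivative_ident])
  finally show ?thesis by (simp add: transition_deriv_dd)
qed

lemma transition_deriv_cocycle:
  assumes c: "c \<in> charts_at \<A> p" "c' \<in> charts_at \<A> p" "c'' \<in> charts_at \<A> p"
  shows "transition_deriv c' c'' p (transition_deriv c c' p v) = transition_deriv c c'' p v"
proof -
  note cA = charts_atD(1)[OF c(1)] charts_atD(1)[OF c(2)] charts_atD(1)[OF c(3)]
  note pd = charts_atD(2)[OF c(1)] charts_atD(2)[OF c(2)] charts_atD(2)[OF c(3)]
  have "dd v (trans_map c c'') (coord c p) = dd v (\<lambda>y. trans_map c' c'' (trans_map c c' y)) (coord c p)"
  proof (rule dd_cong_open[OF open_cimg[OF cA(1) chart(1)[OF cA(2)]] cimgI[OF c(1) pd(2)]])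
    fix y assume "y \<in> cimg c (cdom c')"
    then show "trans_map c c'' y = trans_map c' c'' (trans_map c c' y)"
      using cimgD[OF cA(1)] cA by (simp add: trans_map_def)
  qed
  also have "\<dots> = dd (dd v (trans_map c c') (coord c p)) (trans_map c' c'') (trans_map c c' (coord c p))"
    using trans_map_differentiable[OF c(2,3)]
    by (intro dd_compose trans_map_differentiable[OF c(1,2)]) (simp add: trans_map_coord[OF cA(1) pd(1)])
  finally show ?thesis by (simp add: transition_deriv_dd trans_map_coord[OF cA(1) pd(1)])
qed

lemma transition_deriv_inverse:
  assumes "c \<in> charts_at \<A> p" "c' \<in> charts_at \<A> p"
  shows "transition_deriv c' c p (transition_deriv c c' p v) = v"
  using transition_deriv_cocycle[OF assms assms(1)] transition_deriv_self[OF assms(1)] by simp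

lemma mk_tvec_tangent [simp]: "c \<in> charts_at \<A> p \<Longrightarrow> mk_tvec \<A> c p v \<in> tangent_space \<A> p"
  using transition_deriv_cocycle by (simp add: tangent_space_def mk_tvec_def)

lemma coord_vec_tangent [simp]: "c \<in> charts_at \<A> p \<Longrightarrow> coord_vec \<A> c p i \<in> tangent_space \<A> p"
  by (simp add: coord_vec_mk_tvec)

lemma mk_tvec_self [simp]: "c \<in> charts_at \<A> p \<Longrightarrow> mk_tvec \<A> c p v c = v"
  by (simp add: mk_tvec_def transition_deriv_self)

lemma coord_vec_self [simp]: "c \<in> charts_at \<A> p \<Longrightarrow> coord_vec \<A> c p i c = axis i 1"
  by (simp add: coord_vec_mk_tvec)

lemma mk_tvec_apply:
  "c \<in> charts_at \<A> p \<Longrightarrow> c' \<in> charts_at \<A> p \<Longrightarrow> mk_tvec \<A> c p v c' = transition_deriv c c' p v"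
  by (simp add: mk_tvec_def)

lemma tangent_transition:
  assumes "X \<in> tangent_space \<A> p" "c \<in> charts_at \<A> p" "c' \<in> charts_at \<A> p"
  shows "X c' = transition_deriv c c' p (X c)"
  using assms unfolding tangent_space_def by blast

lemma tangent_mk_tvec:
  assumes "X \<in> tangent_space \<A> p" "c \<in> charts_at \<A> p"
  shows "X = mk_tvec \<A> c p (X c)"
proof
  fix c'
  show "X c' = mk_tvec \<A> c p (X c) c'"
  proof (cases "c' \<in> charts_at \<A> p")
    case True
    then show ?thesis using tangent_transition[OF assms True] by (simp only: mk_tvec_def if_True)
  next
    case False
    then have "X c' = 0" using assms(1) unfolding tangent_space_def by blast
    then show ?thesis using False by (simp only: mk_tvec_def if_False)
  qed
qed

lemma tangent_eqI:
  assumes "X \<in> tangent_space \<A> p" "Y \<in> tangent_space \<A> p" "c \<in> charts_at \<A> p" "X c = Y c"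
  shows "X = Y"
  using tangent_mk_tvec[OF assms(1,3)] tangent_mk_tvec[OF assms(2,3)] assms(4) by simp

lemma mk_tvec_add: "c \<in> charts_at \<A> p \<Longrightarrow> mk_tvec \<A> c p (v + w) = tadd (mk_tvec \<A> c p v) (mk_tvec \<A> c p w)"
  using linear_add[OF linear_transition_deriv] by (auto simp: mk_tvec_def tadd_def fun_eq_iff)

lemma mk_tvec_scale: "c \<in> charts_at \<A> p \<Longrightarrow> mk_tvec \<A> c p (r *\<^sub>R v) = tscale r (mk_tvec \<A> c p v)"
  using linear_scale[OF linear_transition_deriv] by (auto simp: mk_tvec_def tscale_def fun_eq_iff)

lemma mk_tvec_zero: "c \<in> charts_at \<A> p \<Longrightarrow> mk_tvec \<A> c p 0 = (\<lambda>_. 0)"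
  using linear_0[OF linear_transition_deriv] by (auto simp: mk_tvec_def fun_eq_iff)

lemma tangent_zero [simp]: "(\<lambda>_. 0) \<in> tangent_space \<A> p"
  using charts_at_nonempty[of p] mk_tvec_tangent mk_tvec_zero by metis

lemma tangent_tadd [simp]:
  assumes "X \<in> tangent_space \<A> p" "Y \<in> tangent_space \<A> p"
  shows "tadd X Y \<in> tangent_space \<A> p"
proof -
  obtain c where c: "c \<in> charts_at \<A> p" by (rule charts_at_nonempty)
  have "tadd X Y = mk_tvec \<A> c p (X c + Y c)"
    unfolding mk_tvec_add[OF c] tangent_mk_tvec[OF assms(1) c, symmetric] tangent_mk_tvec[OF assms(2) c, symmetric] ..
  then show ?thesis using mk_tvec_tangent[OF c] by simp
qed

lemma tangent_tscale [simp]: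
  assumes "X \<in> tangent_space \<A> p"
  shows "tscale r X \<in> tangent_space \<A> p"
proof -
  obtain c where c: "c \<in> charts_at \<A> p" by (rule charts_at_nonempty)
  have "tscale r X = mk_tvec \<A> c p (r *\<^sub>R X c)"
    unfolding mk_tvec_scale[OF c] tangent_mk_tvec[OF assms(1) c, symmetric] ..
  then show ?thesis using mk_tvec_tangent[OF c] by simp
qed

lemma comps_eval:
  assumes h: "bilin_at \<A> h p" and c: "c \<in> charts_at \<A> p"
    and X: "X \<in> tangent_space \<A> p" and Y: "Y \<in> tangent_space \<A> p"
  shows "h p X Y = mform (comps \<A> h c p) (X c) (Y c)"
proof -
  define B where "B x y = h p (mk_tvec \<A> c p x) (mk_tvec \<A> c p y)" for x y
  have "bilinear B"
    unfolding bilinear_def B_def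
    using mk_tvec_tangent[OF c]
    by (auto intro!: linearI simp: mk_tvec_add[OF c] mk_tvec_scale[OF c] bilin_atD[OF h])
  from bilinear_mform_eq[OF this, of "X c" "Y c"] show ?thesis
    using tangent_mk_tvec[OF X c] tangent_mk_tvec[OF Y c]
    by (simp add: B_def comps_def coord_vec_mk_tvec)
qed

lemma bilin_at_zero: "bilin_at \<A> h p \<Longrightarrow> X \<in> tangent_space \<A> p \<Longrightarrow> h p (\<lambda>_. 0) X = 0"
proof -
  assume h: "bilin_at \<A> h p" and X: "X \<in> tangent_space \<A> p"
  obtain c where c: "c \<in> charts_at \<A> p" by (rule charts_at_nonempty)
  show ?thesis
    using comps_eval[OF h c tangent_zero X] bilinear_lzero[OF bilinear_mform] by simp
qed

lemma comps_transition:
  assumes h: "bilin_at \<A> h p" and c: "c \<in> charts_at \<A> p" "c' \<in> charts_at \<A> p"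
  shows "mform (comps \<A> h c p) x y
    = mform (comps \<A> h c' p) (transition_deriv c c' p x) (transition_deriv c c' p y)"
  using comps_eval[OF h c(1) mk_tvec_tangent[OF c(1)] mk_tvec_tangent[OF c(1)], of x y]
    comps_eval[OF h c(2) mk_tvec_tangent[OF c(1)] mk_tvec_tangent[OF c(1)], of x y] c
  by (simp add: mk_tvec_apply)

lemma chart_invariant_eq:
  assumes "c \<in> charts_at \<A> p" "\<And>c'. c' \<in> charts_at \<A> p \<Longrightarrow> F c' = F c"
  shows "chart_invariant \<A> p F = F c"
  unfolding chart_invariant_def
proof (rule the_equality)
  show "\<forall>c'\<in>charts_at \<A> p. F c' = F c" using assms(2) by blast
  show "r = F c" if "\<forall>c'\<in>charts_at \<A> p. F c' = r" for r
    using bspec[OF that assms(1)] by (rule sym)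
qed

text \<open>The definition quantifies over all charts. One chart about each point suffices, because
  transition maps are smooth.\<close>

lemma smooth_map_on_local:
  assumes f: "\<And>p. p \<in> W \<Longrightarrow>
    \<exists>c\<in>charts_at \<A> p. \<exists>V. open V \<and> coord c p \<in> V \<and> V \<subseteq> coord c ` cdom c \<and> smooth_on V (\<lambda>y. f (param c y))"
  shows "smooth_map_on \<A> W (f :: 'm \<Rightarrow> 'b::euclidean_space)"
  unfolding smooth_map_on_def
proof (intro ballI smooth_on_local)
  fix c' y assume c': "c' \<in> \<A>" and "y \<in> coord c' ` (cdom c' \<inter> W)"
  then have y: "y \<in> cimg c' W" by (simp add: cimg_def)
  define p where "p = param c' y"
  note p = cimgD[OF c' y, folded p_def]
  obtain c V where c: "c \<in> charts_at \<A> p" and V: "open V" "coord c p \<in> V" "V \<subseteq> coord c ` cdom c"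
    and s: "smooth_on V (\<lambda>y. f (param c y))" using f[OF p(2)] by blast
  note cA = charts_atD(1)[OF c]
  define O' where "O' = cimg c' (cdom c \<inter> coord c -` V)"
  have O': "open O'" unfolding O'_def by (intro open_cimg c' open_chart_preimage cA V)
  have sub: "O' \<subseteq> cimg c' (cdom c)" by (auto simp: O'_def cimg_def)
  have im: "trans_map c' c ` O' \<subseteq> V"
    using c' by (auto simp: O'_def cimg_def trans_map_def)
  have "smooth_on O' (\<lambda>z. f (param c (trans_map c' c z)))"
    by (rule smooth_on_compose[OF O' V(1) im smooth_on_subset[OF trans_map_smooth[OF c' cA] sub] s])
  then have "smooth_on O' (\<lambda>z. f (param c' z))"
  proof (rule smooth_on_transfer[OF _ O'])
    fix z assume "z \<in> O'"
    then show "f (param c' z) = f (param c (trans_map c' c z))"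
      using sub cimgD[OF c', of z "cdom c"] cA by (auto simp: trans_map_def)
  qed
  moreover have "y \<in> O'"
    using cimgI[OF p(4), of "cdom c \<inter> coord c -` V"] charts_atD(2)[OF c] V(2) p(3) by (simp add: O'_def)
  ultimately show "\<exists>T. open T \<and> y \<in> T \<and> smooth_on T (\<lambda>y. f (param c' y))" using O' by blast
qed

section \<open>Riemannian metrics in charts\<close>

lemma riemannian_bilin_at:
  assumes h: "riemannian_metric_on \<A> W h" and p: "p \<in> W"
  shows "bilin_at \<A> h p"
proof -
  have s: "h p X Y = h p Y X" and a: "h p (tadd X Y) Z = h p X Z + h p Y Z" and m: "h p (tscale r X) Z = r * h p X Z"
    if "X \<in> tangent_space \<A> p" "Y \<in> tangent_space \<A> p" "Z \<in> tangent_space \<A> p" for X Y Z r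
    using h p that unfolding riemannian_metric_on_def by blast+
  show ?thesis
    unfolding bilin_at_def
  proof (intro ballI allI conjI)
    fix X Y Z r assume t: "X \<in> tangent_space \<A> p" "Y \<in> tangent_space \<A> p" "Z \<in> tangent_space \<A> p"
    show "h p (tadd X Y) Z = h p X Z + h p Y Z" by (rule a[OF t])
    show "h p (tscale r X) Z = r * h p X Z" by (rule m[OF t])
    show "h p Z (tadd X Y) = h p Z X + h p Z Y"
      using s[OF t(3) tangent_tadd[OF t(1,2)] t(1)] a[OF t] s[OF t(3,1,2)] s[OF t(3,2,1)] by simp
    show "h p Z (tscale r X) = r * h p Z X"
      using s[OF t(3) tangent_tscale[OF t(1)] t(1)] m[OF t] s[OF t(3,1,2)] by simp
  qed
qed

lemma riemannian_eval:
  assumes h: "riemannian_metric_on \<A> W h" and p: "p \<in> W" and c: "c \<in> charts_at \<A> p"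
    and X: "X \<in> tangent_space \<A> p" "Y \<in> tangent_space \<A> p"
  shows "h p X Y = loc_form \<A> h c (coord c p) (X c) (Y c)"
  using comps_eval[OF riemannian_bilin_at[OF h p] c X] charts_atD[OF c] by (simp add: loc_form_def)

lemma riemannian_metric_field:
  assumes h: "riemannian_metric_on \<A> W h" and c: "c \<in> \<A>"
  shows "metric_field (cimg c W) (loc_form \<A> h c)"
  unfolding metric_field_def
proof (intro conjI ballI allI impI)
  have W: "open W" using h by (simp add: riemannian_metric_on_def)
  show U: "open (cimg c W)" by (rule open_cimg[OF c W])
  have "smooth_map_on \<A> (cdom c \<inter> W) (comps \<A> h c)"
    using h c by (simp add: riemannian_metric_on_def)
  then have "smooth_on (cimg c W) (\<lambda>y. comps \<A> h c (param c y))"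
    using c by (auto simp: smooth_map_on_def cimg_def)
  then show "smooth_bil (cimg c W) (loc_form \<A> h c)"
    unfolding loc_form_def[abs_def] by (rule smooth_bil_mform[OF U])
  fix y assume "y \<in> cimg c W"
  note y = cimgD[OF c this]
  have ev: "loc_form \<A> h c y u v = h (param c y) (mk_tvec \<A> c (param c y) u) (mk_tvec \<A> c (param c y) v)" for u v
    using riemannian_eval[OF h y(2) y(4) mk_tvec_tangent[OF y(4)] mk_tvec_tangent[OF y(4)], of u v] y by simp
  note t = mk_tvec_tangent[OF y(4)]
  show "loc_form \<A> h c y u v = loc_form \<A> h c y v u" for u v
    unfolding ev using h y(2) t unfolding riemannian_metric_on_def by blast
  show "0 < loc_form \<A> h c y u u" if "u \<noteq> 0" for u
  proof -
    have "mk_tvec \<A> c (param c y) u \<noteq> (\<lambda>_. 0)"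
      using mk_tvec_self[OF y(4), of u] that by metis
    then show ?thesis
      unfolding ev using h y(2) t[of u] unfolding riemannian_metric_on_def by blast
  qed
qed

text \<open>Reduces a global claim to one chart about each point. In any other chart the components
  arise by inserting the smooth derivatives of a transition map into the local metric.\<close>

lemma riemannian_metric_onI:
  assumes W: "open W" and b: "\<And>p. p \<in> W \<Longrightarrow> bilin_at \<A> h p"
    and loc: "\<And>p. p \<in> W \<Longrightarrow> \<exists>c\<in>charts_at \<A> p. \<exists>V g. metric_field V g \<and> coord c p \<in> V \<and> V \<subseteq> cimg c W \<and>
       (\<forall>y\<in>V. \<forall>u v. loc_form \<A> h c y u v = g y u v)"
  shows "riemannian_metric_on \<A> W h"
  unfolding riemannian_metric_on_def
proof (intro conjI ballI allI impI)
  show "open W" by (rule W)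
  fix p X assume p: "p \<in> W" and X: "X \<in> tangent_space \<A> p"
  obtain c V g where c: "c \<in> charts_at \<A> p" and g: "metric_field V g" "coord c p \<in> V"
    "\<And>y u v. y \<in> V \<Longrightarrow> loc_form \<A> h c y u v = g y u v" using loc[OF p] by blast
  note ev = comps_eval[OF b[OF p] c X]
  have lf: "mform (comps \<A> h c p) u v = g (coord c p) u v" for u v
    using g(3)[OF g(2)] charts_atD[OF c] by (simp add: loc_form_def)
  show "h p X Y = h p Y X" if "Y \<in> tangent_space \<A> p" for Y
    using ev[OF that] comps_eval[OF b[OF p] c that X] metric_fieldD(4)[OF g(1,2)] lf by simp
  show "0 < h p X X" if "X \<noteq> (\<lambda>c. 0)"
  proof -
    have "X c \<noteq> 0" using tangent_eqI[OF X tangent_zero c] that by auto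
    then show ?thesis using ev[OF X] metric_fieldD(5)[OF g(1,2)] lf by simp
  qed
next
  fix p X Y Z r assume "p \<in> W" "X \<in> tangent_space \<A> p" "Y \<in> tangent_space \<A> p" "Z \<in> tangent_space \<A> p"
  with b[of p] show "h p (tadd X Y) Z = h p X Z + h p Y Z" "h p (tscale r X) Z = r * h p X Z"
    by (auto simp: bilin_at_def)
next
  fix c' assume c': "c' \<in> \<A>"
  show "smooth_map_on \<A> (cdom c' \<inter> W) (comps \<A> h c')"
  proof (rule smooth_map_on_local)
    fix p assume "p \<in> cdom c' \<inter> W"
    then have p: "p \<in> cdom c'" "p \<in> W" by auto
    have c'p: "c' \<in> charts_at \<A> p" by (rule charts_atI[OF c' p(1)])
    obtain c V g where c: "c \<in> charts_at \<A> p" and g: "metric_field V g" "coord c p \<in> V" "V \<subseteq> cimg c W"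
      "\<And>y u v. y \<in> V \<Longrightarrow> loc_form \<A> h c y u v = g y u v" using loc[OF p(2)] by blast
    note cA = charts_atD(1)[OF c]
    define V' where "V' = cimg c' (cdom c \<inter> coord c -` V)"
    have V': "open V'" unfolding V'_def by (intro open_cimg c' open_chart_preimage cA metric_fieldD(1)[OF g(1)])
    have pV': "coord c' p \<in> V'"
      unfolding V'_def using g(2) charts_atD(2)[OF c] by (intro cimgI c'p) auto
    have sub: "V' \<subseteq> cimg c' (cdom c)" "V' \<subseteq> coord c' ` cdom c'" by (auto simp: V'_def cimg_def)
    have im: "trans_map c' c ` V' \<subseteq> V" using c' by (auto simp: V'_def cimg_def trans_map_def)
    note tm = smooth_on_subset[OF trans_map_smooth[OF c' cA] sub(1)]
    have b2: "smooth_bil V' (\<lambda>z. g (trans_map c' c z))"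
      using metric_fieldD(3)[OF g(1)] im smooth_on_compose[OF V' metric_fieldD(1)[OF g(1)] im tm smooth_bil_on[OF metric_fieldD(2)[OF g(1)]]]
      by (auto simp: smooth_bil_def)
    have "smooth_on V' (\<lambda>z. comps \<A> h c' (param c' z) $ i $ j)" for i j
    proof (rule smooth_on_transfer[OF smooth_bil_smooth[OF V' b2 smooth_on_dd[OF tm] smooth_on_dd[OF tm]] V'])
      fix z assume z: "z \<in> V'"
      define q where "q = param c' z"
      have zi: "z \<in> cimg c' (cdom c)" using z sub by blast
      note q = cimgD[OF c' zi, folded q_def]
      have cq: "c \<in> charts_at \<A> q" by (rule charts_atI[OF cA q(2)])
      have tz: "trans_map c' c z = coord c q" by (simp add: trans_map_def q_def)
      have "coord c q \<in> V" using im z tz by force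
      moreover have "q \<in> W" using calculation g(3) cimgD(2)[OF cA, of "coord c q" W] cA q(2) by auto
      ultimately have "comps \<A> h c' q $ i $ j
          = g (coord c q) (transition_deriv c' c q (axis i 1)) (transition_deriv c' c q (axis j 1))"
        using comps_transition[OF b q(4) cq, of "axis i 1" "axis j 1"] g(4)[of "coord c q"] cA q(2)
        by (simp add: mform_axis loc_form_def)
      then show "comps \<A> h c' (param c' z) $ i $ j
          = g (trans_map c' c z) (dd (axis i 1) (trans_map c' c) z) (dd (axis j 1) (trans_map c' c) z)"
        unfolding transition_deriv_dd tz q(3) q_def[symmetric] .
    qed
    then have "smooth_on V' (\<lambda>z. comps \<A> h c' (param c' z))"
      by (simp add: smooth_on_vec_iff[OF V', where 'b = "real ^ 'n"] smooth_on_vec_iff[OF V', where 'b = real])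
    then show "\<exists>c\<in>charts_at \<A> p. \<exists>V. open V \<and> coord c p \<in> V \<and> V \<subseteq> coord c ` cdom c \<and> smooth_on V (\<lambda>y. comps \<A> h c' (param c y))"
      using V' pV' sub c'p by blast
  qed
qed

section \<open>Curvature, Ricci and Schouten tensors in charts\<close>

lemma curvature_loc_Rm:
  assumes h: "riemannian_metric_on \<A> W h" and p: "p \<in> W" and c: "c \<in> charts_at \<A> p"
  shows "curvature \<A> h p X Y Z c = loc_Rm \<A> h c (coord c p) (X c) (Y c) (Z c)"
proof -
  have "metric_field (cimg c W) (\<lambda>y. mform (comps \<A> h c (param c y)))"
    using riemannian_metric_field[OF h charts_atD(1)[OF c]] by (simp add: loc_form_def[abs_def])
  from riemann_comp_sum[OF this cimgI[OF c p]] show ?thesis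
    using c by (simp add: curvature_def loc_Rm_def)
qed

lemma loc_levi_civita:
  assumes h: "riemannian_metric_on \<A> W h" and c: "c \<in> \<A>"
  shows "levi_civita (cimg c W) (loc_form \<A> h c) (lc_matrix (\<lambda>y. comps \<A> h c (param c y)))"
  using lc_matrix_levi_civita[of "cimg c W" "\<lambda>y. comps \<A> h c (param c y)"] riemannian_metric_field[OF h c]
  by (simp add: loc_form_def[abs_def])

lemma loc_Rm_linear:
  assumes h: "riemannian_metric_on \<A> W h" and p: "p \<in> W" and c: "c \<in> charts_at \<A> p"
  shows "linear (\<lambda>x. loc_Rm \<A> h c (coord c p) x y z)" "linear (\<lambda>y. loc_Rm \<A> h c (coord c p) x y z)"
    "linear (\<lambda>z. loc_Rm \<A> h c (coord c p) x y z)"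
  unfolding loc_Rm_def
  by (rule Rm_linear[OF metric_fieldD(1)[OF riemannian_metric_field[OF h charts_atD(1)[OF c]]] cimgI[OF c p]
        levi_civitaD(1)[OF loc_levi_civita[OF h charts_atD(1)[OF c]]]])+

text \<open>A transition map is an isometry between the two coordinate expressions of the metric, so
  this is an instance of \<open>isometry_Rm\<close>.\<close>

lemma loc_Rm_transition:
  assumes h: "riemannian_metric_on \<A> W h" and p: "p \<in> W" and c: "c \<in> charts_at \<A> p" "c' \<in> charts_at \<A> p"
  defines "J \<equiv> transition_deriv c c' p"
  shows "J (loc_Rm \<A> h c (coord c p) x y z) = loc_Rm \<A> h c' (coord c' p) (J x) (J y) (J z)"
proof -
  note cA = charts_atD(1)[OF c(1)] charts_atD(1)[OF c(2)]
  define U where "U = cimg c (cdom c' \<inter> W)"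
  have W: "open W" using h by (simp add: riemannian_metric_on_def)
  have U: "open U" unfolding U_def by (intro open_cimg cA open_Int chart(1) W)
  have UW: "U \<subseteq> cimg c W" "U \<subseteq> cimg c (cdom c')" by (auto simp: U_def cimg_def)
  have pU: "coord c p \<in> U" unfolding U_def using charts_atD(2)[OF c(2)] p by (intro cimgI c) auto
  have iso: "loc_form \<A> h c y u v = loc_form \<A> h c' (trans_map c c' y) (dd u (trans_map c c') y) (dd v (trans_map c c') y)"
    if y: "y \<in> U" for y u v
  proof -
    note q = cimgD[OF cA(1) y[unfolded U_def]]
    have "c' \<in> charts_at \<A> (param c y)" using q cA by (intro charts_atI) auto
    from comps_transition[OF riemannian_bilin_at[OF h] q(4) this, of u v] q cA show ?thesis
      by (simp add: loc_form_def transition_deriv_dd trans_map_def[of c c' y])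
  qed
  have "dd (loc_Rm \<A> h c (coord c p) x y z) (trans_map c c') (coord c p)
     = loc_Rm \<A> h c' (trans_map c c' (coord c p)) (dd x (trans_map c c') (coord c p))
        (dd y (trans_map c c') (coord c p)) (dd z (trans_map c c') (coord c p))"
    unfolding loc_Rm_def
    by (rule isometry_Rm[OF metric_field_subset[OF riemannian_metric_field[OF h cA(1)] U UW(1)]
          levi_civita_subset[OF loc_levi_civita[OF h cA(1)] UW(1)] riemannian_metric_field[OF h cA(2)]
          loc_levi_civita[OF h cA(2)] smooth_on_subset[OF trans_map_smooth[OF cA] UW(2)]
          trans_map_cimg[OF cA, of W, folded U_def] iso pU])
  then show ?thesis
    by (simp add: J_def transition_deriv_dd trans_map_coord[OF cA(1) charts_atD(2)[OF c(1)]])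
qed

lemma curvature_tangent:
  assumes h: "riemannian_metric_on \<A> W h" and p: "p \<in> W"
    and X: "X \<in> tangent_space \<A> p" "Y \<in> tangent_space \<A> p" "Z \<in> tangent_space \<A> p"
  shows "curvature \<A> h p X Y Z \<in> tangent_space \<A> p"
proof -
  obtain c where c: "c \<in> charts_at \<A> p" by (rule charts_at_nonempty)
  have "curvature \<A> h p X Y Z = mk_tvec \<A> c p (curvature \<A> h p X Y Z c)"
  proof
    fix c'
    show "curvature \<A> h p X Y Z c' = mk_tvec \<A> c p (curvature \<A> h p X Y Z c) c'"
    proof (cases "c' \<in> charts_at \<A> p")
      case True
      show ?thesis
        unfolding mk_tvec_apply[OF c True] curvature_loc_Rm[OF h p c] curvature_loc_Rm[OF h p True]
          loc_Rm_transition[OF h p c True]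
        using tangent_transition[OF X(1) c True] tangent_transition[OF X(2) c True] tangent_transition[OF X(3) c True]
        by simp
    qed (simp add: curvature_def mk_tvec_def)
  qed
  then show ?thesis using mk_tvec_tangent[OF c] by metis
qed

text \<open>\<open>chart_invariant\<close> is a definite description and yields a value only once
  independence of the chart is known. Here it follows because a change of chart conjugates the
  endomorphism under the trace.\<close>

lemma ricci_eq:
  assumes h: "riemannian_metric_on \<A> W h" and p: "p \<in> W" and c: "c \<in> charts_at \<A> p"
    and X: "Y \<in> tangent_space \<A> p" "Z \<in> tangent_space \<A> p"
  shows "ricci \<A> h p Y Z = ltrace (\<lambda>x. loc_Rm \<A> h c (coord c p) x (Y c) (Z c))"
proof -
  define F where "F c = (\<Sum>i\<in>UNIV. curvature \<A> h p (coord_vec \<A> c p i) Y Z c $ i)" for c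
  have F: "F c = ltrace (\<lambda>x. loc_Rm \<A> h c (coord c p) x (Y c) (Z c))" if "c \<in> charts_at \<A> p" for c
    using that by (simp add: F_def ltrace_def curvature_loc_Rm[OF h p that])
  have inv: "F c' = F c" if c': "c' \<in> charts_at \<A> p" for c'
  proof -
    let ?J = "transition_deriv c c' p" and ?J' = "transition_deriv c' c p"
    have "F c' = ltrace (\<lambda>x. ?J (loc_Rm \<A> h c (coord c p) (?J' x) (Y c) (Z c)))"
      unfolding F[OF c'] loc_Rm_transition[OF h p c c'] transition_deriv_inverse[OF c' c]
      using tangent_transition[OF X(1) c c'] tangent_transition[OF X(2) c c'] by simp
    also have "\<dots> = F c"
      unfolding F[OF c]
      by (rule ltrace_conj[OF linear_transition_deriv[OF c c'] loc_Rm_linear(1)[OF h p c] linear_transition_deriv[OF c' c]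
          transition_deriv_inverse[OF c c']])
    finally show ?thesis .
  qed
  have "ricci \<A> h p Y Z = chart_invariant \<A> p F" by (simp add: ricci_def F_def[abs_def])
  also have "\<dots> = F c" by (rule chart_invariant_eq[where F = F, OF c inv])
  finally show ?thesis unfolding F[OF c] .
qed

text \<open>Tracing the curvature gives the Ricci endomorphism \<open>(n - 2) S + tr S\<close>, with
  trace \<open>2 (n - 1) tr S\<close>; the formula for the Schouten tensor then returns
  \<open>S\<close>. It is applied to the given metric with \<open>S\<close> and to the dual metric
  with \<open>T\<close>.\<close>

lemma schouten_kn:
  assumes n: "CARD('n) \<ge> 3" and h: "riemannian_metric_on \<A> W h" and p: "p \<in> W" and c: "c \<in> charts_at \<A> p"
    and S: "linear S" "\<And>x y. loc_form \<A> h c (coord c p) (S x) y = loc_form \<A> h c (coord c p) x (S y)"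
    and R: "\<And>x y z. loc_Rm \<A> h c (coord c p) x y z = kn (loc_form \<A> h c (coord c p)) S x y z"
    and X: "X \<in> tangent_space \<A> p" "Y \<in> tangent_space \<A> p"
  shows "schouten \<A> h p X Y = loc_form \<A> h c (coord c p) (S (X c)) (Y c)"
proof -
  define k where "k = loc_form \<A> h c (coord c p)"
  define L where "L x = (real CARD('n) - 2) *\<^sub>R S x + ltrace S *\<^sub>R x" for x
  note mf = riemannian_metric_field[OF h charts_atD(1)[OF c]]
  note k = metric_fieldD(3-5)[OF mf cimgI[OF c p], folded k_def]
  have ric: "ricci \<A> h p Y Z = k (L (Y c)) (Z c)" if "Y \<in> tangent_space \<A> p" "Z \<in> tangent_space \<A> p" for Y Z
    unfolding ricci_eq[OF h p c that] R k_def[symmetric] ltrace_kn[OF k(1) S(1) S(2)[folded k_def]] L_def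
    by (simp add: bilinear_simps[OF k(1)])
  have L: "linear L" unfolding L_def by (rule linearI) (simp_all add: linear_map_simps[OF S(1)] algebra_simps)
  have trL: "ltrace L = 2 * (real CARD('n) - 1) * ltrace S"
    unfolding L_def ltrace_add ltrace_scale ltrace_id by (simp add: algebra_simps)
  define F where "F c = (\<Sum>i\<in>UNIV. \<Sum>j\<in>UNIV. matrix_inv (comps \<A> h c p) $ i $ j * comps \<A> (ricci \<A> h) c p $ i $ j)" for c
  have F: "F c' = ltrace L" if c': "c' \<in> charts_at \<A> p" for c'
  proof -
    let ?J = "transition_deriv c c' p" and ?J' = "transition_deriv c' c p"
    note k' = metric_fieldD(3-5)[OF riemannian_metric_field[OF h charts_atD(1)[OF c']] cimgI[OF c' p]]
    have lf: "loc_form \<A> h c' (coord c' p) = mform (comps \<A> h c' p)" "k = mform (comps \<A> h c p)"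
      using charts_atD[OF c] charts_atD[OF c'] by (simp_all add: loc_form_def k_def)
    have M: "(\<chi> i j. mform (comps \<A> h c' p) (axis i 1) (axis j 1)) = comps \<A> h c' p"
      by (simp add: mform_axis vec_eq_iff)
    have "comps \<A> (ricci \<A> h) c' p $ i $ j = mform (comps \<A> h c' p) (?J (L (?J' (axis i 1)))) (axis j 1)" for i j
    proof -
      have cv: "coord_vec \<A> c' p i c = ?J' (axis i 1)" for i
        using c c' by (simp add: coord_vec_mk_tvec mk_tvec_apply)
      have "comps \<A> (ricci \<A> h) c' p $ i $ j = k (L (?J' (axis i 1))) (?J' (axis j 1))"
        using ric[OF coord_vec_tangent[OF c'] coord_vec_tangent[OF c'], of i j] by (simp add: comps_def cv)
      also have "\<dots> = mform (comps \<A> h c' p) (?J (L (?J' (axis i 1)))) (?J (?J' (axis j 1)))"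
        unfolding lf by (rule comps_transition[OF riemannian_bilin_at[OF h p] c c'])
      finally show ?thesis by (simp add: transition_deriv_inverse[OF c' c])
    qed
    then have "F c' = ltrace (\<lambda>x. ?J (L (?J' x)))"
      using metric_contraction(2)[of "mform (comps \<A> h c' p)" "\<lambda>x. ?J (L (?J' x))", OF k'[unfolded lf]]
      unfolding M by (simp add: F_def)
    also have "\<dots> = ltrace L"
      by (rule ltrace_conj[OF linear_transition_deriv[OF c c'] L linear_transition_deriv[OF c' c]
          transition_deriv_inverse[OF c c']])
    finally show ?thesis .
  qed
  have "scalar_curvature \<A> h p = chart_invariant \<A> p F" by (simp add: scalar_curvature_def F_def[abs_def])
  also have "\<dots> = F c" by (rule chart_invariant_eq[OF c]) (simp add: F c)
  finally have "scalar_curvature \<A> h p = ltrace L" unfolding F[OF c] .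
  moreover have "real CARD('n) \<ge> 3" using n by simp
  moreover have "k (L (X c)) (Y c) = (real CARD('n) - 2) * k (S (X c)) (Y c) + ltrace S * k (X c) (Y c)"
    by (simp add: L_def bilinear_simps[OF k(1)])
  ultimately show ?thesis
    unfolding schouten_def ric[OF X] trL riemannian_eval[OF h p c X] k_def[symmetric]
    by (simp add: divide_simps)
qed

end

context smooth_manifold
begin

section \<open>Conformal flatness in charts\<close>

lemma comps_conformal: "comps \<A> (\<lambda>q X Y. f q * h q X Y) c q = f q *\<^sub>R comps \<A> h c q"
  by (simp add: comps_def vec_eq_iff)

lemma loc_form_conformal:
  "loc_form \<A> (\<lambda>q X Y. f q * h q X Y) c y u v = f (param c y) * loc_form \<A> h c y u v"
  by (simp add: loc_form_def comps_conformal mform_sum sum_distrib_left mult_ac)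

lemma riemannian_conformal:
  assumes h: "riemannian_metric_on \<A> W h" and U: "open U" "U \<subseteq> W" and \<sigma>: "smooth_map_on \<A> U \<sigma>"
  shows "riemannian_metric_on \<A> U (\<lambda>q X Y. exp (2 * \<sigma> q) * h q X Y)"
proof (rule riemannian_metric_onI[OF U(1)])
  fix p assume p: "p \<in> U"
  then have pW: "p \<in> W" using U by blast
  show "bilin_at \<A> (\<lambda>q X Y. exp (2 * \<sigma> q) * h q X Y) p"
    using riemannian_bilin_at[OF h pW] unfolding bilin_at_def by (simp add: algebra_simps)
  obtain c where c: "c \<in> charts_at \<A> p" by (rule charts_at_nonempty)
  note cA = charts_atD(1)[OF c]
  have sub: "cimg c U \<subseteq> cimg c W" using U(2) by (auto simp: cimg_def)
  have "smooth_on (cimg c U) (\<lambda>y. \<sigma> (param c y))"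
    using \<sigma> cA by (auto simp: smooth_map_on_def cimg_def)
  then have "metric_field (cimg c U) (\<lambda>y u v. exp (2 * \<sigma> (param c y)) * loc_form \<A> h c y u v)"
    by (rule metric_field_conformal[OF metric_field_subset[OF riemannian_metric_field[OF h cA] open_cimg[OF cA U(1)] sub]])
  then show "\<exists>c\<in>charts_at \<A> p. \<exists>V g. metric_field V g \<and> coord c p \<in> V \<and> V \<subseteq> cimg c U \<and>
      (\<forall>y\<in>V. \<forall>u v. loc_form \<A> (\<lambda>q X Y. exp (2 * \<sigma> q) * h q X Y) c y u v = g y u v)"
    using c cimgI[OF c p] by (auto simp: loc_form_conformal[of "\<lambda>q. exp (2 * \<sigma> q)"])
qed

text \<open>The hypothesis speaks of linearly independent pairs and of a quotient. Hence the Gram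
  determinant must be shown to be nonzero, and dependent pairs are treated by the antisymmetry of
  the curvature.\<close>

lemma loc_Rm_zero_of_sectional:
  assumes h: "riemannian_metric_on \<A> W h" and van: "vanishing_sectional_curvature_on \<A> W h"
    and c: "c \<in> \<A>" and y: "y \<in> cimg c W"
  shows "loc_Rm \<A> h c y u v w = 0"
proof (rule Rm_zero_of_sectional[OF riemannian_metric_field[OF h c] loc_levi_civita[OF h c] y, folded loc_Rm_def])
  fix u v
  define q where "q = param c y"
  note q = cimgD[OF c y, folded q_def]
  define X where "X = mk_tvec \<A> c q u"
  define Y where "Y = mk_tvec \<A> c q v"
  have t: "X \<in> tangent_space \<A> q" "Y \<in> tangent_space \<A> q" by (simp_all add: X_def Y_def q(4))
  have Xc: "X c = u" "Y c = v" by (simp_all add: X_def Y_def q(4))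
  define k where "k = loc_form \<A> h c y"
  note k = metric_fieldD(3-5)[OF riemannian_metric_field[OF h c] y, folded k_def]
  have comb: "tadd (tscale a X) (tscale b Y) = mk_tvec \<A> c q (a *\<^sub>R u + b *\<^sub>R v)" for a b
    by (simp add: X_def Y_def mk_tvec_add[OF q(4)] mk_tvec_scale[OF q(4)])
  note lin = loc_Rm_linear[OF h q(2) q(4), unfolded q(3)]
  have R0: "loc_Rm \<A> h c y x x z = 0" for x z
    using Rm_swap[of _ y x x z] unfolding loc_Rm_def by (metis eq_neg_iff_add_eq_0 scaleR_2 scaleR_eq_0_iff zero_neq_numeral)
  show "loc_form \<A> h c y (loc_Rm \<A> h c y u v v) u = 0"
  proof (cases "\<forall>a b. tadd (tscale a X) (tscale b Y) = (\<lambda>c. 0) \<longrightarrow> a = 0 \<and> b = 0")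
    case True
    have ind: "a = 0 \<and> b = 0" if "a *\<^sub>R u + b *\<^sub>R v = 0" for a b
      using True[rule_format, of a b] unfolding comb that mk_tvec_zero[OF q(4)] by blast
    have "k u u * k v v - (k u v)\<^sup>2 \<noteq> 0"
    proof
      assume 0: "k u u * k v v - (k u v)\<^sup>2 = 0"
      \<comment> \<open>\<open>k v v\<close> times the part of \<open>u\<close> orthogonal to
        \<open>v\<close>; its squared length is \<open>k v v\<close> times the Gram
        determinant.\<close>
      define z where "z = k v v *\<^sub>R u + (- k u v) *\<^sub>R v"
      have "k z z = k v v * (k u u * k v v - (k u v)\<^sup>2)"
        unfolding z_def by (simp add: bilinear_simps[OF k(1)] k(2)[of v u] algebra_simps power2_eq_square)
      then have "z = 0" using k(3)[of z] 0 by fastforce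
      then have "k v v = 0" using ind unfolding z_def by blast
      then have "v = 0" using k(3)[of v] by fastforce
      then show False using ind[of 0 1] by simp
    qed
    moreover have "sectional_curvature \<A> h q X Y = 0"
      using van q(2) t True unfolding vanishing_sectional_curvature_on_def by blast
    moreover have "h q Z Z' = k (Z c) (Z' c)" if "Z \<in> tangent_space \<A> q" "Z' \<in> tangent_space \<A> q" for Z Z'
      using riemannian_eval[OF h q(2,4) that] by (simp add: k_def q(3))
    moreover have "curvature \<A> h q X Y Y c = loc_Rm \<A> h c y u v v"
      using curvature_loc_Rm[OF h q(2,4), of X Y Y] by (simp add: Xc q(3))
    ultimately show ?thesis
      using t curvature_tangent[OF h q(2) t t(2)] by (simp add: sectional_curvature_def Xc k_def)
  next
    case False
    then obtain a b where ab: "mk_tvec \<A> c q (a *\<^sub>R u + b *\<^sub>R v) = (\<lambda>c. 0)" "a \<noteq> 0 \<or> b \<noteq> 0"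
      unfolding comb by blast
    have e: "a *\<^sub>R u + b *\<^sub>R v = 0" using fun_cong[OF ab(1), of c] by (simp add: q(4))
    \<comment> \<open>Either \<open>v\<close> is zero or \<open>u\<close> is a multiple of
      \<open>v\<close>, and the curvature with equal directions vanishes by
      \<open>R0\<close>.\<close>
    have "loc_Rm \<A> h c y u v v = 0"
    proof (cases "a = 0")
      case True
      then have "v = 0" using e ab(2) by simp
      then show ?thesis using linear_0[OF lin(3)] by simp
    next
      case False
      then have "u = (- b / a) *\<^sub>R v"
        using e by (metis (no_types) add.inverse_inverse add_eq_0_iff divide_inverse_commute scaleR_minus_left
          scaleR_one scaleR_scaleR left_inverse minus_divide_left scaleR_minus_right)
      then show ?thesis by (metis linear_scale[OF lin(1)] R0 scaleR_zero_right)
    qed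
    then show ?thesis using bilinear_lzero[OF k(1)] by (simp add: k_def)
  qed
qed

lemma conformally_flat_on_local:
  assumes h: "riemannian_metric_on \<A> W h" and cf: "conformally_flat_on \<A> W h"
    and p: "p \<in> W" and c: "c \<in> charts_at \<A> p"
  obtains V s \<Gamma>s where "open V" "coord c p \<in> V" "V \<subseteq> cimg c W" "smooth_on V s"
    "levi_civita V (\<lambda>y u v. exp (2 * s y) * loc_form \<A> h c y u v) \<Gamma>s"
    "\<And>y u v w. y \<in> V \<Longrightarrow> Rm \<Gamma>s y u v w = 0"
proof -
  note cA = charts_atD(1)[OF c]
  obtain U \<sigma> where U: "open U" "p \<in> U" "U \<subseteq> W" and \<sigma>: "smooth_map_on \<A> U \<sigma>"
    and van: "vanishing_sectional_curvature_on \<A> U (\<lambda>q X Y. exp (2 * \<sigma> q) * h q X Y)"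
    using cf p unfolding conformally_flat_on_def by blast
  note h2 = riemannian_conformal[OF h U(1,3) \<sigma>]
  show thesis
  proof (rule that)
    show "open (cimg c U)" by (rule open_cimg[OF cA U(1)])
    show "coord c p \<in> cimg c U" by (rule cimgI[OF c U(2)])
    show "cimg c U \<subseteq> cimg c W" using U(3) by (auto simp: cimg_def)
    show "smooth_on (cimg c U) (\<lambda>y. \<sigma> (param c y))"
      using \<sigma> cA by (auto simp: smooth_map_on_def cimg_def)
    show "levi_civita (cimg c U) (\<lambda>y u v. exp (2 * \<sigma> (param c y)) * loc_form \<A> h c y u v)
        (lc_matrix (\<lambda>y. comps \<A> (\<lambda>q X Y. exp (2 * \<sigma> q) * h q X Y) c (param c y)))"
      by (rule levi_civita_cong[OF loc_levi_civita[OF h2 cA] open_cimg[OF cA U(1)]])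
        (simp add: loc_form_conformal[of "\<lambda>q. exp (2 * \<sigma> q)"])
    show "Rm (lc_matrix (\<lambda>y. comps \<A> (\<lambda>q X Y. exp (2 * \<sigma> q) * h q X Y) c (param c y))) y u v w = 0"
      if "y \<in> cimg c U" for y u v w
      using loc_Rm_zero_of_sectional[OF h2 van cA that] by (simp add: loc_Rm_def)
  qed
qed

text \<open>The flat connection may be any Levi-Civita connection of the rescaled local form;
  uniqueness transfers its curvature to the Christoffel symbols. The sectional curvature then has
  numerator zero.\<close>

lemma conformally_flat_onI:
  assumes h: "riemannian_metric_on \<A> W h"
    and loc: "\<And>p. p \<in> W \<Longrightarrow> \<exists>c\<in>charts_at \<A> p. \<exists>V s \<Gamma>s. open V \<and> coord c p \<in> V \<and> V \<subseteq> cimg c W \<and>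
      smooth_on V s \<and> levi_civita V (\<lambda>y u v. exp (2 * s y) * loc_form \<A> h c y u v) \<Gamma>s \<and>
      (\<forall>y\<in>V. \<forall>u v w. Rm \<Gamma>s y u v w = 0)"
  shows "conformally_flat_on \<A> W h"
  unfolding conformally_flat_on_def
proof
  fix p assume "p \<in> W"
  from loc[OF this] obtain c V s \<Gamma>s where c: "c \<in> charts_at \<A> p" and V: "open V" "coord c p \<in> V" "V \<subseteq> cimg c W"
    and s: "smooth_on V s" and lcs: "levi_civita V (\<lambda>y u v. exp (2 * s y) * loc_form \<A> h c y u v) \<Gamma>s"
    and flat: "\<And>y u v w. y \<in> V \<Longrightarrow> Rm \<Gamma>s y u v w = 0" by blast
  note cA = charts_atD(1)[OF c]
  define U where "U = cdom c \<inter> coord c -` V"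
  define \<sigma> where "\<sigma> q = s (coord c q)" for q
  have Vc: "V \<subseteq> coord c ` cdom c" using V(3) by (auto simp: cimg_def)
  have U: "open U" unfolding U_def by (rule open_chart_preimage[OF cA V(1)])
  have pU: "p \<in> U" using charts_atD(2)[OF c] V(2) by (simp add: U_def)
  have UV: "cimg c U = V" unfolding U_def by (rule cimg_chart_preimage[OF cA Vc])
  have UW: "U \<subseteq> W"
  proof
    fix q assume "q \<in> U"
    then have "coord c q \<in> cimg c W" "q \<in> cdom c" using V(3) by (auto simp: U_def)
    then show "q \<in> W" using cimgD(2)[OF cA] cA by fastforce
  qed
  have \<sigma>: "smooth_map_on \<A> U \<sigma>"
  proof (rule smooth_map_on_local)
    fix q assume q: "q \<in> U"
    have "smooth_on V (\<lambda>y. \<sigma> (param c y))"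
      by (rule smooth_on_transfer[OF s V(1)]) (use Vc cA in \<open>auto simp: \<sigma>_def\<close>)
    then show "\<exists>c\<in>charts_at \<A> q. \<exists>V. open V \<and> coord c q \<in> V \<and> V \<subseteq> coord c ` cdom c \<and> smooth_on V (\<lambda>y. \<sigma> (param c y))"
      using V(1) Vc q charts_atI[OF cA, of q] by (auto simp: U_def)
  qed
  note h2 = riemannian_conformal[OF h U UW \<sigma>]
  have lf: "loc_form \<A> (\<lambda>q X Y. exp (2 * \<sigma> q) * h q X Y) c y u v = exp (2 * s y) * loc_form \<A> h c y u v"
    if "y \<in> V" for y u v
  proof -
    have "\<sigma> (param c y) = s y" using that Vc cA by (auto simp: \<sigma>_def)
    then show ?thesis by (simp add: loc_form_conformal[of "\<lambda>q. exp (2 * \<sigma> q)"])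
  qed
  have lc': "levi_civita V (loc_form \<A> (\<lambda>q X Y. exp (2 * \<sigma> q) * h q X Y) c) \<Gamma>s"
    by (rule levi_civita_cong[OF lcs V(1) lf])
  have "vanishing_sectional_curvature_on \<A> U (\<lambda>q X Y. exp (2 * \<sigma> q) * h q X Y)"
    unfolding vanishing_sectional_curvature_on_def
  proof (intro ballI impI)
    fix q X Y assume q: "q \<in> U" and t: "X \<in> tangent_space \<A> q" "Y \<in> tangent_space \<A> q"
    let ?h = "\<lambda>q X Y. exp (2 * \<sigma> q) * h q X Y"
    have cq: "c \<in> charts_at \<A> q" "coord c q \<in> V" using q charts_atI[OF cA] by (auto simp: U_def)
    have "loc_Rm \<A> ?h c (coord c q) u v w = 0" for u v w
      unfolding loc_Rm_def
      using levi_civita_Rm_unique[OF riemannian_metric_field[OF h2 cA] loc_levi_civita[OF h2 cA], unfolded UV, OF lc' cq(2)]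
        flat[OF cq(2)] by simp
    then have "curvature \<A> ?h q X Y Y c = 0" using curvature_loc_Rm[OF h2 q cq(1)] by simp
    then have "curvature \<A> ?h q X Y Y = (\<lambda>_. 0)"
      by (intro tangent_eqI[OF curvature_tangent[OF h2 q t t(2)] tangent_zero cq(1)])
    then show "sectional_curvature \<A> ?h q X Y = 0"
      using bilin_at_zero[OF riemannian_bilin_at[OF h2 q] t(1)] by (simp add: sectional_curvature_def)
  qed
  then show "\<exists>U \<sigma>. open U \<and> p \<in> U \<and> U \<subseteq> W \<and> smooth_map_on \<A> U \<sigma> \<and>
      vanishing_sectional_curvature_on \<A> U (\<lambda>q X Y. exp (2 * \<sigma> q) * h q X Y)"
    using U pU UW \<sigma> by blast
qed

section \<open>The dual metric\<close>

text \<open>In every chart \<open>c'\<close> the contraction equals the form evaluated on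
  \<open>S\<close> of the two vectors, read in the fixed chart \<open>c\<close>. So it does not
  depend on \<open>c'\<close>, and the same computation gives the component formula.\<close>

lemma dual_tensor_eq:
  assumes g: "riemannian_metric_on \<A> W g" and p: "p \<in> W" and c: "c \<in> charts_at \<A> p" and S: "linear S"
    and A: "\<And>X Y. X \<in> tangent_space \<A> p \<Longrightarrow> Y \<in> tangent_space \<A> p \<Longrightarrow>
      A p X Y = loc_form \<A> g c (coord c p) (S (X c)) (Y c)"
  shows "X \<in> tangent_space \<A> p \<Longrightarrow> Y \<in> tangent_space \<A> p \<Longrightarrow>
      dual_tensor \<A> g A p X Y = loc_form \<A> g c (coord c p) (S (X c)) (S (Y c))"
    and "c' \<in> charts_at \<A> p \<Longrightarrow> (\<Sum>a\<in>UNIV. \<Sum>b\<in>UNIV. comps \<A> A c' p $ i $ a * comps \<A> A c' p $ j $ b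
       * matrix_inv (comps \<A> g c' p) $ a $ b) = comps \<A> (dual_tensor \<A> g A) c' p $ i $ j"
proof -
  define k where "k c = mform (comps \<A> g c p)" for c
  have kl: "loc_form \<A> g c' (coord c' p) = k c'" if "c' \<in> charts_at \<A> p" for c'
    using charts_atD[OF that] by (simp add: loc_form_def k_def)
  have sum: "(\<Sum>a\<in>UNIV. \<Sum>b\<in>UNIV. comps \<A> A c' p $ i $ a * comps \<A> A c' p $ j $ b * matrix_inv (comps \<A> g c' p) $ a $ b)
      = k c (S (coord_vec \<A> c' p i c)) (S (coord_vec \<A> c' p j c))" if c': "c' \<in> charts_at \<A> p" for c' i j
  proof -
    let ?J = "transition_deriv c c' p" and ?J' = "transition_deriv c' c p"
    note k' = metric_fieldD(3-5)[OF riemannian_metric_field[OF g charts_atD(1)[OF c']] cimgI[OF c' p]]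
    have M: "(\<chi> i j. k c' (axis i 1) (axis j 1)) = comps \<A> g c' p"
      by (simp add: mform_axis vec_eq_iff k_def)
    have iso: "k c x y = k c' (?J x) (?J y)" for x y
      unfolding k_def by (rule comps_transition[OF riemannian_bilin_at[OF g p] c c'])
    have cv: "coord_vec \<A> c' p i c = ?J' (axis i 1)" for i
      using c c' by (simp add: coord_vec_mk_tvec mk_tvec_apply)
    have "comps \<A> A c' p $ i $ a = k c' (?J (S (coord_vec \<A> c' p i c))) (axis a 1)" for i a
      using A[OF coord_vec_tangent[OF c'] coord_vec_tangent[OF c'], of i a]
      unfolding kl[OF c] iso cv[of a] by (simp add: comps_def transition_deriv_inverse[OF c' c])
    then have "(\<Sum>a\<in>UNIV. \<Sum>b\<in>UNIV. comps \<A> A c' p $ i $ a * comps \<A> A c' p $ j $ b * matrix_inv (comps \<A> g c' p) $ a $ b)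
        = k c' (?J (S (coord_vec \<A> c' p i c))) (?J (S (coord_vec \<A> c' p j c)))"
      using metric_contraction(1)[of "k c'", OF k'[unfolded kl[OF c']]] unfolding M by simp
    then show ?thesis unfolding iso .
  qed
  show dual: "dual_tensor \<A> g A p X Y = loc_form \<A> g c (coord c p) (S (X c)) (S (Y c))"
    if t: "X \<in> tangent_space \<A> p" "Y \<in> tangent_space \<A> p" for X Y
  proof -
    define F where "F c = (\<Sum>i\<in>UNIV. \<Sum>j\<in>UNIV. \<Sum>a\<in>UNIV. \<Sum>b\<in>UNIV.
       comps \<A> A c p $ i $ a * comps \<A> A c p $ j $ b * matrix_inv (comps \<A> g c p) $ a $ b
         * X c $ i * Y c $ j)" for c
    have F: "F c' = k c (S (X c)) (S (Y c))" if c': "c' \<in> charts_at \<A> p" for c'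
    proof -
      let ?J' = "transition_deriv c' c p"
      define B where "B x y = k c (S (?J' x)) (S (?J' y))" for x y
      have "bilinear B"
        unfolding bilinear_def B_def k_def
        by (auto intro!: linearI simp: linear_map_simps[OF linear_transition_deriv[OF c' c]] linear_map_simps[OF S]
          bilinear_simps[OF bilinear_mform])
      have cv: "coord_vec \<A> c' p i c = ?J' (axis i 1)" for i
        using c c' by (simp add: coord_vec_mk_tvec mk_tvec_apply)
      have "F c' = (\<Sum>i\<in>UNIV. \<Sum>j\<in>UNIV. B (axis i 1) (axis j 1) * X c' $ i * Y c' $ j)"
        unfolding F_def sum_distrib_right[symmetric] sum[OF c'] cv B_def ..
      also have "\<dots> = B (X c') (Y c')"
        unfolding bilinear_mform_eq[OF \<open>bilinear B\<close>, of "X c'" "Y c'"] mform_sum by simp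
      also have "\<dots> = k c (S (X c)) (S (Y c))"
        using tangent_transition[OF t(1) c' c] tangent_transition[OF t(2) c' c] by (simp add: B_def)
      finally show ?thesis .
    qed
    have "dual_tensor \<A> g A p X Y = chart_invariant \<A> p F" by (simp add: dual_tensor_def F_def[abs_def])
    also have "\<dots> = F c" by (rule chart_invariant_eq[OF c]) (simp add: F c)
    finally show ?thesis unfolding F[OF c] kl[OF c] .
  qed
  show "(\<Sum>a\<in>UNIV. \<Sum>b\<in>UNIV. comps \<A> A c' p $ i $ a * comps \<A> A c' p $ j $ b
       * matrix_inv (comps \<A> g c' p) $ a $ b) = comps \<A> (dual_tensor \<A> g A) c' p $ i $ j"
    if c': "c' \<in> charts_at \<A> p"
    using dual[OF coord_vec_tangent[OF c'] coord_vec_tangent[OF c'], of i j]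
    unfolding sum[OF c'] kl[OF c] by (simp add: comps_def)
qed

text \<open>If \<open>X\<close> is in the kernel of \<open>A\<close>, test with the tangent vector
  whose components are \<open>S (X c)\<close>: positive definiteness gives
  \<open>S (X c) = 0\<close>.\<close>

lemma nondegenerate_at_iff:
  assumes g: "riemannian_metric_on \<A> W g" and p: "p \<in> W" and c: "c \<in> charts_at \<A> p" and S: "linear S"
    and A: "\<And>X Y. X \<in> tangent_space \<A> p \<Longrightarrow> Y \<in> tangent_space \<A> p \<Longrightarrow>
      A p X Y = loc_form \<A> g c (coord c p) (S (X c)) (Y c)"
  shows "nondegenerate_at \<A> A p \<longleftrightarrow> inj S"
proof -
  note mf = riemannian_metric_field[OF g charts_atD(1)[OF c]]
  note k = metric_fieldD(3-5)[OF mf cimgI[OF c p]]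
  have "(\<forall>Y\<in>tangent_space \<A> p. A p X Y = 0) \<longleftrightarrow> S (X c) = 0" if X: "X \<in> tangent_space \<A> p" for X
  proof
    assume "\<forall>Y\<in>tangent_space \<A> p. A p X Y = 0"
    then have "loc_form \<A> g c (coord c p) (S (X c)) (S (X c)) = 0"
      using A[OF X mk_tvec_tangent[OF c], of "S (X c)"] mk_tvec_tangent[OF c] c by simp
    then show "S (X c) = 0" using k(3)[of "S (X c)"] by fastforce
  next
    assume "S (X c) = 0"
    then show "\<forall>Y\<in>tangent_space \<A> p. A p X Y = 0"
      using A[OF X] bilinear_lzero[OF k(1)] by simp
  qed
  then have "nondegenerate_at \<A> A p \<longleftrightarrow> (\<forall>X\<in>tangent_space \<A> p. S (X c) = 0 \<longrightarrow> X = (\<lambda>_. 0))"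
    unfolding nondegenerate_at_def by blast
  also have "\<dots> \<longleftrightarrow> (\<forall>x. S x = 0 \<longrightarrow> x = 0)"
  proof
    assume l: "\<forall>X\<in>tangent_space \<A> p. S (X c) = 0 \<longrightarrow> X = (\<lambda>_. 0)"
    show "\<forall>x. S x = 0 \<longrightarrow> x = 0"
      using l mk_tvec_tangent[OF c] mk_tvec_self[OF c] by metis
  next
    assume r: "\<forall>x. S x = 0 \<longrightarrow> x = 0"
    show "\<forall>X\<in>tangent_space \<A> p. S (X c) = 0 \<longrightarrow> X = (\<lambda>_. 0)"
      using r tangent_eqI[OF _ tangent_zero c] by metis
  qed
  also have "\<dots> \<longleftrightarrow> inj S" using linear_injective_0[OF S] by blast
  finally show ?thesis .
qed

end

section \<open>Duality for a conformally flat metric on an open set of the manifold\<close>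

locale conformally_flat_manifold = smooth_manifold \<A>
  for \<A> :: "('m::{t2_space, second_countable_topology}, 'n::finite) chart set" +
  fixes W and g :: "('m, 'n) tensor2"
  assumes dim: "CARD('n) \<ge> 3" and g: "riemannian_metric_on \<A> W g" and cf: "conformally_flat_on \<A> W g"
begin

abbreviation "A \<equiv> schouten \<A> g"
abbreviation "Rstar \<equiv> {p \<in> W. nondegenerate_at \<A> A p}"
abbreviation "g' \<equiv> dual_tensor \<A> g A"
abbreviation "\<Gamma> c \<equiv> lc_matrix (\<lambda>y. comps \<A> g c (param c y))"

lemma schouten_data:
  assumes p: "p \<in> W" and c: "c \<in> charts_at \<A> p"
  obtains V S u P w where "open V" "coord c p \<in> V" "V \<subseteq> cimg c W"
    "conformally_flat_data V (loc_form \<A> g c) (\<Gamma> c) S u P w" "\<And>y. y \<in> V \<Longrightarrow> w y > 0"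
proof -
  note cA = charts_atD(1)[OF c]
  obtain V s \<Gamma>s where V: "open V" "coord c p \<in> V" "V \<subseteq> cimg c W" and s: "smooth_on V s"
    and lcs: "levi_civita V (\<lambda>y u v. exp (2 * s y) * loc_form \<A> g c y u v) \<Gamma>s"
    and flat: "\<And>y u v w. y \<in> V \<Longrightarrow> Rm \<Gamma>s y u v w = 0"
    by (rule conformally_flat_on_local[OF g cf p c]) (rule that)
  obtain V' S u P w where "open V'" "coord c p \<in> V'" "V' \<subseteq> V"
    "conformally_flat_data V' (loc_form \<A> g c) (\<Gamma> c) S u P w" "\<And>y. y \<in> V' \<Longrightarrow> w y > 0"
    by (rule noncritical_conformal_data[OF metric_field_subset[OF riemannian_metric_field[OF g cA] V(1,3)]
          levi_civita_subset[OF loc_levi_civita[OF g cA] V(3)] s lcs])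
      (rule flat, assumption, rule V(2), rule that)
  then show thesis using that V(3) by blast
qed

text \<open>Links the local endomorphism \<open>S\<close>, which comes from a chosen flat factor, to
  the globally defined tensor \<open>A\<close>.\<close>

lemma schouten_eq:
  assumes d: "conformally_flat_data V (loc_form \<A> g c) (\<Gamma> c) S u P w"
    and q: "q \<in> W" "c \<in> charts_at \<A> q" "coord c q \<in> V"
    and t: "X \<in> tangent_space \<A> q" "Y \<in> tangent_space \<A> q"
  shows "A q X Y = loc_form \<A> g c (coord c q) (S (coord c q) (X c)) (Y c)"
  by (rule schouten_kn[OF dim g q(1,2) smooth_linD[OF conformally_flat_data.S[OF d] q(3)]
        conformally_flat_data.S_sym[OF d q(3)] _ t])
    (simp add: loc_Rm_def conformally_flat_data.curv[OF d q(3)])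

lemma dual_eq:
  assumes d: "conformally_flat_data V (loc_form \<A> g c) (\<Gamma> c) S u P w"
    and q: "q \<in> W" "c \<in> charts_at \<A> q" "coord c q \<in> V"
    and t: "X \<in> tangent_space \<A> q" "Y \<in> tangent_space \<A> q"
  shows "g' q X Y = loc_form \<A> g c (coord c q) (S (coord c q) (X c)) (S (coord c q) (Y c))"
  using dual_tensor_eq(1)[OF g q(1,2) _ _ t, of "S (coord c q)" A] schouten_eq[OF d q]
    conformally_flat_data.S[OF d] smooth_linD q(3) by blast

lemma Rstar_iff:
  assumes d: "conformally_flat_data V (loc_form \<A> g c) (\<Gamma> c) S u P w"
    and q: "q \<in> W" "c \<in> charts_at \<A> q" "coord c q \<in> V"
  shows "q \<in> Rstar \<longleftrightarrow> inj (S (coord c q))"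
  using nondegenerate_at_iff[where S = "S (coord c q)" and A = A, OF g q(1,2) smooth_linD[OF conformally_flat_data.S[OF d] q(3)] schouten_eq[OF d q]] q(1)
  by simp

text \<open>Nondegeneracy of \<open>A\<close> is nonvanishing of the determinant of
  \<open>S\<close>, an open condition. Shrinking to it makes \<open>S\<close> invertible and at the
  same time shows that \<open>Rstar\<close> is open.\<close>

lemma dual_data:
  assumes p: "p \<in> Rstar" and c: "c \<in> charts_at \<A> p"
  obtains V S u P w T where "open V" "coord c p \<in> V" "V \<subseteq> cimg c Rstar"
    "conformally_flat_dual V (loc_form \<A> g c) (\<Gamma> c) S u P w T" "\<And>y. y \<in> V \<Longrightarrow> w y > 0"
proof -
  have pW: "p \<in> W" using p by simp
  note cA = charts_atD(1)[OF c]
  obtain V S u P w where V: "open V" "coord c p \<in> V" "V \<subseteq> cimg c W"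
    and d: "conformally_flat_data V (loc_form \<A> g c) (\<Gamma> c) S u P w" and w: "\<And>y. y \<in> V \<Longrightarrow> w y > 0"
    by (rule schouten_data[OF pW c]) (rule that)
  note S = conformally_flat_data.S[OF d]
  define V' where "V' = V \<inter> (\<lambda>y. det (matrix (S y))) -` (- {0})"
  have inj: "inj (S y) \<longleftrightarrow> det (matrix (S y)) \<noteq> 0" if "y \<in> V" for y
    using det_nz_iff_inj[OF smooth_linD[OF S that]] by simp
  have "smooth_on V (\<lambda>y. matrix (S y))"
    unfolding matrix_def
    by (intro smooth_on_vec_lambda V smooth_on_vec_iff[OF V(1), THEN iffD1, rule_format] smooth_lin_on[OF S])
  then have "open V'"
    unfolding V'_def by (intro continuous_open_preimage smooth_on_continuous smooth_on_det V) auto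
  moreover have "coord c p \<in> V'"
    using V(2) inj[OF V(2)] Rstar_iff[OF d pW c V(2)] p by (simp add: V'_def)
  moreover have V'V: "V' \<subseteq> V" by (simp add: V'_def)
  moreover have "V' \<subseteq> cimg c Rstar"
  proof
    fix y assume y: "y \<in> V'"
    then have "y \<in> cimg c W" "y \<in> V" using V'V V(3) by auto
    note q = cimgD[OF cA this(1)]
    have "param c y \<in> Rstar"
      using Rstar_iff[OF d q(2,4)] inj[OF \<open>y \<in> V\<close>] y \<open>y \<in> V\<close> q(3) by (simp add: V'_def)
    then show "y \<in> cimg c Rstar" using cimgI[OF q(4), of Rstar] q(3) by simp
  qed
  moreover obtain T where T: "smooth_lin V' T" "\<And>y x. y \<in> V' \<Longrightarrow> T y (S y x) = x" "\<And>y x. y \<in> V' \<Longrightarrow> S y (T y x) = x"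
    by (rule smooth_lin_inverse[OF \<open>open V'\<close> smooth_lin_subset[OF S V'V]])
      (use inj in \<open>auto simp: V'_def\<close>)
  moreover have "conformally_flat_dual V' (loc_form \<A> g c) (\<Gamma> c) S u P w T"
    unfolding conformally_flat_dual_def conformally_flat_dual_axioms_def
    using conformally_flat_data.subset[OF d \<open>open V'\<close> V'V] T by blast
  ultimately show thesis using that w by blast
qed

lemma dual_bilin_at:
  assumes p: "p \<in> W"
  shows "bilin_at \<A> g' p"
proof -
  obtain c where c: "c \<in> charts_at \<A> p" by (rule charts_at_nonempty)
  obtain V S u P w where V: "coord c p \<in> V"
    and d: "conformally_flat_data V (loc_form \<A> g c) (\<Gamma> c) S u P w"
    by (rule schouten_data[OF p c]) (rule that)
  note bil = metric_fieldD(3)[OF riemannian_metric_field[OF g charts_atD(1)[OF c]] cimgI[OF c p]]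
  note S = smooth_linD[OF conformally_flat_data.S[OF d] V]
  show ?thesis
    unfolding bilin_at_def
    by (intro ballI allI)
      (simp add: dual_eq[OF d p c V], simp add: tadd_def tscale_def linear_map_simps[OF S] bilinear_simps[OF bil])
qed

lemma dual_loc_form:
  assumes d: "conformally_flat_dual V (loc_form \<A> g c) (\<Gamma> c) S u P w T"
    and c: "c \<in> \<A>" and V: "V \<subseteq> cimg c W" and y: "y \<in> V"
  shows "loc_form \<A> g' c y x z = conformally_flat_dual.g' (loc_form \<A> g c) S y x z"
proof -
  have d': "conformally_flat_data V (loc_form \<A> g c) (\<Gamma> c) S u P w"
    using d by (simp add: conformally_flat_dual_def)
  have yW: "y \<in> cimg c W" using y V by blast
  note q = cimgD[OF c yW]
  have "loc_form \<A> g' c y x z = g' (param c y) (mk_tvec \<A> c (param c y) x) (mk_tvec \<A> c (param c y) z)"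
    using comps_eval[OF dual_bilin_at[OF q(2)] q(4) mk_tvec_tangent[OF q(4)] mk_tvec_tangent[OF q(4)], of x z] q(4)
    by (simp add: loc_form_def)
  also have "\<dots> = loc_form \<A> g c y (S y x) (S y z)"
    using dual_eq[OF d' q(2,4) _ mk_tvec_tangent[OF q(4)] mk_tvec_tangent[OF q(4)], of x z] y q(3,4) by simp
  finally show ?thesis by (simp add: conformally_flat_dual.g'_def[OF d])
qed

lemma open_Rstar: "open Rstar"
proof (rule open_subopen[THEN iffD2], rule ballI)
  fix p assume p: "p \<in> Rstar"
  obtain c where c: "c \<in> charts_at \<A> p" by (rule charts_at_nonempty)
  note cA = charts_atD(1)[OF c]
  obtain V where V: "open V" "coord c p \<in> V" "V \<subseteq> cimg c Rstar"
    by (rule dual_data[OF p c]) (rule that)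
  have "cdom c \<inter> coord c -` V \<subseteq> Rstar"
  proof
    fix q assume "q \<in> cdom c \<inter> coord c -` V"
    then have "coord c q \<in> cimg c Rstar" "q \<in> cdom c" using V(3) by auto
    then show "q \<in> Rstar" using cimgD(2)[OF cA, of "coord c q" Rstar] param_coord[OF cA] by metis
  qed
  then show "\<exists>T. open T \<and> p \<in> T \<and> T \<subseteq> Rstar"
    using open_chart_preimage[OF cA V(1)] V(2) charts_atD(2)[OF c] by blast
qed

lemma dual_riemannian: "riemannian_metric_on \<A> Rstar g'"
proof (rule riemannian_metric_onI[OF open_Rstar])
  show "bilin_at \<A> g' p" if "p \<in> Rstar" for p using dual_bilin_at that by simp
  fix p assume p: "p \<in> Rstar"
  obtain c where c: "c \<in> charts_at \<A> p" by (rule charts_at_nonempty)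
  obtain V S u P w T where V: "open V" "coord c p \<in> V" "V \<subseteq> cimg c Rstar"
    and d: "conformally_flat_dual V (loc_form \<A> g c) (\<Gamma> c) S u P w T"
    by (rule dual_data[OF p c]) (rule that)
  have VW: "V \<subseteq> cimg c W" using V(3) by (auto simp: cimg_def)
  show "\<exists>c\<in>charts_at \<A> p. \<exists>V h. metric_field V h \<and> coord c p \<in> V \<and> V \<subseteq> cimg c Rstar \<and>
       (\<forall>y\<in>V. \<forall>u v. loc_form \<A> g' c y u v = h y u v)"
    using conformally_flat_dual.metric_field_dual[OF d] dual_loc_form[OF d charts_atD(1)[OF c] VW] c V by blast
qed

lemma dual_conformally_flat_on: "conformally_flat_on \<A> Rstar g'"
proof (rule conformally_flat_onI[OF dual_riemannian])
  fix p assume p: "p \<in> Rstar"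
  obtain c where c: "c \<in> charts_at \<A> p" by (rule charts_at_nonempty)
  obtain V S u P w T where V: "open V" "coord c p \<in> V" "V \<subseteq> cimg c Rstar"
    and d: "conformally_flat_dual V (loc_form \<A> g c) (\<Gamma> c) S u P w T" and w_pos: "\<And>y. y \<in> V \<Longrightarrow> w y > 0"
    by (rule dual_data[OF p c]) (rule that)
  have VW: "V \<subseteq> cimg c W" using V(3) by (auto simp: cimg_def)
  interpret L: conformally_flat_dual V "loc_form \<A> g c" "\<Gamma> c" S u P w T by (rule d)
  obtain \<Gamma>c where lc: "levi_civita V (\<lambda>q x y. exp (2 * - ln (w q)) * L.g' q x y) \<Gamma>c"
    and flat: "\<And>p x y z. p \<in> V \<Longrightarrow> Rm \<Gamma>c p x y z = 0"
    by (rule L.dual_conformally_flat[OF w_pos]) (assumption, rule that)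
  have "levi_civita V (\<lambda>q x y. exp (2 * - ln (w q)) * loc_form \<A> g' c q x y) \<Gamma>c"
    by (rule levi_civita_cong[OF lc V(1)]) (simp add: dual_loc_form[OF d charts_atD(1)[OF c] VW])
  moreover have "smooth_on V (\<lambda>q. - ln (w q))"
    by (intro smooth_on_uminus smooth_on_ln V L.w w_pos)
  ultimately show "\<exists>c\<in>charts_at \<A> p. \<exists>V s \<Gamma>s. open V \<and> coord c p \<in> V \<and> V \<subseteq> cimg c Rstar \<and>
      smooth_on V s \<and> levi_civita V (\<lambda>y u v. exp (2 * s y) * loc_form \<A> g' c y u v) \<Gamma>s \<and>
      (\<forall>y\<in>V. \<forall>u v w. Rm \<Gamma>s y u v w = 0)"
    using c V flat by blast
qed

lemma dual_comps:
  assumes p: "p \<in> Rstar" and c: "c \<in> charts_at \<A> p"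
  shows "comps \<A> g' c p $ i $ j = (\<Sum>a\<in>UNIV. \<Sum>b\<in>UNIV. comps \<A> A c p $ i $ a * comps \<A> A c p $ j $ b
      * matrix_inv (comps \<A> g c p) $ a $ b)"
proof -
  have pW: "p \<in> W" using p by simp
  obtain V S u P w where V: "coord c p \<in> V"
    and d: "conformally_flat_data V (loc_form \<A> g c) (\<Gamma> c) S u P w"
    by (rule schouten_data[OF pW c]) (rule that)
  show ?thesis
    by (rule dual_tensor_eq(2)[where S = "S (coord c p)" and A = A, OF g pW c smooth_linD[OF conformally_flat_data.S[OF d] V] schouten_eq[OF d pW c V] c, symmetric])
qed

text \<open>The Schouten endomorphism of the dual metric is \<open>T\<close>, and lowering its index
  by the dual metric gives \<open>g (T x)\<close> after two applications of \<open>S\<close>, that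
  is \<open>g x (S y)\<close>, which is \<open>A\<close> by symmetry.\<close>

lemma dual_schouten:
  assumes p: "p \<in> Rstar" and t: "X \<in> tangent_space \<A> p" "Y \<in> tangent_space \<A> p"
  shows "schouten \<A> g' p X Y = A p X Y"
proof -
  have pW: "p \<in> W" using p by simp
  obtain c where c: "c \<in> charts_at \<A> p" by (rule charts_at_nonempty)
  note cA = charts_atD(1)[OF c]
  obtain V S u P w T where V: "open V" "coord c p \<in> V" "V \<subseteq> cimg c Rstar"
    and d: "conformally_flat_dual V (loc_form \<A> g c) (\<Gamma> c) S u P w T"
    by (rule dual_data[OF p c]) (rule that)
  have VW: "V \<subseteq> cimg c W" using V(3) by (auto simp: cimg_def)
  interpret L: conformally_flat_dual V "loc_form \<A> g c" "\<Gamma> c" S u P w T by (rule d)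
  let ?y = "coord c p"
  have lf: "loc_form \<A> g' c y = L.g' y" if "y \<in> V" for y
    using dual_loc_form[OF d cA VW that] by blast
  have lc: "levi_civita V (loc_form \<A> g' c) L.\<Gamma>'"
    by (rule levi_civita_cong[OF L.levi_civita_dual V(1)]) (simp add: lf)
  have R: "loc_Rm \<A> g' c ?y x y z = kn (loc_form \<A> g' c ?y) (T ?y) x y z" for x y z
    unfolding loc_Rm_def lf[OF V(2)] L.Rm_dual[OF V(2), symmetric]
    by (rule levi_civita_Rm_unique[OF metric_field_subset[OF riemannian_metric_field[OF dual_riemannian cA] V(1,3)]
          levi_civita_subset[OF loc_levi_civita[OF dual_riemannian cA] V(3)] lc V(2)])
  have sym: "loc_form \<A> g' c ?y (T ?y x) y = loc_form \<A> g' c ?y x (T ?y y)" for x y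
    unfolding lf[OF V(2)] by (simp add: L.g'_def L.ST[OF V(2)] L.S_sym[OF V(2)])
  have "schouten \<A> g' p X Y = loc_form \<A> g' c ?y (T ?y (X c)) (Y c)"
    by (rule schouten_kn[OF dim dual_riemannian p c smooth_linD[OF L.T V(2)] sym R t])
  also have "\<dots> = loc_form \<A> g c ?y (S ?y (X c)) (Y c)"
    unfolding lf[OF V(2)] L.g'_T[OF V(2)] L.S_sym[OF V(2)] ..
  also have "\<dots> = A p X Y"
    by (rule schouten_eq[OF L.conformally_flat_data_axioms pW c V(2) t, symmetric])
  finally show ?thesis .
qed

end

section \<open>The metric induced by a coherent tangent bundle\<close>

context
  fixes \<A> :: "('m::{t2_space, second_countable_topology}, 'n::finite) chart set"
    and E :: "'m \<Rightarrow> 'e::real_vector set" and \<T> :: "('m, 'e, 'n) trivialisation set"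
    and ip :: "'m \<Rightarrow> 'e \<Rightarrow> 'e \<Rightarrow> real" and \<phi> :: "'m \<Rightarrow> ('m, 'n) tvec \<Rightarrow> 'e"
  assumes sm: "smooth_structure \<A>" and vb: "vector_bundle \<A> E \<T>" and fm: "fibre_metric \<A> E \<T> ip"
    and hom: "tangent_bundle_hom \<A> E \<T> \<phi>"
begin

interpretation smooth_manifold \<A> by standard (rule sm)

lemma fibre_subspace: "subspace (E p)"
  using vb by (simp add: vector_bundle_def)

lemma fibre_metric_simps:
  assumes "a \<in> E p" "b \<in> E p"
  shows "ip p a b = ip p b a" "d \<in> E p \<Longrightarrow> ip p (a + b) d = ip p a d + ip p b d"
    "ip p (r *\<^sub>R a) b = r * ip p a b" "a \<noteq> 0 \<Longrightarrow> ip p a a > 0"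
  using fm assms unfolding fibre_metric_def by blast+

lemma hom_simps:
  assumes "X \<in> tangent_space \<A> p" "Y \<in> tangent_space \<A> p"
  shows "\<phi> p X \<in> E p" "\<phi> p (tadd X Y) = \<phi> p X + \<phi> p Y" "\<phi> p (tscale r X) = r *\<^sub>R \<phi> p X"
  using hom assms unfolding tangent_bundle_hom_def by blast+

lemma induced_bilin_at: "bilin_at \<A> (induced_metric ip \<phi>) p"
  unfolding bilin_at_def induced_metric_def
proof (intro ballI allI)
  fix X Y Z r assume t: "X \<in> tangent_space \<A> p" "Y \<in> tangent_space \<A> p" "Z \<in> tangent_space \<A> p"
  note e = hom_simps(1)[OF t(1,1)] hom_simps(1)[OF t(2,2)] hom_simps(1)[OF t(3,3)]
  note sub = subspace_add[OF fibre_subspace e(1,2)] subspace_scale[OF fibre_subspace e(1), of r]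
  show "ip p (\<phi> p (tadd X Y)) (\<phi> p Z) = ip p (\<phi> p X) (\<phi> p Z) + ip p (\<phi> p Y) (\<phi> p Z) \<and>
    ip p (\<phi> p (tscale r X)) (\<phi> p Z) = r * ip p (\<phi> p X) (\<phi> p Z) \<and>
    ip p (\<phi> p Z) (\<phi> p (tadd X Y)) = ip p (\<phi> p Z) (\<phi> p X) + ip p (\<phi> p Z) (\<phi> p Y) \<and>
    ip p (\<phi> p Z) (\<phi> p (tscale r X)) = r * ip p (\<phi> p Z) (\<phi> p X)"
    unfolding hom_simps[OF t(1,2)] fibre_metric_simps(1)[OF e(3) sub(1)] fibre_metric_simps(1)[OF e(3) sub(2)]
      fibre_metric_simps(2)[OF e(1,2,3)] fibre_metric_simps(3)[OF e(1,3)]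
      fibre_metric_simps(1)[OF e(3,1)] fibre_metric_simps(1)[OF e(3,2)] by simp
qed

text \<open>In a trivialisation the components are a smooth bilinear family \<open>m\<close>,
  evaluated on the smooth fibre coordinates \<open>f i\<close> of the images of coordinate vectors.
  The claim includes the singular points, so that the regular set can be cut out by a
  determinant.\<close>

lemma induced_comps_smooth:
  assumes c: "c \<in> \<A>"
  shows "smooth_on (coord c ` cdom c) (\<lambda>y. comps \<A> (induced_metric ip \<phi>) c (param c y))"
proof (rule smooth_on_local)
  fix y assume y: "y \<in> coord c ` cdom c"
  define p where "p = param c y"
  have p: "p \<in> cdom c" "coord c p = y" using y c by (auto simp: p_def)
  note vbs = vb[unfolded vector_bundle_def, THEN conjunct2]
  have "p \<in> (\<Union>(V, \<tau>)\<in>\<T>. V)" unfolding conjunct1[OF vbs] by simp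
  then obtain V \<tau> where V: "(V, \<tau>) \<in> \<T>" "p \<in> V" by auto
  note triv = bspec[OF conjunct1[OF conjunct2[OF vbs]] V(1), unfolded prod.case]
  have oV: "open V" and bij: "\<And>q. q \<in> V \<Longrightarrow> bij_betw (\<tau> q) (E q) UNIV"
    and lin: "\<And>q a b. q \<in> V \<Longrightarrow> a \<in> E q \<Longrightarrow> b \<in> E q \<Longrightarrow> \<tau> q (a + b) = \<tau> q a + \<tau> q b"
      "\<And>q a r. q \<in> V \<Longrightarrow> a \<in> E q \<Longrightarrow> \<tau> q (r *\<^sub>R a) = r *\<^sub>R \<tau> q a"
    using triv by blast+
  define O' where "O' = cimg c V"
  have O': "open O'" unfolding O'_def by (rule open_cimg[OF c oV])
  define f where "f i y = \<tau> (param c y) (\<phi> (param c y) (coord_vec \<A> c (param c y) i))" for i y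
  have f: "smooth_on O' (f i)" for i
  proof -
    have "smooth_map_on \<A> (cdom c \<inter> V) (\<lambda>p. \<tau> p (\<phi> p (coord_vec \<A> c p i)))"
      using bspec[OF bspec[OF conjunct2[OF hom[unfolded tangent_bundle_hom_def]] c] V(1)] by simp
    then show ?thesis using c by (auto simp: smooth_map_on_def O'_def cimg_def f_def[abs_def])
  qed
  define m where "m y v w = ip (param c y) (inv_into (E (param c y)) (\<tau> (param c y)) v) (inv_into (E (param c y)) (\<tau> (param c y)) w)" for y v w
  have m_smooth: "smooth_on O' (\<lambda>y. m y v w)" for v w
  proof -
    have "smooth_map_on \<A> V (\<lambda>p. ip p (inv_into (E p) (\<tau> p) v) (inv_into (E p) (\<tau> p) w))"
      using bspec[OF conjunct2[OF conjunct2[OF fm[unfolded fibre_metric_def]]] V(1)] by simp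
    then show ?thesis using c by (auto simp: smooth_map_on_def O'_def cimg_def m_def)
  qed
  have m: "smooth_bil O' m"
    unfolding smooth_bil_def
  proof (intro conjI ballI allI m_smooth)
    fix z assume "z \<in> O'"
    define q where "q = param c z"
    have q: "q \<in> V" using cimgD[OF c \<open>z \<in> O'\<close>[unfolded O'_def]] by (simp add: q_def)
    define \<iota> where "\<iota> = inv_into (E q) (\<tau> q)"
    have \<iota>E: "\<iota> v \<in> E q" for v
      using bij_betwE[OF bij_betw_inv_into[OF bij[OF q]]] by (simp add: \<iota>_def)
    have \<tau>\<iota>: "\<tau> q (\<iota> v) = v" for v unfolding \<iota>_def by (rule bij_betw_inv_into_right[OF bij[OF q] UNIV_I])
    have \<iota>\<tau>: "\<iota> (\<tau> q a) = a" if "a \<in> E q" for a unfolding \<iota>_def by (rule bij_betw_inv_into_left[OF bij[OF q] that])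
    have \<iota>_add: "\<iota> (v + w) = \<iota> v + \<iota> w" for v w
      using \<iota>\<tau>[OF subspace_add[OF fibre_subspace \<iota>E[of v] \<iota>E[of w]]] lin(1)[OF q \<iota>E[of v] \<iota>E[of w]] by (simp add: \<tau>\<iota>)
    have \<iota>_scale: "\<iota> (r *\<^sub>R v) = r *\<^sub>R \<iota> v" for r v
      using \<iota>\<tau>[OF subspace_scale[OF fibre_subspace \<iota>E[of v]]] lin(2)[OF q \<iota>E[of v]] by (simp add: \<tau>\<iota>)
    have left: "linear (\<lambda>v. ip q (\<iota> v) (\<iota> w))" for w
      by (rule linearI) (simp_all add: \<iota>_add \<iota>_scale fibre_metric_simps(2)[OF \<iota>E \<iota>E \<iota>E] fibre_metric_simps(3)[OF \<iota>E \<iota>E])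
    moreover have "(\<lambda>w. ip q (\<iota> v) (\<iota> w)) = (\<lambda>w. ip q (\<iota> w) (\<iota> v))" for v
      using fibre_metric_simps(1)[OF \<iota>E \<iota>E] by blast
    ultimately show "bilinear (m z)"
      unfolding bilinear_def m_def q_def[symmetric] \<iota>_def[symmetric] by simp
  qed
  have "smooth_on O' (\<lambda>y. comps \<A> (induced_metric ip \<phi>) c (param c y) $ i $ j)" for i j
  proof (rule smooth_on_transfer[OF smooth_bil_smooth[OF O' m f f] O'])
    fix z assume "z \<in> O'"
    note q = cimgD[OF c \<open>z \<in> O'\<close>[unfolded O'_def]]
    have "inv_into (E (param c z)) (\<tau> (param c z)) (f i z) = \<phi> (param c z) (coord_vec \<A> c (param c z) i)" for i
      unfolding f_def
      by (rule bij_betw_inv_into_left[OF bij[OF q(2)]]) (rule hom_simps(1)[OF coord_vec_tangent[OF q(4)] tangent_zero])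
    then show "comps \<A> (induced_metric ip \<phi>) c (param c z) $ i $ j = m z (f i z) (f j z)"
      by (simp add: comps_def induced_metric_def m_def)
  qed
  then have "smooth_on O' (\<lambda>y. comps \<A> (induced_metric ip \<phi>) c (param c y))"
    by (simp add: smooth_on_vec_iff[OF O', where 'b = "real ^ 'n"] smooth_on_vec_iff[OF O', where 'b = real])
  moreover have "y \<in> O'" using cimgI[OF charts_atI[OF c p(1)] V(2)] p(2) by (simp add: O'_def)
  ultimately show "\<exists>T. open T \<and> y \<in> T \<and> smooth_on T (\<lambda>y. comps \<A> (induced_metric ip \<phi>) c (param c y))"
    using O' by blast
qed

lemma hom_zero: "\<phi> p (\<lambda>_. 0) = 0"
proof -
  have "tscale 0 (\<lambda>_. 0) = ((\<lambda>_. 0) :: ('m, 'n) tvec)" by (simp add: tscale_def)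
  then show ?thesis using hom_simps(3)[OF tangent_zero tangent_zero, of p 0] by simp
qed

lemma regular_pos:
  assumes p: "p \<in> regular_points \<A> \<phi>" and X: "X \<in> tangent_space \<A> p" "X \<noteq> (\<lambda>_. 0)"
  shows "induced_metric ip \<phi> p X X > 0"
proof -
  have "\<phi> p X \<noteq> 0"
    using p X inj_onD[of "\<phi> p" "tangent_space \<A> p" X "\<lambda>_. 0"] hom_zero by (auto simp: regular_points_def)
  then show ?thesis
    unfolding induced_metric_def
    by (rule fibre_metric_simps(4)[OF hom_simps(1)[OF X(1,1)] hom_simps(1)[OF X(1,1)]])
qed

text \<open>Expresses injectivity of \<open>\<phi> p\<close> by a function that is smooth on the
  whole chart domain, whence the regular set is open. Definiteness of the fibre metric gives one
  direction, an explicit test vector the other.\<close>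

lemma regular_iff_det:
  assumes c: "c \<in> charts_at \<A> p"
  shows "p \<in> regular_points \<A> \<phi> \<longleftrightarrow> det (comps \<A> (induced_metric ip \<phi>) c p) \<noteq> 0"
proof
  note ev = comps_eval[OF induced_bilin_at c]
  assume p: "p \<in> regular_points \<A> \<phi>"
  show "det (comps \<A> (induced_metric ip \<phi>) c p) \<noteq> 0"
  proof (rule mform_pos_det)
    fix x :: "real ^ 'n" assume "x \<noteq> 0"
    then have "mk_tvec \<A> c p x \<noteq> (\<lambda>_. 0)" using mk_tvec_self[OF c, of x] by metis
    from regular_pos[OF p mk_tvec_tangent[OF c] this]
    show "0 < mform (comps \<A> (induced_metric ip \<phi>) c p) x x"
      unfolding ev[OF mk_tvec_tangent[OF c] mk_tvec_tangent[OF c]] by (simp add: c)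
  qed
next
  note ev = comps_eval[OF induced_bilin_at c]
  let ?M = "comps \<A> (induced_metric ip \<phi>) c p"
  assume det: "det ?M \<noteq> 0"
  show "p \<in> regular_points \<A> \<phi>"
    unfolding regular_points_def mem_Collect_eq
  proof (rule inj_onI)
    fix X Y assume t: "X \<in> tangent_space \<A> p" "Y \<in> tangent_space \<A> p" and eq: "\<phi> p X = \<phi> p Y"
    have "mform ?M (X c) z = mform ?M (Y c) z" for z
      using ev[OF t(1) mk_tvec_tangent[OF c], of z] ev[OF t(2) mk_tvec_tangent[OF c], of z] eq c
      by (simp add: induced_metric_def)
    \<comment> \<open>The inverse matrix turns the form into the Euclidean inner product with
      \<open>X c - Y c\<close>, so this difference has Euclidean length zero.\<close>
    from this[of "matrix_inv ?M *v (X c - Y c)"] have "X c \<bullet> (X c - Y c) = Y c \<bullet> (X c - Y c)"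
      by (simp add: mform_def matrix_inv_vec[OF det])
    then have "(X c - Y c) \<bullet> (X c - Y c) = 0" by (simp add: inner_diff_left)
    then show "X = Y" using tangent_eqI[OF t c] by simp
  qed
qed

lemma open_regular: "open (regular_points \<A> \<phi>)"
proof (rule open_subopen[THEN iffD2], rule ballI)
  fix p assume p: "p \<in> regular_points \<A> \<phi>"
  obtain c where c: "c \<in> charts_at \<A> p" by (rule charts_at_nonempty)
  note cA = charts_atD[OF c]
  let ?D = "\<lambda>y. det (comps \<A> (induced_metric ip \<phi>) c (param c y))"
  define V where "V = coord c ` cdom c \<inter> ?D -` (- {0})"
  have "open V"
    unfolding V_def
    by (intro continuous_open_preimage smooth_on_continuous smooth_on_det chart(2)[OF cA(1)] induced_comps_smooth cA) auto
  then have "open (cdom c \<inter> coord c -` V)" by (rule open_chart_preimage[OF cA(1)])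
  moreover have "p \<in> cdom c \<inter> coord c -` V"
    using p regular_iff_det[OF c] cA by (simp add: V_def)
  moreover have "cdom c \<inter> coord c -` V \<subseteq> regular_points \<A> \<phi>"
  proof
    fix q assume "q \<in> cdom c \<inter> coord c -` V"
    then have q: "q \<in> cdom c" "?D (coord c q) \<noteq> 0" by (simp_all add: V_def)
    then show "q \<in> regular_points \<A> \<phi>"
      using regular_iff_det[OF charts_atI[OF cA(1) q(1)]] param_coord[OF cA(1) q(1)] by simp
  qed
  ultimately show "\<exists>T. open T \<and> p \<in> T \<and> T \<subseteq> regular_points \<A> \<phi>" by blast
qed

lemma induced_riemannian: "riemannian_metric_on \<A> (regular_points \<A> \<phi>) (induced_metric ip \<phi>)"
proof (rule riemannian_metric_onI[OF open_regular induced_bilin_at])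
  fix p assume p: "p \<in> regular_points \<A> \<phi>"
  obtain c where c: "c \<in> charts_at \<A> p" by (rule charts_at_nonempty)
  note cA = charts_atD(1)[OF c]
  let ?W = "cimg c (regular_points \<A> \<phi>)"
  have U: "open ?W" by (rule open_cimg[OF cA open_regular])
  have "metric_field ?W (loc_form \<A> (induced_metric ip \<phi>) c)"
    unfolding metric_field_def
  proof (intro conjI ballI allI impI U)
    have "?W \<subseteq> coord c ` cdom c" by (auto simp: cimg_def)
    from smooth_bil_mform[OF U smooth_on_subset[OF induced_comps_smooth[OF cA] this]]
    show "smooth_bil ?W (loc_form \<A> (induced_metric ip \<phi>) c)" by (simp add: loc_form_def[abs_def])
    fix y assume "y \<in> ?W"
    note q = cimgD[OF cA this]
    have lf: "loc_form \<A> (induced_metric ip \<phi>) c y u v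
        = induced_metric ip \<phi> (param c y) (mk_tvec \<A> c (param c y) u) (mk_tvec \<A> c (param c y) v)" for u v
      using comps_eval[OF induced_bilin_at q(4) mk_tvec_tangent[OF q(4)] mk_tvec_tangent[OF q(4)], of u v] q(4)
      by (simp add: loc_form_def)
    show "loc_form \<A> (induced_metric ip \<phi>) c y u v = loc_form \<A> (induced_metric ip \<phi>) c y v u" for u v
      unfolding lf unfolding induced_metric_def
      by (rule fibre_metric_simps(1)) (rule hom_simps(1)[OF mk_tvec_tangent[OF q(4)] tangent_zero])+
    show "0 < loc_form \<A> (induced_metric ip \<phi>) c y u u" if "u \<noteq> 0" for u
      unfolding lf
      by (rule regular_pos[OF q(2) mk_tvec_tangent[OF q(4)]]) (use mk_tvec_self[OF q(4), of u] that in metis)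
  qed
  then show "\<exists>c\<in>charts_at \<A> p. \<exists>V g. metric_field V g \<and> coord c p \<in> V \<and> V \<subseteq> cimg c (regular_points \<A> \<phi>) \<and>
       (\<forall>y\<in>V. \<forall>u v. loc_form \<A> (induced_metric ip \<phi>) c y u v = g y u v)"
    using c cimgI[OF c p] by blast
qed

end

theorem theorem2p3:
  fixes \<A> :: "('m::{t2_space, second_countable_topology}, 'n::finite) chart set"
    and E :: "'m \<Rightarrow> 'e::real_vector set"
    and \<T> :: "('m, 'e, 'n) trivialisation set"
    and ip :: "'m \<Rightarrow> 'e \<Rightarrow> 'e \<Rightarrow> real"
    and D :: "('m \<Rightarrow> ('m, 'n) tvec) \<Rightarrow> ('m \<Rightarrow> 'e) \<Rightarrow> 'm \<Rightarrow> 'e"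
    and \<phi> :: "'m \<Rightarrow> ('m, 'n) tvec \<Rightarrow> 'e"
    and g A g' :: "('m, 'n) tensor2"
    and Rstar :: "'m set"
  assumes "CARD('n) \<ge> 3"
    and "gcf_manifold \<A> E \<T> ip D \<phi>"
    and "g = induced_metric ip \<phi>"
    and "A = schouten \<A> g"
    and "Rstar = {p \<in> regular_points \<A> \<phi>. nondegenerate_at \<A> A p}"
    and "g' = dual_tensor \<A> g A"
  shows "riemannian_metric_on \<A> Rstar g' \<and>
         conformally_flat_on \<A> Rstar g' \<and>
         (\<forall>p\<in>Rstar. \<forall>c\<in>charts_at \<A> p. \<forall>i j.
            comps \<A> g' c p $ i $ j =
              (\<Sum>a\<in>UNIV. \<Sum>b\<in>UNIV. comps \<A> A c p $ i $ a * comps \<A> A c p $ j $ b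
                 * matrix_inv (comps \<A> g c p) $ a $ b)) \<and>
         (\<forall>p\<in>Rstar. \<forall>X\<in>tangent_space \<A> p. \<forall>Y\<in>tangent_space \<A> p.
            schouten \<A> g' p X Y = A p X Y)"
proof -
  have ctb: "smooth_structure \<A>" "vector_bundle \<A> E \<T>" "fibre_metric \<A> E \<T> ip" "tangent_bundle_hom \<A> E \<T> \<phi>"
    and cf: "conformally_flat_on \<A> (regular_points \<A> \<phi>) g"
    using assms(2,3) by (auto simp: gcf_manifold_def coherent_tangent_bundle_def)
  interpret conformally_flat_manifold \<A> "regular_points \<A> \<phi>" g
    by standard (use ctb assms(1) cf induced_riemannian[OF ctb] assms(3) in auto)
  show ?thesis
    unfolding assms(5,6) unfolding assms(4)
    using dual_riemannian dual_conformally_flat_on dual_comps dual_schouten by blast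
qed

end
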